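(* Let $V\subset\mathbf{P}^N(\mathbf{C})$ be a complex projective algebraic variety. Let $D_1,\ldots,D_q$ be $q$ hypersurfaces in $\mathbf{P}^N(\mathbf{C})$ such that $$\dim\Big(\bigcap_{1\le i\le q}\mathrm{Supp}\,D_i\cap V\Big)=0.$$ Let $f:\mathbf{C}\to V$ be a holomorphic curve satisfying $\|f'(z)\|=O(|z|^\sigma)$ as $|z|\to\infty$ for some real $\sigma>-1$. Assume that $\big(\bigcup_{1\le i\le q}\mathrm{Supp}\,D_i\big)\cap f(\mathbf{C})=\emptyset$. Then $$T_f(r)=O(r^{\sigma+1})\qquad (r\to\infty).$$
   Context: A holomorphic curve $f:\mathbf{C}\to V\subset\mathbf{P}^N(\mathbf{C})$ is a holomorphic map $\mathbf{C}\to\mathbf{P}^N(\mathbf{C})$ with image in $V$. A homogeneous representation of $f$ is a tuple $\mathbf{f}=(f_0,\ldots,f_N)$ of entire functions without common zeros with $f=[f_0:\cdots:f_N]$. The Fubini-Study derivative $\|f'\|$ is given by $$\|f'\|^2=\frac{\sum_{i<j}|f_i'f_j-f_if_j'|^2}{\big(\sum_{j=0}^N|f_j|^2\big)^2},$$ which does not depend on the homogeneous representation. The Nevanlinna characteristic is $$T_f(r)=\int_0^r\frac{dt}{t}\Big(\frac1\pi\int_{|z|\le t}\|f'\|^2(z)\,dm_z\Big),$$ where $dm$ is the area element in $\mathbf{C}$. A hypersurface $D$ in $\mathbf{P}^N(\mathbf{C})$ is given by a nonconstant homogeneous polynomial $Q\in\mathbf{C}[X_0,\ldots,X_N]$, and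 $\mathrm{Supp}\,D=\{Q=0\}$. *)

theory Defs
  imports
    "HOL-Complex_Analysis.Complex_Analysis"
    "HOL-Library.Poly_Mapping"
    "HOL-Library.Landau_Symbols"
begin

no_notation fps_nth (infixl \<open>$\<close> 75)

section \<open>Complex projective space\<close>

text \<open>
  The projective space $\mathbf{P}^N(\mathbf{C})$ is the type \<open>'n proj\<close>, where the index type
  \<open>'n\<close> of the homogeneous coordinates has $N + 1$ elements: nonzero vectors up to nonzero scalars.
\<close>

definition proj_rel :: "complex ^ 'n::finite \<Rightarrow> complex ^ 'n \<Rightarrow> bool" where
  "proj_rel v w \<longleftrightarrow> v \<noteq> 0 \<and> w \<noteq> 0 \<and> (\<exists>c. c \<noteq> 0 \<and> w = c *s v)"

lemma part_equivp_proj_rel: "part_equivp (proj_rel :: complex ^ 'n::finite \<Rightarrow> _)"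
proof (rule part_equivpI)
  have "proj_rel (axis undefined 1 :: complex ^ 'n) (axis undefined 1)"
    by (auto simp: proj_rel_def axis_eq_0_iff intro!: exI[of _ 1])
  then show "\<exists>v :: complex ^ 'n. proj_rel v v" by blast
  show "symp (proj_rel :: complex ^ 'n \<Rightarrow> _)"
  proof (rule sympI)
    fix v w :: "complex ^ 'n"
    assume "proj_rel v w"
    then obtain c where "v \<noteq> 0" "w \<noteq> 0" "c \<noteq> 0" "w = c *s v"
      by (auto simp: proj_rel_def)
    then show "proj_rel w v"
      unfolding proj_rel_def by (auto intro!: exI[of _ "inverse c"] simp: vector_smult_assoc)
  qed
  show "transp (proj_rel :: complex ^ 'n \<Rightarrow> _)"
  proof (rule transpI)
    fix u v w :: "complex ^ 'n"
    assume "proj_rel u v" "proj_rel v w"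
    then obtain c d where "u \<noteq> 0" "w \<noteq> 0" "c \<noteq> 0" "v = c *s u" "d \<noteq> 0" "w = d *s v"
      by (auto simp: proj_rel_def)
    then show "proj_rel u w"
      unfolding proj_rel_def by (auto intro!: exI[of _ "d * c"] simp: vector_smult_assoc)
  qed
qed

quotient_type 'n proj = "complex ^ 'n::finite" / partial: proj_rel
  morphisms rep_proj abs_proj
  by (rule part_equivp_proj_rel)

lemma abs_proj_eq_iff:
  assumes "v \<noteq> 0" "w \<noteq> 0"
  shows "abs_proj v = abs_proj w \<longleftrightarrow> (\<exists>c. c \<noteq> 0 \<and> w = c *s v)"
proof -
  have refl: "proj_rel u u" if "u \<noteq> 0" for u :: "complex ^ 'a"
    using that by (auto simp: proj_rel_def intro!: exI[of _ 1])
  have "abs_proj v = abs_proj w \<longleftrightarrow> proj_rel v w"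
    using Quotient3_rel[OF Quotient3_proj, of v w] refl assms by blast
  then show ?thesis using assms by (simp add: proj_rel_def)
qed

lift_definition coord_nonzero :: "'n::finite \<Rightarrow> 'n proj \<Rightarrow> bool" is "\<lambda>i v. v $ i \<noteq> 0"
  by (auto simp: proj_rel_def)

text \<open>The $j$-th affine coordinate in the standard chart in which the $i$-th coordinate is nonzero.\<close>

lift_definition affine_coord :: "'n::finite \<Rightarrow> 'n \<Rightarrow> 'n proj \<Rightarrow> complex" is "\<lambda>i j v. v $ j / v $ i"
  by (auto simp: proj_rel_def)


section \<open>Projective varieties and hypersurfaces\<close>

text \<open>
  The polynomial ring $\mathbf{C}[X_i : i \in {}$\<open>'n\<close>$]$, as the monoid algebra over the monoid of
  exponent vectors.
\<close>

type_synonym 'n cpoly = "('n \<Rightarrow>\<^sub>0 nat) \<Rightarrow>\<^sub>0 complex"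

definition cpoly_eval :: "'n::finite cpoly \<Rightarrow> complex ^ 'n \<Rightarrow> complex" where
  "cpoly_eval Q v =
     (\<Sum>m\<in>Poly_Mapping.keys Q. Poly_Mapping.lookup Q m * (\<Prod>i\<in>UNIV. v $ i ^ Poly_Mapping.lookup m i))"

definition homogeneous :: "nat \<Rightarrow> 'n::finite cpoly \<Rightarrow> bool" where
  "homogeneous d Q \<longleftrightarrow> (\<forall>m\<in>Poly_Mapping.keys Q. (\<Sum>i\<in>UNIV. Poly_Mapping.lookup m i) = d)"

text \<open>
  Only used for sets of homogeneous polynomials, for which vanishing does not depend on the choice of
  homogeneous coordinates.
\<close>

definition zero_locus :: "'n::finite cpoly set \<Rightarrow> 'n proj set" where
  "zero_locus S = {abs_proj v | v. v \<noteq> 0 \<and> (\<forall>Q\<in>S. cpoly_eval Q v = 0)}"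

definition zariski_closed :: "'n::finite proj set \<Rightarrow> bool" where
  "zariski_closed X \<longleftrightarrow> (\<exists>S. (\<forall>Q\<in>S. \<exists>d. homogeneous d Q) \<and> X = zero_locus S)"

text \<open>Varieties are not required to be irreducible.\<close>

abbreviation projective_variety :: "'n::finite proj set \<Rightarrow> bool" where
  "projective_variety V \<equiv> zariski_closed V"

definition zariski_irreducible :: "'n::finite proj set \<Rightarrow> bool" where
  "zariski_irreducible Z \<longleftrightarrow> Z \<noteq> {} \<and>
     (\<forall>A B. zariski_closed A \<and> zariski_closed B \<and> Z \<subseteq> A \<union> B \<longrightarrow> Z \<subseteq> A \<or> Z \<subseteq> B)"

text \<open>
  The Krull dimension of a Zariski closed set: the supremum of the lengths $n$ of chains
  $Z_0 \subset \dots \subset Z_n$ of irreducible closed subsets. The empty set has dimension $-\infty$.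
\<close>

definition zariski_dim :: "'n::finite proj set \<Rightarrow> ereal" where
  "zariski_dim X = Sup {ereal (real n) | n. \<exists>Z :: nat \<Rightarrow> 'n proj set.
     (\<forall>k\<le>n. zariski_closed (Z k) \<and> zariski_irreducible (Z k) \<and> Z k \<subseteq> X) \<and>
     (\<forall>k<n. Z k \<subset> Z (Suc k))}"

definition hypersurface_poly :: "'n::finite cpoly \<Rightarrow> bool" where
  "hypersurface_poly Q \<longleftrightarrow> Q \<noteq> 0 \<and> (\<exists>d>0. homogeneous d Q)"

definition Supp :: "'n::finite cpoly \<Rightarrow> 'n proj set" where
  "Supp Q = zero_locus {Q}"


section \<open>Holomorphic curves\<close>

text \<open>
  Holomorphy with respect to the standard atlas; openness of the preimages of the chart domains is
  continuity.
\<close>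

definition holomorphic_curve :: "(complex \<Rightarrow> 'n::finite proj) \<Rightarrow> bool" where
  "holomorphic_curve f \<longleftrightarrow>
     (\<forall>i. open {z. coord_nonzero i (f z)} \<and>
          (\<forall>j. (\<lambda>z. affine_coord i j (f z)) holomorphic_on {z. coord_nonzero i (f z)}))"

definition homogeneous_rep :: "(complex \<Rightarrow> 'n::finite proj) \<Rightarrow> (complex \<Rightarrow> complex ^ 'n) \<Rightarrow> bool" where
  "homogeneous_rep f F \<longleftrightarrow>
     (\<forall>i. (\<lambda>z. F z $ i) holomorphic_on UNIV) \<and> (\<forall>z. F z \<noteq> 0) \<and> (\<forall>z. f z = abs_proj (F z))"

definition fs_deriv_rep :: "(complex \<Rightarrow> complex ^ 'n::{finite,linorder}) \<Rightarrow> complex \<Rightarrow> real" where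
  "fs_deriv_rep F z = sqrt (
     (\<Sum>(i, j)\<in>{(i, j). i < j}.
        (cmod (deriv (\<lambda>w. F w $ i) z * F z $ j - F z $ i * deriv (\<lambda>w. F w $ j) z))\<^sup>2)
     / (\<Sum>j\<in>UNIV. (cmod (F z $ j))\<^sup>2)\<^sup>2)"

lemma fs_deriv_rep_unique:
  assumes "homogeneous_rep f F" "homogeneous_rep f G"
  shows "fs_deriv_rep F = fs_deriv_rep G"
proof
  fix z
  have nz: "F w \<noteq> 0" "G w \<noteq> 0" for w
    using assms by (auto simp: homogeneous_rep_def)
  have dF: "((\<lambda>w. F w $ i) has_field_derivative deriv (\<lambda>w. F w $ i) z) (at z)"
    and dG: "((\<lambda>w. G w $ i) has_field_derivative deriv (\<lambda>w. G w $ i) z) (at z)" for i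
    using assms by (auto simp: homogeneous_rep_def intro!: holomorphic_derivI)
  have scal: "\<exists>c. c \<noteq> 0 \<and> F w = c *s G w" for w
    using assms abs_proj_eq_iff[OF nz(2,1), of w w] by (metis homogeneous_rep_def)
  obtain c where c: "c \<noteq> 0" "F z = c *s G z" using scal by blast
  obtain i where i: "G z $ i \<noteq> 0" using nz(2)[of z] by (auto simp: vec_eq_iff)
  have cross: "F w $ j * G w $ i = F w $ i * G w $ j" for w j
    using scal[of w] by auto
  define F' where "F' j = deriv (\<lambda>w. F w $ j) z" for j
  define G' where "G' j = deriv (\<lambda>w. G w $ j) z" for j
  define s where "s = (F' i - c * G' i) / G z $ i"
  have F': "F' j = c * G' j + s * G z $ j" for j
  proof -
    have "((\<lambda>w. F w $ j * G w $ i) has_field_derivative F' j * G z $ i + F z $ j * G' i) (at z)"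
      unfolding F'_def G'_def by (auto intro!: derivative_eq_intros dF dG)
    moreover have "((\<lambda>w. F w $ i * G w $ j) has_field_derivative
        F' i * G z $ j + F z $ i * G' j) (at z)"
      unfolding F'_def G'_def by (auto intro!: derivative_eq_intros dF dG)
    ultimately have "F' j * G z $ i + F z $ j * G' i = F' i * G z $ j + F z $ i * G' j"
      by (metis (no_types, lifting) DERIV_unique cross ext)
    then show ?thesis using i c(2) by (simp add: s_def field_simps)
  qed
  have wronskian: "F' a * F z $ b - F z $ a * F' b = c\<^sup>2 * (G' a * G z $ b - G z $ a * G' b)" for a b
    by (simp add: F' c(2) algebra_simps power2_eq_square)
  have "(\<Sum>(a, b)\<in>{(a, b). a < b}. (cmod (F' a * F z $ b - F z $ a * F' b))\<^sup>2) =
      cmod c ^ 4 * (\<Sum>(a, b)\<in>{(a, b). a < b}. (cmod (G' a * G z $ b - G z $ a * G' b))\<^sup>2)"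
    unfolding wronskian sum_distrib_left
    by (intro sum.cong) (auto simp: norm_mult norm_power power_mult_distrib)
  moreover have "(\<Sum>j\<in>UNIV. (cmod (F z $ j))\<^sup>2)\<^sup>2 = cmod c ^ 4 * (\<Sum>j\<in>UNIV. (cmod (G z $ j))\<^sup>2)\<^sup>2"
    by (simp add: c(2) norm_mult power_mult_distrib flip: sum_distrib_left power_mult)
  ultimately show "fs_deriv_rep F z = fs_deriv_rep G z"
    using c(1) unfolding fs_deriv_rep_def F'_def G'_def by simp
qed

text \<open>
  Every holomorphic curve has a homogeneous representation (by the Weierstrass product theorem), and by
  \<open>fs_deriv_rep_unique\<close> the choice does not matter.
\<close>

definition fs_deriv :: "(complex \<Rightarrow> 'n::{finite,linorder} proj) \<Rightarrow> complex \<Rightarrow> real" where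
  "fs_deriv f = fs_deriv_rep (SOME F. homogeneous_rep f F)"

definition nevanlinna_char :: "(complex \<Rightarrow> 'n::{finite,linorder} proj) \<Rightarrow> real \<Rightarrow> real" where
  "nevanlinna_char f r =
     (LINT t:{0..r}|lborel. 1 / t * (1 / pi * (LINT z:cball 0 t|lborel. (fs_deriv f z)\<^sup>2)))"

end

theory Submission
  imports Defs
begin

text \<open>
  The proof follows Eremenko's method for Brody curves omitting hyperplanes. The intersection of \<open>V\<close>
  with all the hypersurfaces is finite, so some linear form \<open>L\<close> does not vanish on it, and by
  compactness \<open>log \<parallel>F\<parallel>\<close> is, up to a bounded error, the maximum of \<open>log \<bar>L F\<bar>\<close> and the functions
  \<open>u\<^sub>i = log \<bar>Q\<^sub>i F\<bar> / deg Q\<^sub>i\<close>, which are harmonic because \<open>f\<close> omits the hypersurfaces.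
  The bound on the derivative says that on discs of radius about \<open>\<bar>z\<bar> powr -\<sigma>\<close> this maximum is within a
  constant of a harmonic function. Under this condition the functions can be dropped from the maximum
  one after another, the first being \<open>log \<bar>L F\<bar>\<close>: where the dropped function exceeds the others, its
  difference with a remaining one is a positive harmonic function on a disc that reaches the zero set
  of the difference, and Harnack's inequality bounds it by \<open>O(\<bar>z\<bar> powr (\<sigma> + 1))\<close>; the remaining maximum
  again satisfies the condition. In the end \<open>log \<parallel>F\<parallel>\<close> differs by \<open>O(\<bar>z\<bar> powr (\<sigma> + 1))\<close> from a single
  harmonic function, and integrating its Laplacian against a cutoff function bounds the area integral
  in the characteristic.
\<close>

section \<open>Real parts of holomorphic functions and the Harnack inequality\<close>

text \<open>The growth rate is a quotient of two scales. On a disc of radius \<open>s\<close>,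
  evaluated at distance \<open>r / 2\<close> from its boundary, Harnack's inequality loses a factor
  of order \<open>s / r\<close>; with \<open>s\<close> at most of order \<open>cmod z\<close> and
  \<open>r\<close> of order \<open>cmod z powr -\<sigma>\<close> this is
  \<open>cmod z powr (\<sigma> + 1)\<close>. To keep \<open>s\<close> that small, constants are
  added to the harmonic functions so that at the origin they agree and are not below
  \<open>log |L F|\<close>. The linear form goes first because \<open>log |L F|\<close> may have
  poles, while a function that touches the maximum at a boundary point of the free disc must be
  harmonic around that point. Each removal costs fixed factors in the domain, the radius and the
  error, and the number of removals is fixed. The harmonic function that remains disappears on
  multiplying \<open>F\<close> by a zero-free entire function, which gives another representation of
  \<open>f\<close>. Two classical facts are needed on the way: a closed set of dimension 0 is
  finite, through Hilbert's basis theorem, and every curve has a global homogeneous representation,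
  through Weierstrass products.\<close>

definition re_holo :: "complex set \<Rightarrow> (complex \<Rightarrow> real) \<Rightarrow> bool" where
  "re_holo S p \<longleftrightarrow> (\<exists>g. g holomorphic_on S \<and> (\<forall>z\<in>S. p z = Re (g z)))"

lemma re_holo_const: "re_holo S (\<lambda>z. c)"
  unfolding re_holo_def by (rule exI[of _ "\<lambda>_. of_real c"]) auto

lemma re_holo_add: "re_holo S p \<Longrightarrow> re_holo S q \<Longrightarrow> re_holo S (\<lambda>z. p z + q z)"
  unfolding re_holo_def by (metis holomorphic_on_add plus_complex.simps(1))

lemma re_holo_diff: "re_holo S p \<Longrightarrow> re_holo S q \<Longrightarrow> re_holo S (\<lambda>z. p z - q z)"
  unfolding re_holo_def by (metis holomorphic_on_diff minus_complex.simps(1))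

lemma re_holo_scale: "re_holo S p \<Longrightarrow> re_holo S (\<lambda>z. c * p z)"
proof -
  assume "re_holo S p"
  then obtain g where "g holomorphic_on S" "\<forall>z\<in>S. p z = Re (g z)" by (auto simp: re_holo_def)
  then show ?thesis
    unfolding re_holo_def by (intro exI[of _ "\<lambda>z. of_real c * g z"]) (auto intro!: holomorphic_intros)
qed

lemma re_holo_mono: "re_holo S p \<Longrightarrow> T \<subseteq> S \<Longrightarrow> re_holo T p"
  unfolding re_holo_def by (meson holomorphic_on_subset subsetD)

lemma re_holo_cong: "(\<And>z. z \<in> S \<Longrightarrow> p z = q z) \<Longrightarrow> re_holo S p \<longleftrightarrow> re_holo S q"
  unfolding re_holo_def by auto

lemma re_holo_imp_continuous_on: "re_holo S p \<Longrightarrow> continuous_on S p"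
  unfolding re_holo_def
  by (metis (no_types, lifting) continuous_on_Re continuous_on_cong holomorphic_on_imp_continuous_on)

text \<open>A convex set carries a holomorphic logarithm of every zero-free holomorphic function.
  Logarithms of moduli of coordinates and of omitted polynomials become harmonic functions in this
  way.\<close>

lemma re_holo_ln_norm:
  assumes "convex S" "g holomorphic_on S" "\<And>z. z \<in> S \<Longrightarrow> g z \<noteq> 0"
  shows "re_holo S (\<lambda>z. ln (cmod (g z)))"
proof -
  obtain G where G: "G holomorphic_on S" "\<And>z. z \<in> S \<Longrightarrow> g z = exp (G z)"
    using contractible_imp_holomorphic_log[OF assms(2) convex_imp_contractible[OF assms(1)] assms(3)] by metis
  have "ln (cmod (g z)) = Re (G z)" if "z \<in> S" for z
    using G(2)[OF that] by (simp add: norm_exp_eq_Re)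
  then show ?thesis unfolding re_holo_def using G(1) by auto
qed

text \<open>Since \<open>g 0\<close> is a positive real, the Cayley transform \<open>\<phi>\<close>
  carries the right half-plane into the unit disc and \<open>g 0\<close> to \<open>0\<close>, so the
  Schwarz lemma applies. The symmetric form of the inequality is equivalent to the usual two-sided
  one.\<close>

lemma harnack_unit:
  assumes g: "g holomorphic_on ball 0 1" and pos: "\<And>z. z \<in> ball 0 1 \<Longrightarrow> Re (g z) > 0"
    and z: "cmod z < 1" and b: "Im (g 0) = 0"
  shows "\<bar>Re (g z) - Re (g 0)\<bar> \<le> cmod z * (Re (g z) + Re (g 0))"
proof -
  define \<phi> where "\<phi> z = (g z - g 0) / (g z + g 0)" for z
  have p0: "Re (g 0) > 0" using pos[of 0] by simp
  have nz: "g z + g 0 \<noteq> 0" if "z \<in> ball 0 1" for z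
    using pos[OF that] p0 by (auto simp: complex_eq_iff)
  have hol: "\<phi> holomorphic_on ball 0 1"
    unfolding \<phi>_def by (intro holomorphic_intros g nz)
  have lt: "cmod (\<phi> w) < 1" if "cmod w < 1" for w
  proof -
    have w: "w \<in> ball 0 1" using that by simp
    have "(cmod (g w - g 0))\<^sup>2 < (cmod (g w + g 0))\<^sup>2"
      using pos[OF w] p0 b unfolding cmod_power2 by (simp add: power2_eq_square algebra_simps)
    then have "cmod (g w - g 0) < cmod (g w + g 0)"
      using power2_less_imp_less norm_ge_zero by blast
    then show ?thesis using nz[OF w] by (simp add: \<phi>_def norm_divide)
  qed
  have le: "cmod (\<phi> z) \<le> cmod z"
    using Schwarz_Lemma(1)[OF hol _ lt z] by (simp add: \<phi>_def)
  have z1: "z \<in> ball 0 1" using z by simp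
  define x y a t where "x = Re (g z)" and "y = Im (g z)" and "a = Re (g 0)" and "t = cmod z"
  have x: "x > 0" "a > 0" using pos[OF z1] p0 by (auto simp: x_def a_def)
  have t: "0 \<le> t" "t < 1" using z by (auto simp: t_def)
  have "cmod (g z - g 0) \<le> t * cmod (g z + g 0)"
    using le nz[OF z1] by (simp add: \<phi>_def norm_divide field_simps t_def)
  then have "(cmod (g z - g 0))\<^sup>2 \<le> (t * cmod (g z + g 0))\<^sup>2"
    by (intro power_mono) auto
  then have "(x - a)\<^sup>2 + y\<^sup>2 \<le> t\<^sup>2 * ((x + a)\<^sup>2 + y\<^sup>2)"
    using b unfolding power_mult_distrib cmod_power2 by (simp add: x_def y_def a_def)
  \<comment> \<open>The imaginary part has factor 1 on the left and \<open>t\<^sup>2 \<le> 1\<close>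
    on the right, so it can be discarded.\<close>
  moreover have "t\<^sup>2 * y\<^sup>2 \<le> 1 * y\<^sup>2"
    using t by (intro mult_right_mono) (auto simp: power_le_one)
  ultimately have "(x - a)\<^sup>2 \<le> (t * (x + a))\<^sup>2"
    unfolding power_mult_distrib by (simp add: distrib_left)
  then have "\<bar>x - a\<bar> \<le> t * (x + a)"
    using x t by (metis abs_le_square_iff abs_of_nonneg add_nonneg_nonneg less_imp_le mult_nonneg_nonneg)
  then show ?thesis by (simp add: x_def a_def t_def)
qed

lemma harnack:
  assumes h: "re_holo (ball z0 s) p" and pos: "\<And>z. z \<in> ball z0 s \<Longrightarrow> p z \<ge> 0"
    and s: "s > 0" and z: "z \<in> ball z0 s"
  shows "\<bar>p z - p z0\<bar> \<le> (dist z0 z / s) * (p z + p z0)"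
proof -
  obtain g where g: "g holomorphic_on ball z0 s" "\<And>z. z \<in> ball z0 s \<Longrightarrow> p z = Re (g z)"
    using h unfolding re_holo_def by auto
  define t where "t = dist z0 z / s"
  have t: "0 \<le> t" "t < 1" using z s by (auto simp: t_def)
  have main: "\<bar>p z - p z0\<bar> \<le> t * (p z + p z0) + e" if "e > 0" for e
  proof -
    \<comment> \<open>Besides rescaling to the unit disc, subtracting \<open>Im (g z0)\<close> makes
      the value at the centre real, and adding \<open>e / 2\<close> makes the real part strictly
      positive, as \<open>harnack_unit\<close> demands.\<close>
    define G where "G w = g (z0 + complex_of_real s * w) - \<i> * Im (g z0) + of_real e / 2" for w
    have sub: "(\<lambda>w. z0 + complex_of_real s * w) ` ball 0 1 \<subseteq> ball z0 s"
      using s by (auto simp: dist_norm norm_mult)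
    have holG: "G holomorphic_on ball 0 1"
      unfolding G_def
      by (intro holomorphic_intros holomorphic_on_compose_gen[OF _ g(1) sub, unfolded o_def])
    have reG: "Re (G w) = p (z0 + complex_of_real s * w) + e / 2" if "w \<in> ball 0 1" for w
    proof -
      have "z0 + complex_of_real s * w \<in> ball z0 s" using sub that by blast
      from g(2)[OF this] show ?thesis by (simp add: G_def)
    qed
    have "\<bar>Re (G ((z - z0) / s)) - Re (G 0)\<bar> \<le> cmod ((z - z0) / s) * (Re (G ((z - z0) / s)) + Re (G 0))"
    proof (rule harnack_unit[OF holG])
      show "Re (G w) > 0" if "w \<in> ball 0 1" for w
      proof -
        have "z0 + complex_of_real s * w \<in> ball z0 s" using sub that by blast
        from pos[OF this] show ?thesis using reG[OF that] \<open>e > 0\<close> by simp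
      qed
      show "cmod ((z - z0) / s) < 1" using z s by (simp add: norm_divide dist_norm norm_minus_commute)
      show "Im (G 0) = 0" by (simp add: G_def)
    qed
    moreover have "(z - z0) / s \<in> ball 0 1" using z s by (simp add: norm_divide dist_norm norm_minus_commute)
    moreover have "cmod ((z - z0) / s) = t" using s by (simp add: t_def norm_divide dist_norm norm_minus_commute)
    ultimately have "\<bar>p z - p z0\<bar> \<le> t * (p z + p z0 + e)"
      using reG[of 0] reG[of "(z - z0) / s"] s by (simp add: add_ac)
    also have "\<dots> \<le> t * (p z + p z0) + e"
      using t that by (simp add: algebra_simps mult_left_le_one_le)
    finally show ?thesis .
  qed
  then show ?thesis unfolding t_def[symmetric] by (rule field_le_epsilon)
qed

lemma harnack_bounds:
  assumes h: "re_holo (ball z0 s) p" and pos: "\<And>z. z \<in> ball z0 s \<Longrightarrow> p z \<ge> 0"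
    and s: "s > 0" and z: "z \<in> ball z0 s" and t: "dist z0 z \<le> t * s" "t < 1"
  shows "p z \<ge> (1 - t) / (1 + t) * p z0" "p z \<le> (1 + t) / (1 - t) * p z0"
proof -
  have t0: "0 \<le> t" using t(1) s by (smt (verit) mult_neg_pos zero_le_dist)
  have p: "p z \<ge> 0" "p z0 \<ge> 0" using pos z s by auto
  have "\<bar>p z - p z0\<bar> \<le> (dist z0 z / s) * (p z + p z0)"
    by (rule harnack[OF h pos s z])
  also have "\<dots> \<le> t * (p z + p z0)"
    using t s p by (intro mult_right_mono) (auto simp: divide_le_eq)
  finally have "\<bar>p z - p z0\<bar> \<le> t * (p z + p z0)" .
  then have "p z * (1 + t) \<ge> (1 - t) * p z0" "p z * (1 - t) \<le> (1 + t) * p z0"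
    by (simp_all add: algebra_simps abs_le_iff)
  then show "p z \<ge> (1 - t) / (1 + t) * p z0" "p z \<le> (1 + t) / (1 - t) * p z0"
    using t t0 by (simp_all add: field_simps)
qed

section \<open>Maxima of harmonic functions\<close>

text \<open>The comparison function may change from disc to disc; only the radius \<open>r\<close>
  and the error \<open>C\<close> are uniform. The centres range over the disc of radius
  \<open>\<rho>\<close>, which the balls themselves may leave.\<close>

definition nearly_re_holo :: "real \<Rightarrow> real \<Rightarrow> real \<Rightarrow> (complex \<Rightarrow> real) \<Rightarrow> bool" where
  "nearly_re_holo \<rho> r C W \<longleftrightarrow>
     (\<forall>z. cmod z \<le> \<rho> \<longrightarrow> (\<exists>h. re_holo (ball z r) h \<and> (\<forall>w\<in>ball z r. \<bar>W w - h w\<bar> \<le> C)))"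

text \<open>The function \<open>h + C - v\<close> is nonnegative on the disc and at most
  \<open>2 * C\<close> at the centre, where \<open>v\<close> touches \<open>W\<close>. Harnack's
  factor 3 on the half disc bounds it by \<open>6 * C\<close> there.\<close>

lemma touching:
  assumes W: "nearly_re_holo \<rho> r C W" and r: "r > 0"
    and z1: "cmod z1 \<le> \<rho>" and v: "re_holo UNIV v" "\<And>z. v z \<le> W z" and eq: "v z1 = W z1"
  obtains h where "re_holo (ball z1 r) h" "\<And>w. w \<in> ball z1 r \<Longrightarrow> \<bar>W w - h w\<bar> \<le> C"
    "\<And>w. dist z1 w \<le> r / 2 \<Longrightarrow> v w \<ge> h w - 5 * C"
proof -
  obtain h where h: "re_holo (ball z1 r) h" "\<And>w. w \<in> ball z1 r \<Longrightarrow> \<bar>W w - h w\<bar> \<le> C"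
    using W z1 unfolding nearly_re_holo_def by auto
  define p where "p w = h w + C - v w" for w
  have hp: "re_holo (ball z1 r) p"
    unfolding p_def by (intro re_holo_add re_holo_diff re_holo_const h re_holo_mono[OF v(1)]) auto
  have pos: "p w \<ge> 0" if "w \<in> ball z1 r" for w
    using h(2)[OF that] v(2)[of w] by (auto simp: p_def abs_le_iff)
  have p1: "p z1 \<le> 2 * C" using h(2)[of z1] eq r by (auto simp: p_def abs_le_iff)
  have "v w \<ge> h w - 5 * C" if "dist z1 w \<le> r / 2" for w
  proof -
    have "p w \<le> (1 + 1/2) / (1 - 1/2) * p z1"
      by (rule harnack_bounds(2)[OF hp pos r]) (use that r in auto)
    then show ?thesis using p1 by (simp add: p_def)
  qed
  then show ?thesis using that h by blast
qed

lemma continuous_on_Max_image: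
  fixes u :: "'i \<Rightarrow> 'a::topological_space \<Rightarrow> real"
  assumes "finite I" "I \<noteq> {}" "\<And>k. k \<in> I \<Longrightarrow> continuous_on S (u k)"
  shows "continuous_on S (\<lambda>z. Max ((\<lambda>k. u k z) ` I))"
  using assms by (induction I rule: finite_ne_induct) (auto intro!: continuous_on_max)

text \<open>
  \<open>W\<close> is the maximum of \<open>U\<close> and one more function, given only through its harmonicity where \<open>W\<close>
  exceeds \<open>U\<close>, so that this function may have logarithmic poles. The proof looks at the largest disc
  around a point \<open>z0\<close> on which \<open>W > U\<close>, and at the index \<open>j\<close> with \<open>u j = W\<close> at a boundary point \<open>z1\<close>.
\<close>

lemma remove_index:
  fixes u :: "'i \<Rightarrow> complex \<Rightarrow> real" and I :: "'i set"
  defines "U \<equiv> \<lambda>z. Max ((\<lambda>k. u k z) ` I)"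
  assumes I: "finite I" "I \<noteq> {}" and u: "\<And>k. k \<in> I \<Longrightarrow> re_holo UNIV (u k)"
    and cont: "continuous_on UNIV W" and le: "\<And>z. U z \<le> W z"
    and harm: "\<And>z s. (\<And>w. w \<in> ball z s \<Longrightarrow> U w < W w) \<Longrightarrow> re_holo (ball z s) W"
    and zero: "W 0 = U 0"
    and near: "nearly_re_holo \<rho> r C W" and r: "r > 0" and C: "C \<ge> 0" and \<rho>: "\<rho> > 0"
  shows "nearly_re_holo (\<rho> / 2) (r / 8) (12 * C) U"
    and "cmod z \<le> \<rho> / 2 \<Longrightarrow> W z - U z \<le> 12 * C * (1 + \<rho> / r)"
proof -
  have Uge: "u k z \<le> U z" if "k \<in> I" for k z using that I by (simp add: U_def)
  have Uex: "\<exists>k\<in>I. u k z = U z" for z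
  proof -
    have "U z \<in> (\<lambda>k. u k z) ` I" unfolding U_def using I by (intro Max_in) auto
    then show ?thesis by force
  qed
  define E where "E = {z. W z \<le> U z}"
  have closedE: "closed E"
    unfolding E_def U_def
    by (intro closed_Collect_le continuous_on_Max_image I cont re_holo_imp_continuous_on u)
  have E0: "0 \<in> E" using zero by (simp add: E_def)
  have main: "\<exists>s z1 j h. j \<in> I \<and> s \<ge> 0 \<and> s \<le> \<rho> / 2 \<and> dist z0 z1 = s \<and> (\<forall>w\<in>ball z0 s. U w < W w) \<and>
      re_holo (ball z1 r) h \<and> (\<forall>w\<in>ball z1 r. \<bar>W w - h w\<bar> \<le> C) \<and>
      (\<forall>w. dist z1 w \<le> r / 2 \<longrightarrow> u j w \<ge> h w - 5 * C) \<and>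
      (s \<le> r / 2 \<longrightarrow> W z0 - u j z0 \<le> 6 * C) \<and> (r / 2 < s \<longrightarrow> W z0 - u j z0 \<le> 24 * C * s / r)"
    if z0: "cmod z0 \<le> \<rho> / 2" for z0
  proof -
    obtain z1 where z1: "z1 \<in> E" "infdist z0 E = dist z0 z1"
      using infdist_attains_inf[OF closedE] E0 by blast
    \<comment> \<open>Since \<open>0\<close> lies in \<open>E\<close>, the distance \<open>s\<close>
      is at most \<open>cmod z0\<close>; this keeps \<open>z1\<close> in the disc of radius
      \<open>\<rho>\<close>, where \<open>near\<close> applies.\<close>
    define s where "s = dist z0 z1"
    have s: "s \<ge> 0" "s \<le> \<rho> / 2" using infdist_le[OF E0, of z0] z1(2) z0 by (auto simp: s_def)
    have free: "U w < W w" if "w \<in> ball z0 s" for w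
    proof (rule ccontr)
      assume "\<not> U w < W w"
      then have "w \<in> E" by (simp add: E_def)
      from infdist_le[OF this, of z0] show False using that z1(2) by (simp add: s_def)
    qed
    obtain j where j: "j \<in> I" "u j z1 = U z1" using Uex by blast
    have eq: "u j z1 = W z1" using j z1(1) le[of z1] by (simp add: E_def)
    have "cmod z1 \<le> cmod z0 + s" unfolding s_def
      by (metis dist_commute dist_norm norm_triangle_sub)
    then have nz1: "cmod z1 \<le> \<rho>" using z0 s by simp
    obtain h where h: "re_holo (ball z1 r) h" "\<And>w. w \<in> ball z1 r \<Longrightarrow> \<bar>W w - h w\<bar> \<le> C"
       "\<And>w. dist z1 w \<le> r / 2 \<Longrightarrow> u j w \<ge> h w - 5 * C"
      using touching[OF near r nz1 u[OF j(1)] order_trans[OF Uge[OF j(1)] le] eq] by metis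
    have six: "W w - u j w \<le> 6 * C" if "dist z1 w \<le> r / 2" for w
      using h(2)[of w] h(3)[OF that] that r by (simp add: abs_le_iff)
    have small: "W z0 - u j z0 \<le> 6 * C" if "s \<le> r / 2"
      by (rule six) (use that in \<open>simp add: s_def dist_commute\<close>)
    have large: "W z0 - u j z0 \<le> 24 * C * s / r" if "r / 2 < s"
    proof -
      have s0: "s > 0" using that r by simp
      \<comment> \<open>Harnack's inequality on the disc of radius \<open>s\<close> is evaluated at
        the point \<open>z2\<close> of the segment from \<open>z0\<close> to \<open>z1\<close> at
        distance \<open>r / 2\<close> from \<open>z1\<close>, where \<open>six\<close> holds. The
        value \<open>1 - t = r / (2 * s)\<close> is the source of the loss
        \<open>s / r\<close>.\<close>
      define t where "t = 1 - r / (2 * s)"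
      have t: "0 \<le> t" "t < 1" using that r s0 by (auto simp: t_def field_simps)
      define z2 where "z2 = z1 + complex_of_real (r / (2 * s)) * (z0 - z1)"
      have ns: "cmod (z0 - z1) = s" by (simp add: s_def dist_norm)
      have d1: "dist z1 z2 \<le> r / 2" using s0 r ns by (simp add: z2_def dist_norm norm_mult norm_divide)
      have "z0 - z2 = complex_of_real t * (z0 - z1)"
        unfolding z2_def t_def by (simp add: algebra_simps)
      then have d2: "dist z0 z2 = t * s" using t ns by (simp add: dist_norm norm_mult)
      have hp: "re_holo (ball z0 s) (\<lambda>w. W w - u j w)"
        by (intro re_holo_diff harm free re_holo_mono[OF u[OF j(1)]]) auto
      have "(1 - t) / (1 + t) * (W z0 - u j z0) \<le> W z2 - u j z2"
        by (rule harnack_bounds(1)[OF hp _ s0])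
          (use d2 t s0 order_trans[OF Uge[OF j(1)] le] in auto)
      also have "\<dots> \<le> 6 * C" by (rule six[OF d1])
      finally have *: "(1 - t) / (1 + t) * (W z0 - u j z0) \<le> 6 * C" .
      have pos: "W z0 - u j z0 \<ge> 0" using free[of z0] Uge[OF j(1), of z0] s0 by simp
      have "(1 - t) / 2 * (W z0 - u j z0) \<le> (1 - t) / (1 + t) * (W z0 - u j z0)"
        by (intro mult_right_mono frac_le) (use t pos in auto)
      with * have "(1 - t) / 2 * (W z0 - u j z0) \<le> 6 * C" by linarith
      then have "r / (4 * s) * (W z0 - u j z0) \<le> 6 * C" by (simp add: t_def)
      then show ?thesis using r s0 by (simp add: field_simps)
    qed
    show ?thesis
      by (intro exI[of _ s] exI[of _ z1] exI[of _ j] exI[of _ h])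
        (use j(1) s free h small large in \<open>auto simp: s_def\<close>)
  qed
  show "W z - U z \<le> 12 * C * (1 + \<rho> / r)" if z: "cmod z \<le> \<rho> / 2" for z
  proof -
    obtain s z1 j where j: "j \<in> I" and s: "s \<ge> 0" "s \<le> \<rho> / 2"
      and small: "s \<le> r / 2 \<longrightarrow> W z - u j z \<le> 6 * C" and large: "r / 2 < s \<longrightarrow> W z - u j z \<le> 24 * C * s / r"
      using main[OF z] by blast
    have "24 * C * s / r \<le> 24 * C * (\<rho> / 2) / r" using s C r by (intro divide_right_mono mult_left_mono) auto
    also have "\<dots> \<le> 12 * C * (1 + \<rho> / r)" using C r by (simp add: field_simps)
    finally have 1: "24 * C * s / r \<le> 12 * C * (1 + \<rho> / r)" .
    have "0 \<le> C * (\<rho> / r)" using C r \<rho> by simp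
    moreover have "12 * C * (1 + \<rho> / r) = 12 * C + 12 * (C * (\<rho> / r))" by (simp add: distrib_left)
    ultimately have 2: "6 * C \<le> 12 * C * (1 + \<rho> / r)" using C by linarith
    show ?thesis using small large 1 2 Uge[OF j, of z] by linarith
  qed
  show "nearly_re_holo (\<rho> / 2) (r / 8) (12 * C) U"
    unfolding nearly_re_holo_def
  proof (intro allI impI)
    fix z0 :: complex assume z0: "cmod z0 \<le> \<rho> / 2"
    obtain s z1 j h where j: "j \<in> I" and s: "s \<ge> 0" "s \<le> \<rho> / 2" "dist z0 z1 = s"
      and free: "\<And>w. w \<in> ball z0 s \<Longrightarrow> U w < W w"
      and h: "re_holo (ball z1 r) h" "\<And>w. w \<in> ball z1 r \<Longrightarrow> \<bar>W w - h w\<bar> \<le> C"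
        "\<And>w. dist z1 w \<le> r / 2 \<Longrightarrow> u j w \<ge> h w - 5 * C"
      and small: "s \<le> r / 2 \<Longrightarrow> W z0 - u j z0 \<le> 6 * C" and large: "r / 2 < s \<Longrightarrow> W z0 - u j z0 \<le> 24 * C * s / r"
      using main[OF z0] by blast
    show "\<exists>h. re_holo (ball z0 (r / 8)) h \<and> (\<forall>w\<in>ball z0 (r / 8). \<bar>U w - h w\<bar> \<le> 12 * C)"
    proof (cases "s \<le> r / 4")
      \<comment> \<open>The small disc lies within \<open>r / 2\<close> of \<open>z1\<close>, so
        \<open>U\<close> is squeezed there: it is at least \<open>u j \<ge> h - 5 * C\<close> and at
        most \<open>W \<le> h + C\<close>.\<close>
      case True
      have sub: "dist z1 w \<le> r / 2" if "w \<in> ball z0 (r / 8)" for w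
        using dist_triangle[of z1 w z0] that s(3) True r by (simp add: dist_commute)
      have "re_holo (ball z0 (r / 8)) h"
        by (rule re_holo_mono[OF h(1)]) (use sub r in force)
      moreover have "\<bar>U w - h w\<bar> \<le> 12 * C" if "w \<in> ball z0 (r / 8)" for w
        using h(2)[of w] h(3)[OF sub[OF that]] Uge[OF j, of w] le[of w] sub[OF that] r C
        by (simp add: abs_le_iff)
      ultimately show ?thesis by blast
    next
      case False
      then have s0: "s > r / 4" "s > 0" using r by auto
      have rs: "r / s < 4" using s0 r by (simp add: field_simps)
      \<comment> \<open>Away from \<open>E\<close> the comparison function is \<open>W - a\<close>,
        which is harmonic near \<open>z0\<close>. Moving from \<open>z0\<close> by the relative
        distance \<open>t\<close> changes a difference \<open>W - u k\<close> by a factor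
        \<open>1 + O(t)\<close>, and \<open>a * t\<close> is of order \<open>C\<close>, because the
        radius \<open>r / 8\<close> balances the bound \<open>24 * C * s / r\<close> for
        \<open>a\<close>.\<close>
      define a where "a = W z0 - U z0"
      have "6 * C \<le> 24 * C * s / r" using s0 r C by (simp add: field_simps mult_left_mono)
      then have "W z0 - u j z0 \<le> 24 * C * s / r" using small large by linarith
      then have a: "0 \<le> a" "a \<le> 24 * C * s / r" using le[of z0] Uge[OF j, of z0] by (auto simp: a_def)
      define t where "t = r / (8 * s)"
      have t: "0 \<le> t" "t < 1 / 2" "t * s = r / 8" using s0 r by (auto simp: t_def field_simps)
      have at: "a * t \<le> 3 * C"
      proof -
        have "a * t \<le> 24 * C * s / r * t" using a t by (intro mult_right_mono) auto
        also have "\<dots> = 3 * C" using s0 r by (simp add: t_def)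
        finally show ?thesis .
      qed
      have sub: "w \<in> ball z0 s" "dist z0 w \<le> t * s" if "w \<in> ball z0 (r / 8)" for w
        using that s0 r t by auto
      have hp: "re_holo (ball z0 s) (\<lambda>w. W w - u k w)" if "k \<in> I" for k
        by (intro re_holo_diff harm free re_holo_mono[OF u[OF that]]) auto
      have pos: "0 \<le> W w - u k w" if "k \<in> I" "w \<in> ball z0 s" for k w
        using free[OF that(2)] Uge[OF that(1), of w] by simp
      have upper: "u k w \<le> W w - a + 6 * C" if "k \<in> I" "w \<in> ball z0 (r / 8)" for k w
      proof -
        have "W w - u k w \<ge> (1 - t) / (1 + t) * (W z0 - u k z0)"
          by (rule harnack_bounds(1)[OF hp[OF that(1)] pos[OF that(1)] s0(2) sub[OF that(2)]]) (use t in auto)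
        moreover have "(1 - t) / (1 + t) * (W z0 - u k z0) \<ge> (1 - t) / (1 + t) * a"
          using t Uge[OF that(1), of z0] by (intro mult_left_mono) (auto simp: a_def)
        moreover have "(1 - t) / (1 + t) \<ge> 1 - 2 * t" using t by (simp add: field_simps)
        then have "(1 - t) / (1 + t) * a \<ge> (1 - 2 * t) * a" using a by (intro mult_right_mono) auto
        ultimately show ?thesis using at by (simp add: algebra_simps)
      qed
      \<comment> \<open>A single index gives the lower bound for \<open>U\<close>: one that attains
        the maximum at \<open>z0\<close>, so that \<open>W - u k\<close> equals \<open>a\<close>
        there.\<close>
      obtain k where k: "k \<in> I" "u k z0 = U z0" using Uex by blast
      have lower: "u k w \<ge> W w - a - 12 * C" if "w \<in> ball z0 (r / 8)" for w
      proof -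
        have "W w - u k w \<le> (1 + t) / (1 - t) * (W z0 - u k z0)"
          by (rule harnack_bounds(2)[OF hp[OF k(1)] pos[OF k(1)] s0(2) sub[OF that]]) (use t in auto)
        moreover have "t * t \<le> t * (1 / 2)" using t by (intro mult_left_mono) auto
        then have "(1 + t) / (1 - t) \<le> 1 + 4 * t" using t by (simp add: field_simps)
        then have "(1 + t) / (1 - t) * a \<le> (1 + 4 * t) * a" using a by (intro mult_right_mono) auto
        ultimately show ?thesis using at k(2) by (simp add: algebra_simps a_def)
      qed
      have "re_holo (ball z0 (r / 8)) (\<lambda>w. W w - a)"
        by (intro re_holo_diff re_holo_const re_holo_mono[OF harm[OF free]]) (use sub in auto)
      moreover have "\<bar>U w - (W w - a)\<bar> \<le> 12 * C" if "w \<in> ball z0 (r / 8)" for w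
      proof -
        obtain l where l: "l \<in> I" "u l w = U w" using Uex by blast
        show ?thesis using upper[OF l(1) that] l(2) lower[OF that] Uge[OF k(1), of w] C
          by (simp add: abs_le_iff)
      qed
      ultimately show ?thesis by blast
    qed
  qed
qed

text \<open>Induction on the number of functions, one being taken off by \<open>remove_index\<close>
  at each step; the common value \<open>M\<close> provides its condition at the origin. The index
  and the constants are chosen before \<open>\<rho>\<close>, \<open>r\<close>, \<open>C\<close> and
  \<open>z\<close>, so one harmonic function serves all scales.\<close>

lemma Max_minus_member_bound:
  fixes u :: "'i \<Rightarrow> complex \<Rightarrow> real" and I :: "'i set"
  assumes "finite I" "I \<noteq> {}" "\<And>k. k \<in> I \<Longrightarrow> re_holo UNIV (u k)" "\<And>k. k \<in> I \<Longrightarrow> u k 0 = M"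
  shows "\<exists>k\<in>I. \<exists>A B. A > 0 \<and> B > 0 \<and> (\<forall>\<rho> r C z. \<rho> > 0 \<longrightarrow> r > 0 \<longrightarrow> C \<ge> 0 \<longrightarrow>
      nearly_re_holo \<rho> r C (\<lambda>z. Max ((\<lambda>k. u k z) ` I)) \<longrightarrow> cmod z \<le> \<rho> / B \<longrightarrow>
      Max ((\<lambda>k. u k z) ` I) - u k z \<le> A * C * (1 + \<rho> / r))"
  using assms
proof (induction I rule: finite_ne_induct)
  case (singleton i)
  show ?case
    by (rule bexI[of _ i], rule exI[of _ 1], rule exI[of _ 1]) auto
next
  case (insert i I)
  let ?U = "\<lambda>z. Max ((\<lambda>k. u k z) ` I)" and ?W = "\<lambda>z. Max ((\<lambda>k. u k z) ` insert i I)"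
  obtain k A B where k: "k \<in> I" and A: "A > 0" and B: "B > 0" and
    IH: "\<And>\<rho> r C z. \<rho> > 0 \<Longrightarrow> r > 0 \<Longrightarrow> C \<ge> 0 \<Longrightarrow> nearly_re_holo \<rho> r C ?U \<Longrightarrow> cmod z \<le> \<rho> / B \<Longrightarrow>
      ?U z - u k z \<le> A * C * (1 + \<rho> / r)"
    using insert.IH[OF insert.prems(1,2)[OF insertI2]] by blast
  have Weq: "?W = (\<lambda>z. max (u i z) (?U z))" using insert.hyps by simp
  have u: "re_holo UNIV (u l)" if "l \<in> insert i I" for l using insert.prems that by blast
  have contW: "continuous_on UNIV ?W"
    by (intro continuous_on_Max_image re_holo_imp_continuous_on u) (use insert.hyps in auto)
  have harm: "re_holo (ball z s) ?W" if "\<And>w. w \<in> ball z s \<Longrightarrow> ?U w < ?W w" for z s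
  proof -
    have "?W w = u i w" if "w \<in> ball z s" for w
      using fun_cong[OF Weq, of w] \<open>\<And>w. w \<in> ball z s \<Longrightarrow> ?U w < ?W w\<close>[OF that] by linarith
    then show ?thesis using re_holo_mono[OF u[of i]] re_holo_cong[of "ball z s" ?W "u i"] by blast
  qed
  have W0: "?W 0 = ?U 0"
  proof -
    have "(\<lambda>k. u k 0) ` I = {M}" using insert.prems insert.hyps by force
    then show ?thesis unfolding Weq using insert.prems by simp
  qed
  have UW: "?U z \<le> ?W z" for z using fun_cong[OF Weq, of z] by linarith
  show ?case
  \<comment> \<open>From \<open>\<rho>\<close>, \<open>r\<close> to \<open>\<rho> / 2\<close>,
    \<open>r / 8\<close> the quotient grows by the factor 4 and the error by 12, whence
    \<open>12 * A * 4\<close>; the summand 12 pays for the passage from \<open>?W\<close> to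
    \<open>?U\<close>. The divisor \<open>2 * B + 2\<close> exceeds both 2 and
    \<open>2 * B\<close>.\<close>
  proof (rule bexI[of _ k], rule exI[of _ "12 * A * 4 + 12"], rule exI[of _ "2 * B + 2"], intro conjI allI impI)
    fix \<rho> r C :: real and z :: complex
    assume *: "\<rho> > 0" "r > 0" "C \<ge> 0" "nearly_re_holo \<rho> r C ?W" "cmod z \<le> \<rho> / (2 * B + 2)"
    note rem = remove_index[OF insert.hyps(1,2) u[OF insertI2] contW UW harm W0 *(4,2,3,1)]
    have "\<rho> / (2 * B + 2) \<le> \<rho> / 2" "\<rho> / (2 * B + 2) \<le> (\<rho> / 2) / B"
      using * B by (auto simp: field_simps)
    then have z: "cmod z \<le> \<rho> / 2" "cmod z \<le> (\<rho> / 2) / B" using *(5) by linarith+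
    have 1: "?W z - ?U z \<le> 12 * C * (1 + \<rho> / r)" using rem(2)[OF _ _ z(1)] by simp
    have 2: "?U z - u k z \<le> A * (12 * C) * (1 + (\<rho> / 2) / (r / 8))"
      using IH[OF _ _ _ rem(1) z(2)] * by simp
    also have "\<dots> \<le> A * (12 * C) * (4 * (1 + \<rho> / r))"
      using A * by (intro mult_left_mono) auto
    finally show "?W z - u k z \<le> (12 * A * 4 + 12) * C * (1 + \<rho> / r)"
      using 1 by (simp add: algebra_simps)
  qed (use A B k in auto)
qed

section \<open>The logarithm of the norm of an entire curve\<close>

definition sqnorm :: "(complex \<Rightarrow> complex ^ 'n::finite) \<Rightarrow> complex \<Rightarrow> real" where
  "sqnorm F z = (\<Sum>j\<in>UNIV. (cmod (F z $ j))\<^sup>2)"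

definition entire_curve :: "(complex \<Rightarrow> complex ^ 'n::finite) \<Rightarrow> bool" where
  "entire_curve F \<longleftrightarrow> (\<forall>i. (\<lambda>z. F z $ i) holomorphic_on UNIV) \<and> (\<forall>z. F z \<noteq> 0)"

lemma sqnorm_pos:
  assumes "entire_curve F"
  shows "sqnorm F z > 0"
proof -
  obtain i where "F z $ i \<noteq> 0"
    using assms unfolding entire_curve_def by (metis vec_eq_iff zero_index)
  then show ?thesis unfolding sqnorm_def by (intro sum_pos2[of _ i]) auto
qed

lemma norm_coord_le_sqnorm: "(cmod (F z $ i))\<^sup>2 \<le> sqnorm F z"
  unfolding sqnorm_def by (rule member_le_sum) auto

lemma wronskian_le:
  fixes F :: "complex \<Rightarrow> complex ^ 'n::{finite,linorder}"
  assumes "entire_curve F"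
  shows "cmod (deriv (\<lambda>w. F w $ i) z * F z $ j - F z $ i * deriv (\<lambda>w. F w $ j) z)
     \<le> fs_deriv_rep F z * sqnorm F z"
proof -
  define w where "w i j = cmod (deriv (\<lambda>w. F w $ i) z * F z $ j - F z $ i * deriv (\<lambda>w. F w $ j) z)" for i j
  have sym: "w i j = w j i" for i j
    unfolding w_def by (subst norm_minus_commute) (simp add: mult.commute)
  have le: "w i j \<le> fs_deriv_rep F z * sqnorm F z" if "i < j" for i j
  proof -
    have "(w i j)\<^sup>2 \<le> (\<Sum>(i, j)\<in>{(i, j). i < j}. (w i j)\<^sup>2)"
      using member_le_sum[of "(i, j)" "{(i, j). i < j}" "\<lambda>(i, j). (w i j)\<^sup>2"] that by force
    then have "w i j \<le> sqrt (\<Sum>(i, j)\<in>{(i, j). i < j}. (w i j)\<^sup>2)"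
      by (rule real_le_rsqrt)
    also have "\<dots> = fs_deriv_rep F z * sqnorm F z"
      using sqnorm_pos[OF assms, of z]
      by (simp add: fs_deriv_rep_def w_def real_sqrt_divide flip: sqnorm_def)
    finally show ?thesis .
  qed
  have ge: "0 \<le> fs_deriv_rep F z * sqnorm F z"
    unfolding fs_deriv_rep_def sqnorm_def
    by (intro mult_nonneg_nonneg real_sqrt_ge_zero divide_nonneg_nonneg sum_nonneg) auto
  show ?thesis
  proof (cases "i = j")
    case False
    then show ?thesis using le[of i j] le[of j i] sym[of i j] unfolding w_def by (metis neqE)
  qed (use ge in simp)
qed

lemma has_derivative_cmod_sq:
  assumes "(f has_field_derivative f') (at z)"
  shows "((\<lambda>z. (cmod (f z))\<^sup>2) has_derivative (\<lambda>h. 2 * Re (cnj (f z) * f' * h))) (at z)"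
proof -
  have "(f has_derivative (\<lambda>h. f' * h)) (at z)" using assms by (simp add: has_field_derivative_def)
  then have "((\<lambda>z. (Re (f z))\<^sup>2 + (Im (f z))\<^sup>2) has_derivative
      (\<lambda>h. 2 * Re (f z) * Re (f' * h) + 2 * Im (f z) * Im (f' * h))) (at z)"
    by (auto intro!: derivative_eq_intros simp: fun_eq_iff algebra_simps)
  then show ?thesis by (simp add: cmod_power2 algebra_simps)
qed

lemma entire_curve_deriv:
  assumes "entire_curve F"
  shows "((\<lambda>w. F w $ i) has_field_derivative deriv (\<lambda>w. F w $ i) z) (at z)"
  using assms by (auto simp: entire_curve_def intro!: holomorphic_derivI)

text \<open>The ratio does not change when \<open>F\<close> is multiplied by a function, so its
  derivative involves only Wronskians: the numerator is the sum of \<open>CARD('n)\<close> terms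
  \<open>T j\<close>, each containing the Wronskian of the coordinates \<open>i\<close> and
  \<open>j\<close>, which \<open>wronskian_le\<close> controls.\<close>

lemma coord_ratio_derivative:
  fixes F :: "complex \<Rightarrow> complex ^ 'n::{finite,linorder}"
  assumes F: "entire_curve F"
  obtains m' where "((\<lambda>z. (cmod (F z $ i))\<^sup>2 / sqnorm F z) has_derivative m') (at z)"
    "\<And>h. \<bar>m' h\<bar> \<le> 2 * CARD('n) * fs_deriv_rep F z * cmod h"
proof -
  define D where "D j = deriv (\<lambda>w. F w $ j) z" for j
  define S where "S = sqnorm F z"
  have S: "S > 0" using sqnorm_pos[OF F] by (simp add: S_def)
  define A' where "A' h j = 2 * Re (cnj (F z $ j) * D j * h)" for h j
  define m' where "m' h = (A' h i * S - (cmod (F z $ i))\<^sup>2 * (\<Sum>j\<in>UNIV. A' h j)) / S\<^sup>2" for h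
  have dA: "((\<lambda>z. (cmod (F z $ j))\<^sup>2) has_derivative (\<lambda>h. A' h j)) (at z)" for j
    unfolding A'_def D_def by (rule has_derivative_cmod_sq[OF entire_curve_deriv[OF F]])
  have dS: "(sqnorm F has_derivative (\<lambda>h. \<Sum>j\<in>UNIV. A' h j)) (at z)"
    unfolding sqnorm_def[abs_def] by (intro has_derivative_sum dA)
  have der: "((\<lambda>z. (cmod (F z $ i))\<^sup>2 / sqnorm F z) has_derivative m') (at z)"
    using S by (intro has_derivative_eq_rhs[OF has_derivative_divide[OF dA dS]])
      (auto simp: m'_def S_def fun_eq_iff field_simps power2_eq_square)
  have "\<bar>m' h\<bar> \<le> 2 * CARD('n) * fs_deriv_rep F z * cmod h" for h
  proof -
    define T where "T j = 2 * Re (cnj (F z $ i) * cnj (F z $ j) * (D i * F z $ j - F z $ i * D j) * h)" for j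
    have T: "T j = A' h i * (cmod (F z $ j))\<^sup>2 - (cmod (F z $ i))\<^sup>2 * A' h j" for j
      unfolding T_def A'_def cmod_power2 by (simp add: algebra_simps power2_eq_square)
    have "A' h i * S - (cmod (F z $ i))\<^sup>2 * (\<Sum>j\<in>UNIV. A' h j) = (\<Sum>j\<in>UNIV. T j)"
      unfolding T S_def sqnorm_def by (simp add: sum_subtractf sum_distrib_left)
    moreover have "\<bar>T j\<bar> \<le> 2 * fs_deriv_rep F z * cmod h * S\<^sup>2" for j
    proof -
      have sq: "cmod (F z $ j) \<le> sqrt S" for j
        using norm_coord_le_sqnorm[of F z j] by (simp add: S_def real_le_rsqrt)
      have Re_le: "\<bar>2 * Re y\<bar> \<le> 2 * cmod y" for y
        using abs_Re_le_cmod[of y] by (simp add: abs_mult)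
      have "\<bar>T j\<bar> \<le> 2 * cmod (cnj (F z $ i) * cnj (F z $ j) * (D i * F z $ j - F z $ i * D j) * h)"
        unfolding T_def by (rule Re_le)
      also have "\<dots> = 2 * (cmod (F z $ i) * cmod (F z $ j) * cmod (D i * F z $ j - F z $ i * D j) * cmod h)"
        by (simp add: norm_mult)
      also have "\<dots> \<le> 2 * (sqrt S * sqrt S * (fs_deriv_rep F z * S) * cmod h)"
        using wronskian_le[OF F, of i z j] sq S
        by (intro mult_left_mono mult_right_mono mult_mono) (auto simp: D_def S_def)
      also have "\<dots> = 2 * fs_deriv_rep F z * cmod h * S\<^sup>2"
        using S by (simp add: power2_eq_square)
      finally show ?thesis .
    qed
    then have "\<bar>\<Sum>j\<in>UNIV. T j\<bar> \<le> CARD('n) * (2 * fs_deriv_rep F z * cmod h * S\<^sup>2)"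
      by (intro order_trans[OF sum_abs] sum_bounded_above[of UNIV "\<lambda>j. \<bar>T j\<bar>", simplified])
    ultimately show ?thesis unfolding m'_def using S by (simp add: field_simps)
  qed
  with der show ?thesis using that by blast
qed

definition log_norm :: "(complex \<Rightarrow> complex ^ 'n::finite) \<Rightarrow> complex \<Rightarrow> real" where
  "log_norm F z = ln (sqnorm F z) / 2"

text \<open>
  The comparison function is \<open>ln \<bar>F\<^sub>i\<bar>\<close> for the largest coordinate \<open>i\<close> at the centre: the ratio
  \<open>\<bar>F\<^sub>i\<bar>\<^sup>2 / \<parallel>F\<parallel>\<^sup>2\<close> has gradient at most \<open>2 n \<parallel>f'\<parallel>\<close>, so it stays away from \<open>0\<close> on the disc.
\<close>

lemma log_norm_near_re_holo:
  fixes F :: "complex \<Rightarrow> complex ^ 'n::{finite,linorder}"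
    and r \<omega> :: real
  assumes F: "entire_curve F" and bd: "\<And>z. z \<in> ball z0 r \<Longrightarrow> fs_deriv_rep F z \<le> \<omega>"
    and \<omega>: "\<omega> > 0" and r: "r * (4 * (real CARD('n))\<^sup>2 * \<omega>) \<le> 1" "r > 0"
  shows "\<exists>h. re_holo (ball z0 r) h \<and> (\<forall>w\<in>ball z0 r. \<bar>log_norm F w - h w\<bar> \<le> ln (2 * real CARD('n)) / 2)"
proof -
  define n where "n = real CARD('n)"
  have n: "n \<ge> 1" by (simp add: n_def Suc_leI)
  have "Max (range (\<lambda>j. cmod (F z0 $ j))) \<in> range (\<lambda>j. cmod (F z0 $ j))" by (rule Max_in) auto
  then obtain i where "Max (range (\<lambda>j. cmod (F z0 $ j))) = cmod (F z0 $ i)" by blast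
  then have i: "cmod (F z0 $ j) \<le> cmod (F z0 $ i)" for j
    using Max_ge[of "range (\<lambda>j. cmod (F z0 $ j))" "cmod (F z0 $ j)"] by auto
  define m where "m z = (cmod (F z $ i))\<^sup>2 / sqnorm F z" for z
  have S: "sqnorm F z > 0" for z by (rule sqnorm_pos[OF F])
  have "sqnorm F z0 \<le> n * (cmod (F z0 $ i))\<^sup>2"
    unfolding sqnorm_def n_def by (rule sum_bounded_above) (use i in \<open>simp add: power_mono\<close>)
  then have m0: "m z0 \<ge> 1 / n" using S[of z0] n by (simp add: m_def field_simps)
  have m1: "m z \<le> 1" for z using norm_coord_le_sqnorm[of F z i] S[of z] by (simp add: m_def)
  have mlow: "m z \<ge> 1 / (2 * n)" if z: "z \<in> ball z0 r" for z
  proof -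
    have "\<forall>x. \<exists>m'. (m has_derivative m') (at x) \<and> (\<forall>h. \<bar>m' h\<bar> \<le> 2 * CARD('n) * fs_deriv_rep F x * cmod h)"
      unfolding m_def[abs_def] using coord_ratio_derivative[OF F] by metis
    then obtain m' where m': "\<And>x. (m has_derivative m' x) (at x)"
       "\<And>x h. \<bar>m' x h\<bar> \<le> 2 * CARD('n) * fs_deriv_rep F x * cmod h" by metis
    have "norm (m z - m z0) \<le> 2 * n * \<omega> * norm (z - z0)"
    proof (rule differentiable_bound[of "ball z0 r" m m'])
      show "(m has_derivative m' x) (at x within ball z0 r)" for x
        using m'(1) by (rule has_derivative_at_withinI)
      show "onorm (m' x) \<le> 2 * n * \<omega>" if "x \<in> ball z0 r" for x
      proof (rule onorm_le)
        fix h
        have "norm (m' x h) \<le> 2 * n * fs_deriv_rep F x * cmod h" using m'(2) by (simp add: n_def)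
        also have "\<dots> \<le> 2 * n * \<omega> * cmod h"
          using n bd[OF that] by (intro mult_left_mono mult_right_mono) auto
        finally show "norm (m' x h) \<le> 2 * n * \<omega> * cmod h" .
      qed
    qed (use z r in auto)
    also have "\<dots> \<le> 2 * n * \<omega> * r"
      using z n \<omega> by (intro mult_left_mono) (auto simp: dist_norm norm_minus_commute)
    \<comment> \<open>The hypothesis on \<open>r\<close> is calibrated here: over the radius of the
      disc the ratio loses at most half of the lower bound \<open>1 / n\<close> that holds at the
      centre.\<close>
    also have "\<dots> \<le> 1 / (2 * n)" using r n by (simp add: field_simps power2_eq_square n_def)
    finally have "m z \<ge> m z0 - 1 / (2 * n)" by (simp add: abs_le_iff)
    moreover have "1 / n - 1 / (2 * n) = 1 / (2 * n)" using n by (simp add: field_simps)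
    ultimately show ?thesis using m0 by linarith
  qed
  have nz: "F z $ i \<noteq> 0" if "z \<in> ball z0 r" for z
    using mlow[OF that] n by (auto simp: m_def)
  have "re_holo (ball z0 r) (\<lambda>z. ln (cmod (F z $ i)))"
    by (rule re_holo_ln_norm[OF convex_ball _ nz]) (use F holomorphic_on_subset in \<open>auto simp: entire_curve_def\<close>)
  moreover have "\<bar>log_norm F w - ln (cmod (F w $ i))\<bar> \<le> ln (2 * real CARD('n)) / 2" if w: "w \<in> ball z0 r" for w
  proof -
    have pos: "m w > 0" using mlow[OF w] n by (smt (verit) divide_pos_pos)
    have "ln (m w) = 2 * ln (cmod (F w $ i)) - 2 * log_norm F w"
      unfolding m_def log_norm_def using nz[OF w] S[of w] by (simp add: ln_div ln_realpow)
    moreover have "ln (m w) \<le> 0" using m1[of w] pos by simp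
    moreover have "ln (m w) \<ge> - ln (2 * n)"
    proof -
      have "ln (1 / (2 * n)) \<le> ln (m w)" using mlow[OF w] n pos by (subst ln_le_cancel_iff) auto
      then show ?thesis using n by (simp add: ln_div)
    qed
    ultimately show ?thesis by (simp add: n_def abs_le_iff)
  qed
  ultimately show ?thesis by blast
qed

section \<open>Growth of the logarithm of the norm\<close>

lemma nearly_re_holo_shift:
  assumes "nearly_re_holo \<rho> r C V" "\<And>z. \<bar>W z - V z\<bar> \<le> d"
  shows "nearly_re_holo \<rho> r (C + d) W"
  unfolding nearly_re_holo_def
proof (intro allI impI)
  fix z :: complex assume "cmod z \<le> \<rho>"
  then obtain h where h: "re_holo (ball z r) h" "\<And>w. w \<in> ball z r \<Longrightarrow> \<bar>V w - h w\<bar> \<le> C"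
    using assms(1) unfolding nearly_re_holo_def by blast
  have "\<bar>W w - h w\<bar> \<le> C + d" if "w \<in> ball z r" for w
    using h(2)[OF that] assms(2)[of w] by linarith
  with h(1) show "\<exists>h. re_holo (ball z r) h \<and> (\<forall>w\<in>ball z r. \<bar>W w - h w\<bar> \<le> C + d)" by blast
qed

lemma Max_image_diff_le:
  fixes u v :: "'i \<Rightarrow> real"
  assumes "finite I" "I \<noteq> {}" "\<And>k. k \<in> I \<Longrightarrow> \<bar>u k - v k\<bar> \<le> d"
  shows "\<bar>Max (u ` I) - Max (v ` I)\<bar> \<le> d"
proof -
  have *: "Max (u ` I) \<le> Max (v ` I) + d" if bd: "\<And>k. k \<in> I \<Longrightarrow> \<bar>u k - v k\<bar> \<le> d" for u v :: "'i \<Rightarrow> real"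
  proof -
    have "u k \<le> Max (v ` I) + d" if k: "k \<in> I" for k
    proof -
      have "v k \<le> Max (v ` I)" using assms(1) k by (intro Max_ge) auto
      then show ?thesis using bd[OF k] by linarith
    qed
    then show ?thesis using assms(1,2) by simp
  qed
  show ?thesis using *[of u v] *[of v u] assms(3) by (simp add: abs_minus_commute abs_le_iff)
qed

text \<open>
  The function \<open>ln (max \<bar>g\<bar> (exp m))\<close> is used for the maximum of \<open>m\<close> and \<open>ln \<bar>g\<bar>\<close> because \<open>ln 0 = 0\<close> here.
\<close>

lemma log_norm_growth_nonneg:
  fixes F :: "complex \<Rightarrow> complex ^ 'n::{finite,linorder}" and u :: "'i \<Rightarrow> complex \<Rightarrow> real"
  assumes F: "entire_curve F" and fs: "\<And>z. fs_deriv_rep F z \<le> K * (1 + cmod z) powr \<sigma>" and \<sigma>: "\<sigma> \<ge> 0"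
    and g: "g holomorphic_on UNIV" and I: "finite I" "I \<noteq> {}" and u: "\<And>k. k \<in> I \<Longrightarrow> re_holo UNIV (u k)"
    and comp: "\<And>z. \<bar>ln (max (cmod (g z)) (exp (Max ((\<lambda>k. u k z) ` I)))) - log_norm F z\<bar> \<le> C0"
  shows "\<exists>k\<in>I. \<exists>C. \<forall>z. \<bar>log_norm F z - u k z\<bar> \<le> C * (1 + cmod z) powr (\<sigma> + 1)"
proof -
  \<comment> \<open>The shifted functions \<open>v k\<close> all equal \<open>M\<close> at the
    origin, and \<open>exp M\<close> is at least \<open>cmod (g 0)\<close>. Hence \<open>W\<close>
    and \<open>V\<close> agree at the origin, as \<open>remove_index\<close> requires.\<close>
  define M where "M = ln (1 + cmod (g 0))"
  have M: "cmod (g 0) \<le> exp M" by (simp add: M_def add_pos_nonneg)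
  define v where "v k z = u k z + (M - u k 0)" for k z
  define d where "d = Max ((\<lambda>k. \<bar>M - u k 0\<bar>) ` I)"
  have d: "\<bar>M - u k 0\<bar> \<le> d" if "k \<in> I" for k using that I by (simp add: d_def)
  have d0: "d \<ge> 0" using d I by fastforce
  define U where "U z = Max ((\<lambda>k. u k z) ` I)" for z
  define V where "V z = Max ((\<lambda>k. v k z) ` I)" for z
  define W where "W z = ln (max (cmod (g z)) (exp (V z)))" for z
  have UV: "\<bar>V z - U z\<bar> \<le> d" for z
    unfolding U_def V_def by (rule Max_image_diff_le[OF I]) (use d in \<open>auto simp: v_def\<close>)
  have W_U: "\<bar>W z - ln (max (cmod (g z)) (exp (U z)))\<bar> \<le> d" for z
  proof -
    have *: "ln (max (cmod (g z)) (exp a)) \<le> ln (max (cmod (g z)) (exp b)) + d" if "\<bar>a - b\<bar> \<le> d" for a b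
    proof -
      have "exp a \<le> exp d * exp b" using that by (simp flip: exp_add)
      moreover have "1 * cmod (g z) \<le> exp d * cmod (g z)" using d0 by (intro mult_right_mono) auto
      ultimately have "max (cmod (g z)) (exp a) \<le> exp d * max (cmod (g z)) (exp b)"
        by (simp add: max_mult_distrib_left max.coboundedI1 max.coboundedI2)
      then have "ln (max (cmod (g z)) (exp a)) \<le> ln (exp d * max (cmod (g z)) (exp b))"
        by (subst ln_le_cancel_iff) (auto simp: less_max_iff_disj)
      also have "\<dots> = ln (max (cmod (g z)) (exp b)) + d"
      proof -
        have "max (cmod (g z)) (exp b) > 0" by (simp add: less_max_iff_disj)
        then show ?thesis by (subst ln_mult) auto
      qed
      finally show ?thesis .
    qed
    show ?thesis using *[OF UV[of z]] *[of "U z" "V z"] UV[of z] unfolding W_def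
      by (simp add: abs_le_iff)
  qed
  have WL: "\<bar>W z - log_norm F z\<bar> \<le> C0 + d" for z
    using W_U[of z] comp[of z] unfolding U_def by linarith
  have C0: "C0 \<ge> 0" using comp[of 0] by linarith
  define n where "n = real CARD('n)"
  have n: "n \<ge> 1" by (simp add: n_def Suc_leI)
  define C1 where "C1 = ln (2 * n) / 2 + (C0 + d)"
  have C1: "C1 \<ge> 0" using n C0 d0 by (simp add: C1_def)
  define K1 where "K1 = max K 1"
  have contV: "continuous_on UNIV V" unfolding V_def v_def
    by (intro continuous_on_Max_image I continuous_intros re_holo_imp_continuous_on u)
  have hv: "re_holo UNIV (v k)" if "k \<in> I" for k
    unfolding v_def by (intro re_holo_add re_holo_const u that)
  have v0: "v k 0 = M" for k by (simp add: v_def)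
  have V0: "V 0 = M" using I by (simp add: V_def v0)
  have contW: "continuous_on UNIV W" unfolding W_def
    by (intro continuous_intros contV holomorphic_on_imp_continuous_on[OF g])
       (auto simp: max_def)
  have VW: "V z \<le> W z" for z
  proof -
    have "ln (exp (V z)) \<le> W z" unfolding W_def by (subst ln_le_cancel_iff) (auto simp: less_max_iff_disj)
    then show ?thesis by simp
  qed
  have harm: "re_holo (ball z s) W" if "\<And>w. w \<in> ball z s \<Longrightarrow> V w < W w" for z s
  proof -
    have *: "exp (V w) < cmod (g w)" if "w \<in> ball z s" for w
    proof (rule ccontr)
      assume "\<not> exp (V w) < cmod (g w)"
      then have "W w = V w" by (simp add: W_def max_def)
      with \<open>\<And>w. w \<in> ball z s \<Longrightarrow> V w < W w\<close>[OF that] show False by simp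
    qed
    then have "W w = ln (cmod (g w))" if "w \<in> ball z s" for w
      using *[OF that] by (simp add: W_def max_def)
    moreover have "re_holo (ball z s) (\<lambda>w. ln (cmod (g w)))"
    proof (rule re_holo_ln_norm)
      show "convex (ball z s)" by (rule convex_ball)
      show "g holomorphic_on ball z s" using g holomorphic_on_subset by blast
      show "g w \<noteq> 0" if "w \<in> ball z s" for w
        using *[OF that] exp_gt_zero[of "V w"] by (metis norm_zero not_less_iff_gr_or_eq order_less_trans)
    qed
    ultimately show ?thesis using re_holo_cong[of "ball z s" W "\<lambda>w. ln (cmod (g w))"] by simp
  qed
  have W0: "W 0 = V 0" using M by (simp add: W_def V0 max_def)
  have "\<exists>k\<in>I. \<exists>A B. A > 0 \<and> B > 0 \<and> (\<forall>\<rho> r C z. \<rho> > 0 \<longrightarrow> r > 0 \<longrightarrow> C \<ge> 0 \<longrightarrow>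
      nearly_re_holo \<rho> r C V \<longrightarrow> cmod z \<le> \<rho> / B \<longrightarrow> V z - v k z \<le> A * C * (1 + \<rho> / r))"
    unfolding V_def by (rule Max_minus_member_bound[OF I hv v0])
  then obtain k A B where k: "k \<in> I" and A: "A > 0" and B: "B > 0" and
    chain: "\<And>\<rho> r C z. \<rho> > 0 \<Longrightarrow> r > 0 \<Longrightarrow> C \<ge> 0 \<Longrightarrow> nearly_re_holo \<rho> r C V \<Longrightarrow> cmod z \<le> \<rho> / B \<Longrightarrow>
      V z - v k z \<le> A * C * (1 + \<rho> / r)"
    by blast
  define L where "L = 4 * n\<^sup>2 * K1 * (2 * B + 4) powr (\<sigma> + 1)"
  define C where "C = C0 + d + d + (48 * A + 12) * C1 * (1 + L)"
  have "\<bar>log_norm F z - u k z\<bar> \<le> C * (1 + cmod z) powr (\<sigma> + 1)" for z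
  proof -
    define x where "x = 1 + cmod z"
    have x: "x \<ge> 1" by (simp add: x_def)
    \<comment> \<open>The factor leaves room for \<open>z\<close> both in the disc where
      \<open>g\<close> is removed and in the smaller one that is left after removing functions
      \<open>v k\<close>, starting from \<open>\<rho> / 2\<close>.\<close>
    define \<rho> where "\<rho> = (2 * B + 2) * x"
    have \<rho>: "\<rho> > 0" using B x by (simp add: \<rho>_def)
    have z: "cmod z \<le> \<rho> / 2" "cmod z \<le> (\<rho> / 2) / B"
      using B by (auto simp: \<rho>_def x_def field_simps add_nonneg_nonneg)
    define \<omega> where "\<omega> = K1 * (2 + \<rho>) powr \<sigma>"
    have \<omega>1: "\<omega> \<ge> 1"
    proof -
      have "1 * 1 \<le> \<omega>" unfolding \<omega>_def
        by (intro mult_mono ge_one_powr_ge_zero) (use \<rho> \<sigma> in \<open>auto simp: K1_def\<close>)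
      then show ?thesis by simp
    qed
    \<comment> \<open>The largest radius that \<open>log_norm_near_re_holo\<close> allows for the
      bound \<open>\<omega>\<close>. Being at most 1, it keeps discs with centre in radius
      \<open>\<rho>\<close> inside radius \<open>\<rho> + 1\<close>, where \<open>\<omega>\<close>
      bounds the derivative.\<close>
    define r where "r = 1 / (4 * n\<^sup>2 * \<omega>)"
    have r: "r > 0" using n \<omega>1 by (simp add: r_def)
    have "1 \<le> n\<^sup>2" using n by simp
    then have "1 * 1 \<le> (4 * n\<^sup>2) * \<omega>" using \<omega>1 by (intro mult_mono) auto
    then have r1: "r \<le> 1" using r by (simp add: r_def)
    have "nearly_re_holo \<rho> r (ln (2 * n) / 2) (log_norm F)"
      unfolding nearly_re_holo_def
    proof (intro allI impI)
      fix w assume w: "cmod w \<le> \<rho>"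
      show "\<exists>h. re_holo (ball w r) h \<and> (\<forall>wa\<in>ball w r. \<bar>log_norm F wa - h wa\<bar> \<le> ln (2 * n) / 2)"
        unfolding n_def
      proof (rule log_norm_near_re_holo[OF F])
        show "fs_deriv_rep F y \<le> \<omega>" if "y \<in> ball w r" for y
        proof -
          have "cmod y \<le> \<rho> + 1"
            using that w r1 norm_triangle_ineq2[of y w] by (simp add: dist_norm norm_minus_commute)
          have "fs_deriv_rep F y \<le> K * (1 + cmod y) powr \<sigma>" by (rule fs)
          also have "\<dots> \<le> K1 * (1 + cmod y) powr \<sigma>" by (intro mult_right_mono) (auto simp: K1_def)
          also have "\<dots> \<le> \<omega>" unfolding \<omega>_def using \<open>cmod y \<le> \<rho> + 1\<close> \<sigma>
            by (intro mult_left_mono powr_mono2) (auto simp: K1_def)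
          finally show ?thesis .
        qed
      qed (use r \<omega>1 n in \<open>auto simp: r_def n_def\<close>)
    qed
    from nearly_re_holo_shift[OF this WL] have near: "nearly_re_holo \<rho> r C1 W" by (simp add: C1_def)
    note rem = remove_index[OF I hv contW VW[unfolded V_def] harm[unfolded V_def] W0[unfolded V_def] near r C1 \<rho>,
        folded V_def]
    have 1: "W z - V z \<le> 12 * C1 * (1 + \<rho> / r)" using rem(2)[OF _ _ z(1)] by simp
    have "V z - v k z \<le> A * (12 * C1) * (1 + (\<rho> / 2) / (r / 8))"
      using chain[OF _ _ _ rem(1) z(2)] \<rho> r C1 by simp
    also have "\<dots> \<le> A * (12 * C1) * (4 * (1 + \<rho> / r))"
      using A C1 by (intro mult_left_mono) auto
    finally have 2: "V z - v k z \<le> 48 * A * C1 * (1 + \<rho> / r)" by (simp add: algebra_simps)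
    \<comment> \<open>The quotient \<open>\<rho> / r\<close> produces the exponent
      \<open>\<sigma> + 1\<close>: one power comes from the size of the domain, the exponent
      \<open>\<sigma>\<close> from the derivative bound inside \<open>r\<close>.\<close>
    define y where "y = x powr (\<sigma> + 1)"
    have y: "y \<ge> 1" using x \<sigma> by (simp add: y_def ge_one_powr_ge_zero)
    have "\<rho> / r = 4 * n\<^sup>2 * K1 * (\<rho> * (2 + \<rho>) powr \<sigma>)" by (simp add: r_def \<omega>_def)
    also have "\<dots> \<le> 4 * n\<^sup>2 * K1 * ((2 + \<rho>) powr 1 * (2 + \<rho>) powr \<sigma>)"
      using \<rho> n by (intro mult_left_mono mult_right_mono) (auto simp: K1_def)
    also have "\<dots> = 4 * n\<^sup>2 * K1 * (2 + \<rho>) powr (\<sigma> + 1)"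
      using \<rho> by (simp add: powr_add)
    also have "\<dots> \<le> 4 * n\<^sup>2 * K1 * ((2 * B + 4) powr (\<sigma> + 1) * y)"
    proof (rule mult_left_mono)
      have "(2 + \<rho>) powr (\<sigma> + 1) \<le> ((2 * B + 4) * x) powr (\<sigma> + 1)"
        using \<rho> x \<sigma> by (intro powr_mono2) (auto simp: \<rho>_def algebra_simps)
      also have "\<dots> = (2 * B + 4) powr (\<sigma> + 1) * y"
        unfolding y_def by (rule powr_mult)
      finally show "(2 + \<rho>) powr (\<sigma> + 1) \<le> (2 * B + 4) powr (\<sigma> + 1) * y" .
    qed (simp add: K1_def)
    finally have "\<rho> / r \<le> L * y" by (simp only: L_def mult.assoc)
    then have "1 + \<rho> / r \<le> (1 + L) * y" using y by (simp add: algebra_simps)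
    then have "(48 * A + 12) * C1 * (1 + \<rho> / r) \<le> (48 * A + 12) * C1 * ((1 + L) * y)"
      using A C1 by (intro mult_left_mono) auto
    moreover have "C0 + d + d \<le> (C0 + d + d) * y"
      using C0 d0 y mult_left_mono[of 1 y "C0 + d + d"] by simp
    moreover have "\<bar>log_norm F z - u k z\<bar> \<le> C0 + d + d + (48 * A + 12) * C1 * (1 + \<rho> / r)"
    proof -
      have e: "v k z - u k z = M - u k 0" by (simp add: v_def)
      have "v k z \<le> V z" using k I by (simp add: V_def)
      then have "\<bar>W z - v k z\<bar> \<le> (48 * A + 12) * C1 * (1 + \<rho> / r)"
        using 1 2 VW[of z] by (simp add: abs_le_iff algebra_simps)
      then show ?thesis using WL[of z] d[OF k] e by linarith
    qed
    ultimately show ?thesis unfolding C_def x_def[symmetric] y_def[symmetric] by (simp add: algebra_simps)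
  qed
  with k show ?thesis by blast
qed

section \<open>Negative exponents \<open>\<sigma>\<close> and substitution of a power\<close>

lemma one_plus_power_le: "(1 + x) ^ N \<le> 2 ^ N * (1 + x ^ N)" if "x \<ge> (0::real)"
proof -
  have "(1 + x) ^ N \<le> (2 * max 1 x) ^ N" using that by (intro power_mono) auto
  also have "\<dots> = 2 ^ N * (max 1 x) ^ N" by (simp add: power_mult_distrib)
  also have "(max 1 x) ^ N \<le> 1 + x ^ N" using that by (auto simp: max_def)
  finally show ?thesis by simp
qed

lemma fs_deriv_rep_compose_power:
  fixes F :: "complex \<Rightarrow> complex ^ 'n::{finite,linorder}"
  assumes F: "entire_curve F"
  shows "fs_deriv_rep (\<lambda>z. F (z ^ N)) z = real N * cmod z ^ (N - 1) * fs_deriv_rep F (z ^ N)"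
proof -
  define c where "c = of_nat N * z ^ (N - 1)"
  have d: "deriv (\<lambda>w. F (w ^ N) $ i) z = c * deriv (\<lambda>w. F w $ i) (z ^ N)" for i
    by (rule DERIV_imp_deriv, rule DERIV_cong[OF DERIV_chain2[OF entire_curve_deriv[OF F]]])
      (auto intro!: derivative_eq_intros simp: c_def)
  have "(\<Sum>(i, j)\<in>{(i, j). i < j}. (cmod (deriv (\<lambda>w. F (w ^ N) $ i) z * F (z ^ N) $ j -
            F (z ^ N) $ i * deriv (\<lambda>w. F (w ^ N) $ j) z))\<^sup>2) =
     (cmod c)\<^sup>2 * (\<Sum>(i, j)\<in>{(i, j). i < j}. (cmod (deriv (\<lambda>w. F w $ i) (z ^ N) * F (z ^ N) $ j -
            F (z ^ N) $ i * deriv (\<lambda>w. F w $ j) (z ^ N)))\<^sup>2)"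
    unfolding sum_distrib_left d
    by (intro sum.cong refl) (auto simp flip: power_mult_distrib norm_mult simp: algebra_simps)
  then have "fs_deriv_rep (\<lambda>z. F (z ^ N)) z = cmod c * fs_deriv_rep F (z ^ N)"
    by (simp add: fs_deriv_rep_def real_sqrt_mult flip: times_divide_eq_right)
  then show ?thesis by (simp add: c_def norm_mult norm_power)
qed

text \<open>
  The case \<open>\<sigma> < 0\<close> is reduced to the previous one by composing with \<open>z \<mapsto> z ^ N\<close>, which turns
  \<open>\<sigma>\<close> into \<open>N (\<sigma> + 1) - 1\<close>.
\<close>

lemma log_norm_growth:
  fixes F :: "complex \<Rightarrow> complex ^ 'n::{finite,linorder}" and u :: "'i \<Rightarrow> complex \<Rightarrow> real"
  assumes F: "entire_curve F" and fs: "\<And>z. fs_deriv_rep F z \<le> K * (1 + cmod z) powr \<sigma>" and \<sigma>: "\<sigma> > -1"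
    and g: "g holomorphic_on UNIV" and I: "finite I" "I \<noteq> {}" and u: "\<And>k. k \<in> I \<Longrightarrow> re_holo UNIV (u k)"
    and comp: "\<And>z. \<bar>ln (max (cmod (g z)) (exp (Max ((\<lambda>k. u k z) ` I)))) - log_norm F z\<bar> \<le> C0"
  shows "\<exists>k\<in>I. \<exists>C. \<forall>z. \<bar>log_norm F z - u k z\<bar> \<le> C * (1 + cmod z) powr (\<sigma> + 1)"
proof (cases "\<sigma> \<ge> 0")
  case True
  from log_norm_growth_nonneg[OF F fs True g I u comp] show ?thesis .
next
  case False
  obtain N where "1 / (\<sigma> + 1) < real N" using reals_Archimedean2 by blast
  then have N: "real N * (\<sigma> + 1) > 1" using \<sigma> by (simp add: field_simps)
  then have N0: "N > 0" by (cases N) auto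
  define \<sigma>' where "\<sigma>' = real N * (\<sigma> + 1) - 1"
  define K' where "K' = N * (max K 0 * 2 powr (- real N * \<sigma>))"
  define G where "G z = F (z ^ N)" for z
  have G: "entire_curve G"
    unfolding entire_curve_def
  proof (intro conjI allI)
    show "(\<lambda>z. G z $ i) holomorphic_on UNIV" for i
    proof -
      have pw: "(\<lambda>z :: complex. z ^ N) holomorphic_on UNIV" by (intro holomorphic_intros)
      have "(\<lambda>z. F z $ i) holomorphic_on UNIV" using F by (simp add: entire_curve_def)
      from holomorphic_on_compose_gen[OF pw this] show ?thesis by (simp add: o_def G_def)
    qed
    show "G z \<noteq> 0" for z using F by (simp add: G_def entire_curve_def)
  qed
  have fsG: "fs_deriv_rep G z \<le> K' * (1 + cmod z) powr \<sigma>'" for z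
  proof -
    define x where "x = cmod z"
    have x: "x \<ge> 0" by (simp add: x_def)
    \<comment> \<open>Because \<open>\<sigma>\<close> is negative here, an upper bound of the power
      calls for the lower bound \<open>(1 + x) ^ N / 2 ^ N\<close> of its base.\<close>
    have "(1 + x ^ N) powr \<sigma> \<le> ((1 + x) ^ N / 2 ^ N) powr \<sigma>"
      using False x one_plus_power_le[OF x, of N] by (intro powr_mono2') (auto simp: field_simps)
    also have "\<dots> = 2 powr (- real N * \<sigma>) * (1 + x) powr (real N * \<sigma>)"
      using x by (simp add: powr_divide powr_minus powr_powr field_simps flip: powr_realpow)
    finally have 0: "(1 + x ^ N) powr \<sigma> \<le> 2 powr (- real N * \<sigma>) * (1 + x) powr (real N * \<sigma>)" .
    have "fs_deriv_rep F (z ^ N) \<le> K * (1 + x ^ N) powr \<sigma>" using fs[of "z ^ N"] by (simp add: x_def norm_power)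
    also have "\<dots> \<le> max K 0 * (1 + x ^ N) powr \<sigma>" by (intro mult_right_mono) auto
    also have "\<dots> \<le> max K 0 * (2 powr (- real N * \<sigma>) * (1 + x) powr (real N * \<sigma>))"
      by (intro mult_left_mono 0) auto
    finally have 1: "fs_deriv_rep F (z ^ N) \<le> max K 0 * 2 powr (- real N * \<sigma>) * (1 + x) powr (real N * \<sigma>)"
      by (simp only: mult.assoc)
    have 2: "x ^ (N - 1) \<le> (1 + x) powr (real N - 1)"
    proof -
      have "x ^ (N - 1) \<le> (1 + x) ^ (N - 1)" using x by (intro power_mono) auto
      also have "\<dots> = (1 + x) powr (real N - 1)" using x N0 by (simp flip: powr_realpow add: of_nat_diff)
      finally show ?thesis .
    qed
    have "fs_deriv_rep G z = real N * (x ^ (N - 1) * fs_deriv_rep F (z ^ N))"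
      unfolding G_def by (simp add: fs_deriv_rep_compose_power[OF F] x_def)
    also have "\<dots> \<le> real N * ((1 + x) powr (real N - 1) * (max K 0 * 2 powr (- real N * \<sigma>) * (1 + x) powr (real N * \<sigma>)))"
      using 1 2 by (intro mult_left_mono mult_mono)
        (auto simp: fs_deriv_rep_def intro!: divide_nonneg_nonneg sum_nonneg)
    also have "\<dots> = K' * ((1 + x) powr (real N - 1) * (1 + x) powr (real N * \<sigma>))"
      by (simp add: K'_def)
    also have "(1 + x) powr (real N - 1) * (1 + x) powr (real N * \<sigma>) = (1 + x) powr \<sigma>'"
      by (subst powr_add[symmetric]) (simp add: \<sigma>'_def algebra_simps)
    finally show ?thesis by (simp add: x_def)
  qed
  have pw: "(\<lambda>z :: complex. z ^ N) holomorphic_on UNIV" by (intro holomorphic_intros)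
  have uG: "re_holo UNIV (\<lambda>z. u k (z ^ N))" if k: "k \<in> I" for k
  proof -
    obtain q where q: "q holomorphic_on UNIV" "\<And>z. u k z = Re (q z)"
      using u[OF k] unfolding re_holo_def by auto
    have "(\<lambda>z. q (z ^ N)) holomorphic_on UNIV"
      using holomorphic_on_compose_gen[OF pw q(1)] by (simp add: o_def)
    then show ?thesis using q(2) unfolding re_holo_def by auto
  qed
  have gG: "(\<lambda>z. g (z ^ N)) holomorphic_on UNIV"
    using holomorphic_on_compose_gen[OF pw g] by (simp add: o_def)
  have lG: "log_norm G z = log_norm F (z ^ N)" for z by (simp add: log_norm_def sqnorm_def G_def)
  obtain k C where k: "k \<in> I" and
    C: "\<And>z. \<bar>log_norm G z - u k (z ^ N)\<bar> \<le> C * (1 + cmod z) powr (\<sigma>' + 1)"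
    using log_norm_growth_nonneg[OF G fsG _ gG I uG comp[of "_ ^ N", folded lG]] N
    by (auto simp: \<sigma>'_def)
  have C0: "C \<ge> 0" using C[of 0] by simp
  have "\<bar>log_norm F z - u k z\<bar> \<le> (C * (2 ^ N) powr (\<sigma> + 1)) * (1 + cmod z) powr (\<sigma> + 1)" for z
  proof -
    \<comment> \<open>The functions composed with the power depend on \<open>w\<close> only through
      \<open>w ^ N\<close>, and the majorant only through \<open>cmod w\<close>, so any root of
      \<open>z\<close> serves.\<close>
    obtain w where w: "w ^ N = z"
      using exists_complex_root[of N z] N0 by auto
    define x where "x = cmod w"
    have x: "x \<ge> 0" by (simp add: x_def)
    have cz: "cmod z = x ^ N" using w by (auto simp: x_def norm_power)
    have "(1 + x) powr (\<sigma>' + 1) = ((1 + x) ^ N) powr (\<sigma> + 1)"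
      using x by (simp add: \<sigma>'_def powr_powr flip: powr_realpow)
    also have "\<dots> \<le> (2 ^ N * (1 + x ^ N)) powr (\<sigma> + 1)"
      using \<sigma> x one_plus_power_le[OF x, of N] by (intro powr_mono2) auto
    also have "\<dots> = (2 ^ N) powr (\<sigma> + 1) * (1 + x ^ N) powr (\<sigma> + 1)"
      by (rule powr_mult)
    finally have "(1 + x) powr (\<sigma>' + 1) \<le> (2 ^ N) powr (\<sigma> + 1) * (1 + x ^ N) powr (\<sigma> + 1)" .
    then have "C * (1 + x) powr (\<sigma>' + 1) \<le> C * ((2 ^ N) powr (\<sigma> + 1) * (1 + x ^ N) powr (\<sigma> + 1))"
      using C0 by (rule mult_left_mono)
    moreover have "\<bar>log_norm F z - u k z\<bar> \<le> C * (1 + x) powr (\<sigma>' + 1)"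
      using C[of w] w by (simp add: lG x_def)
    ultimately have "\<bar>log_norm F z - u k z\<bar> \<le> C * ((2 ^ N) powr (\<sigma> + 1) * (1 + x ^ N) powr (\<sigma> + 1))"
      by linarith
    then show ?thesis by (simp only: cz mult.assoc)
  qed
  with k show ?thesis by blast
qed

section \<open>The Nevanlinna characteristic\<close>

text \<open>The sum over all ordered pairs counts each unordered pair twice, and expanding the
  squares in terms of conjugates factors it into products of single sums. With \<open>a\<close> the
  derivative and \<open>b\<close> the curve, it turns the Fubini-Study numerator into the Gram
  determinant that the Laplacian produces.\<close>

lemma lagrange_identity:
  fixes a b :: "'n::{finite,linorder} \<Rightarrow> complex"
  shows "(\<Sum>(i, j)\<in>{(i, j). i < j}. (cmod (a i * b j - b i * a j))\<^sup>2) =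
    (\<Sum>i\<in>UNIV. (cmod (a i))\<^sup>2) * (\<Sum>i\<in>UNIV. (cmod (b i))\<^sup>2) - (cmod (\<Sum>i\<in>UNIV. cnj (b i) * a i))\<^sup>2"
proof -
  define w where "w i j = (cmod (a i * b j - b i * a j))\<^sup>2" for i j
  have sym: "w i j = w j i" for i j
    unfolding w_def by (subst norm_minus_commute) (simp add: mult.commute)
  have diag: "w i i = 0" for i by (simp add: w_def)
  have split: "(UNIV :: ('n \<times> 'n) set) = {(i, j). i < j} \<union> ({(i, j). j < i} \<union> {(i, j). i = j})"
    by auto
  have "(\<Sum>(i, j)\<in>UNIV. w i j) = (\<Sum>(i, j)\<in>{(i, j). i < j}. w i j) +
      ((\<Sum>(i, j)\<in>{(i, j). j < i}. w i j) + (\<Sum>(i, j)\<in>{(i, j). i = j}. w i j))"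
    by (subst split, subst sum.union_disjoint, simp, simp, force,
        subst sum.union_disjoint, simp, simp, force) simp
  also have "(\<Sum>(i, j)\<in>{(i, j). i = j}. w i j) = 0"
    by (intro sum.neutral) (auto simp: diag)
  also have "(\<Sum>(i, j)\<in>{(i, j). j < i}. w i j) = (\<Sum>(i, j)\<in>{(i, j). i < j}. w i j)"
    by (rule sum.reindex_bij_witness[of _ prod.swap prod.swap]) (auto simp: sym)
  finally have 1: "(\<Sum>(i, j)\<in>UNIV. w i j) = 2 * (\<Sum>(i, j)\<in>{(i, j). i < j}. w i j)" by simp
  have w: "complex_of_real (w i j) =
      complex_of_real ((cmod (a i))\<^sup>2 * (cmod (b j))\<^sup>2) + complex_of_real ((cmod (b i))\<^sup>2 * (cmod (a j))\<^sup>2)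
      - (cnj (b i) * a i) * cnj (cnj (b j) * a j) - cnj (cnj (b i) * a i) * (cnj (b j) * a j)" for i j
    unfolding w_def of_real_mult complex_norm_square by (simp add: algebra_simps)
  define P where "P = (\<Sum>i\<in>UNIV. cnj (b i) * a i)"
  define A B where "A = (\<Sum>i\<in>UNIV. (cmod (a i))\<^sup>2)" and "B = (\<Sum>i\<in>UNIV. (cmod (b i))\<^sup>2)"
  have "complex_of_real (\<Sum>(i, j)\<in>UNIV. w i j) = (\<Sum>i\<in>UNIV. \<Sum>j\<in>UNIV. complex_of_real (w i j))"
    by (simp add: sum.cartesian_product split_def flip: UNIV_Times_UNIV)
  also have "\<dots> = A * B + B * A - P * cnj P - cnj P * P"
    unfolding w P_def A_def B_def
    by (simp add: sum.distrib sum_subtractf sum_product)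
  also have "\<dots> = complex_of_real (2 * (A * B - (cmod P)\<^sup>2))"
    unfolding of_real_mult of_real_diff complex_norm_square by simp
  finally have "(\<Sum>(i, j)\<in>UNIV. w i j) = 2 * (A * B - (cmod P)\<^sup>2)"
    using of_real_eq_iff by blast
  with 1 show ?thesis unfolding w_def A_def B_def P_def by simp
qed

text \<open>The Hermitian product of \<open>G\<close> and \<open>F\<close>, linear in
  \<open>G\<close> and antilinear in \<open>F\<close>.\<close>

definition herm :: "(complex \<Rightarrow> complex ^ 'n::finite) \<Rightarrow> (complex \<Rightarrow> complex ^ 'n) \<Rightarrow> complex \<Rightarrow> complex" where
  "herm G F z = (\<Sum>j\<in>UNIV. cnj (F z $ j) * G z $ j)"

definition vderiv :: "(complex \<Rightarrow> complex ^ 'n::finite) \<Rightarrow> complex \<Rightarrow> complex ^ 'n" where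
  "vderiv F z = (\<chi> i. deriv (\<lambda>w. F w $ i) z)"

text \<open>The second derivative of \<open>log_norm F\<close> in the direction of the unit complex number \<open>e\<close>.\<close>

definition log_norm_dd :: "(complex \<Rightarrow> complex ^ 'n::finite) \<Rightarrow> complex \<Rightarrow> complex \<Rightarrow> real" where
  "log_norm_dd F e z = (sqnorm (vderiv F) z + Re (e\<^sup>2 * herm (vderiv (vderiv F)) F z)) / sqnorm F z
     - 2 * (Re (e * herm (vderiv F) F z))\<^sup>2 / (sqnorm F z)\<^sup>2"

text \<open>The terms with \<open>e\<^sup>2\<close> cancel between the directions 1 and
  \<open>\<i>\<close>, and the squares of the real and imaginary parts of
  \<open>herm (vderiv F) F z\<close> add up to its squared modulus. Lagrange's identity recognises
  the rest.\<close>

lemma laplacian_log_norm: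
  assumes F: "entire_curve F"
  shows "log_norm_dd F 1 z + log_norm_dd F \<i> z = 2 * (fs_deriv_rep F z)\<^sup>2"
proof -
  have S: "sqnorm F z > 0" by (rule sqnorm_pos[OF F])
  have "(fs_deriv_rep F z)\<^sup>2 = (sqnorm (vderiv F) z * sqnorm F z - (cmod (herm (vderiv F) F z))\<^sup>2) / (sqnorm F z)\<^sup>2"
  proof -
    define X where "X = (\<Sum>(i, j)\<in>{(i, j). i < j}.
        (cmod (deriv (\<lambda>w. F w $ i) z * F z $ j - F z $ i * deriv (\<lambda>w. F w $ j) z))\<^sup>2)"
    have "X = sqnorm (vderiv F) z * sqnorm F z - (cmod (herm (vderiv F) F z))\<^sup>2"
      unfolding X_def lagrange_identity by (simp add: sqnorm_def vderiv_def herm_def)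
    moreover have "X \<ge> 0" unfolding X_def by (intro sum_nonneg) auto
    moreover have "fs_deriv_rep F z = sqrt (X / (sqnorm F z)\<^sup>2)"
      by (simp add: fs_deriv_rep_def X_def sqnorm_def)
    ultimately show ?thesis by simp
  qed
  moreover have "(q + r) / s - 2 * x\<^sup>2 / s\<^sup>2 + ((q - r) / s - 2 * y\<^sup>2 / s\<^sup>2) = 2 * ((q * s - (x\<^sup>2 + y\<^sup>2)) / s\<^sup>2)"
    if "s > 0" for q r x y s :: real
    using that by (simp add: field_simps power2_eq_square)
  from this[OF S, of "sqnorm (vderiv F) z" "Re (herm (vderiv (vderiv F)) F z)" "Re (herm (vderiv F) F z)"
     "Im (herm (vderiv F) F z)"]
  have "log_norm_dd F 1 z + log_norm_dd F \<i> z =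
      2 * ((sqnorm (vderiv F) z * sqnorm F z - (cmod (herm (vderiv F) F z))\<^sup>2) / (sqnorm F z)\<^sup>2)"
    unfolding log_norm_dd_def cmod_power2 by simp
  ultimately show ?thesis by simp
qed

lemma vderiv_holomorphic:
  assumes "\<And>i. (\<lambda>z. F z $ i) holomorphic_on UNIV"
  shows "(\<lambda>z. vderiv F z $ i) holomorphic_on UNIV"
  using holomorphic_deriv[OF assms, of i] by (simp add: vderiv_def)

text \<open>The squared norm is not holomorphic; restricting to lines makes its second derivatives
  ordinary derivatives in one real variable, to which one-dimensional integration by parts
  applies.\<close>

lemma has_vector_derivative_line:
  assumes "\<And>i. (\<lambda>z. F z $ i) holomorphic_on UNIV"
  shows "((\<lambda>t. F (z + of_real t * e) $ i) has_vector_derivative e * vderiv F (z + of_real t * e) $ i) (at t)"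
proof -
  have "((\<lambda>w. F w $ i) has_field_derivative vderiv F (z + of_real t * e) $ i) (at (z + of_real t * e))"
    unfolding vderiv_def using assms by (auto intro!: holomorphic_derivI)
  moreover have "((\<lambda>t. z + of_real t * e) has_vector_derivative e) (at t)"
    by (auto intro!: derivative_eq_intros simp: has_vector_derivative_def scaleR_conv_of_real)
  ultimately show ?thesis
    using field_vector_diff_chain_at[of "\<lambda>t. z + of_real t * e" e t "\<lambda>w. F w $ i"] by (simp add: o_def)
qed

lemma sqnorm_line_derivative:
  fixes F :: "complex \<Rightarrow> complex ^ 'n::finite"
  assumes F: "\<And>i. (\<lambda>z. F z $ i) holomorphic_on UNIV"
  shows "((\<lambda>t. sqnorm F (z + of_real t * e)) has_real_derivative 2 * Re (e * herm (vderiv F) F (z + of_real t * e))) (at t)"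
proof -
  have "((\<lambda>t. (Re (F (z + of_real t * e) $ j))\<^sup>2 + (Im (F (z + of_real t * e) $ j))\<^sup>2) has_real_derivative
     2 * Re (e * (cnj (F (z + of_real t * e) $ j) * vderiv F (z + of_real t * e) $ j))) (at t)" for j
  proof -
    note d = has_vector_derivative_line[OF F, of z e j t]
    have re: "((\<lambda>t. Re (F (z + of_real t * e) $ j)) has_real_derivative Re (e * vderiv F (z + of_real t * e) $ j)) (at t)"
      and im: "((\<lambda>t. Im (F (z + of_real t * e) $ j)) has_real_derivative Im (e * vderiv F (z + of_real t * e) $ j)) (at t)"
      using d by (auto simp: has_vector_derivative_complex_iff)
    show ?thesis
      by (rule DERIV_cong[OF DERIV_add[OF DERIV_power[OF re, of 2] DERIV_power[OF im, of 2]]])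
        (simp add: algebra_simps)
  qed
  then have "((\<lambda>t. \<Sum>j\<in>UNIV. (Re (F (z + of_real t * e) $ j))\<^sup>2 + (Im (F (z + of_real t * e) $ j))\<^sup>2) has_real_derivative
     (\<Sum>j\<in>UNIV. 2 * Re (e * (cnj (F (z + of_real t * e) $ j) * vderiv F (z + of_real t * e) $ j)))) (at t)"
    by (intro DERIV_sum)
  then show ?thesis by (simp only: sqnorm_def herm_def cmod_power2 sum_distrib_left Re_sum)
qed

lemma herm_line_derivative:
  fixes F :: "complex \<Rightarrow> complex ^ 'n::finite"
  assumes F: "\<And>i. (\<lambda>z. F z $ i) holomorphic_on UNIV" and e: "cmod e = 1"
  shows "((\<lambda>t. Re (e * herm (vderiv F) F (z + of_real t * e))) has_real_derivative
     sqnorm (vderiv F) (z + of_real t * e) + Re (e\<^sup>2 * herm (vderiv (vderiv F)) F (z + of_real t * e))) (at t)"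
proof -
  have e2: "cnj e * e = 1" using e complex_norm_square[of e] by (simp add: mult.commute)
  have "((\<lambda>t. e * (cnj (F (z + of_real t * e) $ j) * vderiv F (z + of_real t * e) $ j)) has_vector_derivative
     (of_real ((cmod (vderiv F (z + of_real t * e) $ j))\<^sup>2)
       + e\<^sup>2 * (cnj (F (z + of_real t * e) $ j) * vderiv (vderiv F) (z + of_real t * e) $ j))) (at t)" for j
  proof -
    note d1 = has_vector_derivative_cnj[OF has_vector_derivative_line[OF F, of z e j t]]
    note d2 = has_vector_derivative_line[OF vderiv_holomorphic[OF F], of z e j t]
    have eq: "e * (cnj (F w $ j) * (e * D2) + cnj (e * D) * D) = of_real ((cmod D)\<^sup>2) + e\<^sup>2 * (cnj (F w $ j) * D2)"
      for w D D2
    proof -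
      have "e * (cnj (F w $ j) * (e * D2) + cnj (e * D) * D) = (cnj e * e) * (D * cnj D) + e\<^sup>2 * (cnj (F w $ j) * D2)"
        by (simp add: algebra_simps power2_eq_square)
      then show ?thesis unfolding e2 complex_norm_square by simp
    qed
    show ?thesis
      using has_vector_derivative_mult_right[OF has_vector_derivative_mult[OF d1 d2], of e]
      unfolding eq by simp
  qed
  then have "((\<lambda>t. \<Sum>j\<in>UNIV. e * (cnj (F (z + of_real t * e) $ j) * vderiv F (z + of_real t * e) $ j)) has_vector_derivative
     (\<Sum>j\<in>UNIV. (of_real ((cmod (vderiv F (z + of_real t * e) $ j))\<^sup>2)
       + e\<^sup>2 * (cnj (F (z + of_real t * e) $ j) * vderiv (vderiv F) (z + of_real t * e) $ j)))) (at t)"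
    by (intro has_vector_derivative_sum)
  then have "((\<lambda>t. e * herm (vderiv F) F (z + of_real t * e)) has_vector_derivative
     of_real (sqnorm (vderiv F) (z + of_real t * e)) + e\<^sup>2 * herm (vderiv (vderiv F)) F (z + of_real t * e)) (at t)"
    by (simp add: herm_def sqnorm_def sum_distrib_left sum.distrib)
  then show ?thesis by (auto simp: has_vector_derivative_complex_iff)
qed

lemma log_norm_line_derivatives:
  assumes F: "entire_curve F" and e: "cmod e = 1"
  shows "((\<lambda>t. log_norm F (z + of_real t * e)) has_real_derivative
      Re (e * herm (vderiv F) F (z + of_real t * e)) / sqnorm F (z + of_real t * e)) (at t)"
    and "((\<lambda>t. Re (e * herm (vderiv F) F (z + of_real t * e)) / sqnorm F (z + of_real t * e)) has_real_derivative
      log_norm_dd F e (z + of_real t * e)) (at t)"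
proof -
  have hF: "(\<lambda>z. F z $ i) holomorphic_on UNIV" for i using F by (simp add: entire_curve_def)
  have S: "sqnorm F w > 0" for w by (rule sqnorm_pos[OF F])
  note d = sqnorm_line_derivative[OF hF, of z e t]
  note dd = herm_line_derivative[OF hF e, of z t]
  show "((\<lambda>t. log_norm F (z + of_real t * e)) has_real_derivative
      Re (e * herm (vderiv F) F (z + of_real t * e)) / sqnorm F (z + of_real t * e)) (at t)"
    unfolding log_norm_def
    by (rule DERIV_cong[OF DERIV_cdivide[OF DERIV_chain2[OF DERIV_ln_divide[OF S] d]]])
       (simp add: field_simps del: times_complex.sel)
  show "((\<lambda>t. Re (e * herm (vderiv F) F (z + of_real t * e)) / sqnorm F (z + of_real t * e)) has_real_derivative
      log_norm_dd F e (z + of_real t * e)) (at t)"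
    by (rule DERIV_cong[OF DERIV_divide[OF dd d]])
       (use S[of "z + of_real t * e"] in \<open>auto simp: log_norm_dd_def field_simps power2_eq_square\<close>)
qed

section \<open>Integration of the Laplacian against a cutoff function on a square\<close>

definition bump :: "real \<Rightarrow> real \<Rightarrow> real" where "bump a x = (a\<^sup>2 - x\<^sup>2)\<^sup>2"
definition bump_dd :: "real \<Rightarrow> real \<Rightarrow> real" where "bump_dd a x = 12 * x\<^sup>2 - 4 * a\<^sup>2"

text \<open>The polynomial \<open>bump a\<close> has double zeros at \<open>a\<close> and
  \<open>-a\<close>, so both boundary terms vanish; \<open>bump_dd a\<close> is its second
  derivative and \<open>- 4 * x * (a\<^sup>2 - x\<^sup>2)\<close> its first.\<close>

lemma integration_by_parts_twice:
  fixes g g' g'' :: "real \<Rightarrow> real"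
  assumes "\<And>t. (g has_real_derivative g' t) (at t)" "\<And>t. (g' has_real_derivative g'' t) (at t)" "a \<ge> 0"
  shows "((\<lambda>x. bump a x * g'' x - bump_dd a x * g x) has_integral 0) {-a..a}"
proof -
  define G where "G x = bump a x * g' x + 4 * x * (a\<^sup>2 - x\<^sup>2) * g x" for x
  have "(G has_real_derivative (bump a x * g'' x - bump_dd a x * g x)) (at x)" for x
    unfolding G_def bump_def bump_dd_def
    by (auto intro!: derivative_eq_intros assms(1,2) simp: algebra_simps power2_eq_square)
  then have "((\<lambda>x. bump a x * g'' x - bump_dd a x * g x) has_integral G a - G (-a)) {-a..a}"
    using assms(3) by (intro fundamental_theorem_of_calculus)
      (auto simp: has_real_derivative_iff_has_vector_derivative intro: has_vector_derivative_at_within)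
  then show ?thesis by (simp add: G_def bump_def)
qed

lemma continuous_on_sqnorm:
  assumes "\<And>i. continuous_on UNIV (\<lambda>z. F z $ i)"
  shows "continuous_on UNIV (sqnorm F)"
  unfolding sqnorm_def by (intro continuous_intros assms)

lemma continuous_on_log_norm:
  assumes F: "entire_curve F"
  shows "continuous_on UNIV (log_norm F)"
proof -
  have "continuous_on UNIV (\<lambda>z. F z $ i)" for i
    using F by (auto simp: entire_curve_def intro: holomorphic_on_imp_continuous_on)
  from continuous_on_sqnorm[OF this] show ?thesis
    unfolding log_norm_def
    by (intro continuous_intros) (use sqnorm_pos[OF F] in \<open>auto simp: less_imp_neq[symmetric]\<close>)
qed

lemma continuous_on_log_norm_dd:
  assumes F: "entire_curve F"
  shows "continuous_on UNIV (log_norm_dd F e)"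
proof -
  have h: "(\<lambda>z. F z $ i) holomorphic_on UNIV" for i using F by (simp add: entire_curve_def)
  note h1 = vderiv_holomorphic[OF h] note h2 = vderiv_holomorphic[OF h1]
  note c = h[THEN holomorphic_on_imp_continuous_on] h1[THEN holomorphic_on_imp_continuous_on]
     h2[THEN holomorphic_on_imp_continuous_on]
  have nz: "sqnorm F z \<noteq> 0" for z using sqnorm_pos[OF F, of z] by simp
  note cs = continuous_on_sqnorm[of F, OF c(1)] continuous_on_sqnorm[of "vderiv F", OF c(2)]
  have herm: "continuous_on UNIV (herm (vderiv (vderiv F)) F)" "continuous_on UNIV (herm (vderiv F) F)"
    unfolding herm_def by (intro continuous_on_sum continuous_on_mult continuous_on_cnj c)+
  have "continuous_on UNIV (\<lambda>z. e\<^sup>2 * herm (vderiv (vderiv F)) F z)" "continuous_on UNIV (\<lambda>z. e * herm (vderiv F) F z)"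
    by (intro continuous_on_mult continuous_on_const herm)+
  from this[THEN continuous_on_Re] show ?thesis
    unfolding log_norm_dd_def using nz
    by (intro continuous_on_diff continuous_on_divide continuous_on_add continuous_on_mult
      continuous_on_power continuous_on_const cs) auto
qed

lemma continuous_on_fs_deriv_rep_sq:
  assumes F: "entire_curve F"
  shows "continuous_on UNIV (\<lambda>z. (fs_deriv_rep F z)\<^sup>2)"
proof -
  have "(\<lambda>z. (fs_deriv_rep F z)\<^sup>2) = (\<lambda>z. (log_norm_dd F 1 z + log_norm_dd F \<i> z) / 2)"
    by (simp add: laplacian_log_norm[OF F])
  then show ?thesis by (simp only:) (intro continuous_intros continuous_on_log_norm_dd[OF F], auto)
qed

lemma continuous_on_plane:
  assumes "continuous_on UNIV (g :: complex \<Rightarrow> real)"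
  shows "continuous_on S (\<lambda>p. g (Complex (fst p) (snd p)))"
  by (rule continuous_on_compose2[OF assms]) (auto intro!: continuous_intros)

text \<open>On each line parallel to the direction of differentiation the integral is zero by parts,
  and Fubini's theorem does the rest. For direction 1 the variables are swapped so that this line
  integral is the inner one.\<close>

lemma integral_bump_log_norm_dd:
  fixes F :: "complex \<Rightarrow> complex ^ 'n::finite"
  assumes F: "entire_curve F" and a: "a > 0"
  shows "integral (cbox (-a,-a) (a,a)) (\<lambda>(x, y). bump a x * bump a y * log_norm_dd F 1 (Complex x y)
           - bump_dd a x * bump a y * log_norm F (Complex x y)) = 0" (is "integral _ ?A = 0")
    and "integral (cbox (-a,-a) (a,a)) (\<lambda>(x, y). bump a x * bump a y * log_norm_dd F \<i> (Complex x y)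
           - bump a x * bump_dd a y * log_norm F (Complex x y)) = 0" (is "integral _ ?B = 0")
proof -
  note cp = continuous_on_plane[OF continuous_on_log_norm_dd[OF F]] continuous_on_plane[OF continuous_on_log_norm[OF F]]
  have contA: "continuous_on S ?A" and contB: "continuous_on S ?B" for S
    unfolding split_def bump_def bump_dd_def
    by (intro continuous_intros cp)+
  have line: "((\<lambda>t. bump a t * log_norm_dd F e (z + of_real t * e) - bump_dd a t * log_norm F (z + of_real t * e))
      has_integral 0) {-a..a}" if "cmod e = 1" for e z
    by (rule integration_by_parts_twice[OF log_norm_line_derivatives[OF F that]]) (use a in auto)
  have "integral {-a..a} (\<lambda>y. ?B (x, y)) = 0" for x
  proof -
    have "Complex x 0 + of_real y * \<i> = Complex x y" for y by (simp add: complex_eq_iff)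
    with line[of \<i> "Complex x 0"]
    have "((\<lambda>y. bump a y * log_norm_dd F \<i> (Complex x y) - bump_dd a y * log_norm F (Complex x y))
      has_integral 0) {-a..a}" by simp
    from integral_unique[OF has_integral_mult_right[OF this, of "bump a x"]]
    show ?thesis by (simp add: algebra_simps)
  qed
  then show "integral (cbox (-a,-a) (a,a)) ?B = 0"
    by (subst integral_prod_continuous[OF contB]) simp
  have "integral {-a..a} (\<lambda>x. ?A (x, y)) = 0" for y
  proof -
    have "Complex 0 y + of_real x * 1 = Complex x y" for x by (simp add: complex_eq_iff)
    with line[of 1 "Complex 0 y"]
    have "((\<lambda>x. bump a x * log_norm_dd F 1 (Complex x y) - bump_dd a x * log_norm F (Complex x y))
      has_integral 0) {-a..a}" by simp
    from integral_unique[OF has_integral_mult_right[OF this, of "bump a y"]]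
    show ?thesis by (simp add: algebra_simps)
  qed
  moreover have "integral (cbox (-a,-a) (a,a)) ?A = integral (cbox (-a,-a) (a,a)) (\<lambda>(y, x). ?A (x, y))"
    by (subst integral_swap_2dim[OF contA]) simp
  moreover have "continuous_on (cbox (-a,-a) (a,a)) (\<lambda>(y, x). ?A (x, y))"
    by (rule swap_continuous) (use contA in simp)
  ultimately show "integral (cbox (-a,-a) (a,a)) ?A = 0"
    by (simp add: integral_prod_continuous)
qed

text \<open>The Laplacian moves from \<open>log_norm F\<close> to the cutoff function, whose
  Laplacian is at most \<open>16 * a ^ 6\<close> on a square of area \<open>4 * a\<^sup>2\<close>.
  Half of the product is \<open>32 * a ^ 8\<close>, as the Laplacian of \<open>log_norm F\<close> is
  twice the squared derivative. Points of the square have modulus at most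
  \<open>2 * a\<close>.\<close>

lemma caccioppoli:
  fixes F :: "complex \<Rightarrow> complex ^ 'n::{finite,linorder}"
  assumes F: "entire_curve F" and a: "a > 0" and m: "\<And>z. cmod z \<le> 2 * a \<Longrightarrow> \<bar>log_norm F z\<bar> \<le> m"
  shows "integral (cbox (-a,-a) (a,a)) (\<lambda>(x, y). bump a x * bump a y * (fs_deriv_rep F (Complex x y))\<^sup>2)
    \<le> 32 * a ^ 8 * m"
proof -
  let ?S = "cbox (-a,-a) (a,a)"
  define A B where "A = (\<lambda>(x, y). bump a x * bump a y * log_norm_dd F 1 (Complex x y)
           - bump_dd a x * bump a y * log_norm F (Complex x y))"
    and "B = (\<lambda>(x, y). bump a x * bump a y * log_norm_dd F \<i> (Complex x y)
           - bump a x * bump_dd a y * log_norm F (Complex x y))"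
  define E where "E = (\<lambda>(x, y). bump a x * bump a y * (fs_deriv_rep F (Complex x y))\<^sup>2)"
  define R where "R = (\<lambda>(x, y). (bump_dd a x * bump a y + bump a x * bump_dd a y) * log_norm F (Complex x y))"
  note cp = continuous_on_plane[OF continuous_on_log_norm_dd[OF F]] continuous_on_plane[OF continuous_on_log_norm[OF F]]
    continuous_on_plane[OF continuous_on_fs_deriv_rep_sq[OF F]]
  have cont: "continuous_on ?S A" "continuous_on ?S B" "continuous_on ?S E" "continuous_on ?S R"
    unfolding A_def B_def E_def R_def split_def bump_def bump_dd_def
    by (intro continuous_intros cp)+
  have int: "A integrable_on ?S" "B integrable_on ?S" "E integrable_on ?S" "R integrable_on ?S"
    using cont by (auto intro: integrable_continuous)
  have "2 * E p = A p + B p + R p" for p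
  proof -
    obtain x y where p: "p = (x, y)" by force
    have "2 * E p = bump a x * bump a y * (2 * (fs_deriv_rep F (Complex x y))\<^sup>2)" by (simp add: E_def p)
    also have "\<dots> = A p + B p + R p"
      unfolding laplacian_log_norm[OF F, symmetric] by (simp add: p A_def B_def R_def algebra_simps)
    finally show ?thesis .
  qed
  then have "integral ?S (\<lambda>p. 2 * E p) = integral ?S A + integral ?S B + integral ?S R"
    using int by (simp add: integral_add integrable_add)
  also have "\<dots> = integral ?S R"
    using integral_bump_log_norm_dd[OF F a] unfolding A_def B_def by simp
  finally have eq: "2 * integral ?S E = integral ?S R" by simp
  have "norm (integral ?S R) \<le> (16 * a ^ 6 * m) * measure lborel ?S"
  proof (rule integrable_bound[OF _ int(4)])
    have m0: "m \<ge> 0" using m[of 0] a by (smt (verit) norm_zero)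
    then show "0 \<le> 16 * a ^ 6 * m" using a by simp
    show "norm (R p) \<le> 16 * a ^ 6 * m" if "p \<in> ?S" for p
    proof -
      obtain x y where p: "p = (x, y)" by force
      have xy: "\<bar>x\<bar> \<le> a" "\<bar>y\<bar> \<le> a" using that by (auto simp: p cbox_Pair_eq)
      have bump: "\<bar>bump a s\<bar> \<le> a ^ 4" "\<bar>bump_dd a s\<bar> \<le> 8 * a\<^sup>2" if "\<bar>s\<bar> \<le> a" for s
      proof -
        have sa: "s\<^sup>2 \<le> a\<^sup>2" using that a by (simp add: abs_le_square_iff[symmetric])
        then have "(a\<^sup>2 - s\<^sup>2)\<^sup>2 \<le> (a\<^sup>2)\<^sup>2" by (intro power_mono) auto
        then show "\<bar>bump a s\<bar> \<le> a ^ 4" by (simp add: bump_def)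
        show "\<bar>bump_dd a s\<bar> \<le> 8 * a\<^sup>2"
          unfolding bump_dd_def abs_le_iff using sa zero_le_power2[of s] zero_le_power2[of a]
          by linarith
      qed
      have prod: "\<bar>bump_dd a x * bump a y\<bar> \<le> (8 * a\<^sup>2) * a ^ 4" "\<bar>bump a x * bump_dd a y\<bar> \<le> a ^ 4 * (8 * a\<^sup>2)"
        unfolding abs_mult using bump[OF xy(1)] bump[OF xy(2)] by (auto intro!: mult_mono)
      have "\<bar>bump_dd a x * bump a y + bump a x * bump_dd a y\<bar> \<le> (8 * a\<^sup>2) * a ^ 4 + a ^ 4 * (8 * a\<^sup>2)"
        using prod by linarith
      also have "\<dots> = 16 * a ^ 6" by (simp add: power_numeral_reduce)
      finally have 1: "\<bar>bump_dd a x * bump a y + bump a x * bump_dd a y\<bar> \<le> 16 * a ^ 6" .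
      have "cmod (Complex x y) \<le> 2 * a" using cmod_le[of "Complex x y"] xy by simp
      from mult_mono[OF 1 m[OF this]] show ?thesis using a by (simp add: p R_def abs_mult)
    qed
  qed
  also have "measure lborel ?S = (2 * a) * (2 * a)" using a by (simp add: content_Pair)
  finally have "integral ?S R \<le> 64 * a ^ 8 * m" by (simp add: power_numeral_reduce algebra_simps abs_le_iff)
  with eq show ?thesis by (simp add: E_def)
qed

text \<open>It suffices to compare boxes, which determine Lebesgue measure. The identity links area
  integrals over discs with the iterated integrals over squares.\<close>

lemma lborel_complex: "(lborel :: complex measure) = distr lborel borel (\<lambda>p. Complex (fst p) (snd p))"
proof (rule lborel_eqI)
  have meas: "(\<lambda>p. Complex (fst p) (snd p)) \<in> borel_measurable (borel :: (real \<times> real) measure)"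
    by (intro borel_measurable_continuous_onI continuous_intros)
  fix l u :: complex
  assume le: "\<And>b. b \<in> Basis \<Longrightarrow> l \<bullet> b \<le> u \<bullet> b"
  have le: "Re l \<le> Re u" "Im l \<le> Im u" using le[of 1] le[of \<i>] by (auto simp: Basis_complex_def)
  have "(\<lambda>p. Complex (fst p) (snd p)) -` box l u = box (Re l, Im l) (Re u, Im u)"
    by (auto simp: box_def Basis_complex_def Basis_prod_def)
  then have "emeasure (distr lborel borel (\<lambda>p. Complex (fst p) (snd p))) (box l u) =
      emeasure lborel (box (Re l, Im l) (Re u, Im u))"
    using meas by (subst emeasure_distr) auto
  also have "\<dots> = (\<Prod>b\<in>Basis. ((Re u, Im u) - (Re l, Im l)) \<bullet> b)"
    by (rule emeasure_lborel_box) (use le in \<open>auto simp: Basis_prod_def\<close>)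
  also have "(\<Prod>b\<in>Basis. ((Re u, Im u) - (Re l, Im l)) \<bullet> b) = (Re u - Re l) * (Im u - Im l)"
    by (simp add: Basis_prod_def)
  also have "\<dots> = (\<Prod>b\<in>Basis. (u - l) \<bullet> b)"
    by (simp add: Basis_complex_def)
  finally show "emeasure (distr lborel borel (\<lambda>p. Complex (fst p) (snd p))) (box l u) = (\<Prod>b\<in>Basis. (u - l) \<bullet> b)" .
qed simp

text \<open>With \<open>a = 2 * t\<close> each cutoff factor is at least
  \<open>(3 * t\<^sup>2)\<^sup>2\<close> on the disc, so the product is at least
  \<open>81 * t ^ 8\<close>. Then \<open>32 * a ^ 8 / (81 * t ^ 8) = 8192 / 81\<close>, which is
  below 102.\<close>

lemma area_bound:
  fixes F :: "complex \<Rightarrow> complex ^ 'n::{finite,linorder}"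
  assumes F: "entire_curve F" and t: "t > 0" and m: "\<And>z. cmod z \<le> 4 * t \<Longrightarrow> \<bar>log_norm F z\<bar> \<le> m"
  shows "(LINT z:cball 0 t|lborel. (fs_deriv_rep F z)\<^sup>2) \<le> 102 * m"
proof -
  define a where "a = 2 * t"
  have a: "a > 0" using t by (simp add: a_def)
  let ?S = "cbox (-a,-a) (a,a)"
  let ?c = "\<lambda>p. Complex (fst p) (snd p)"
  define E where "E = (\<lambda>p. bump a (fst p) * bump a (snd p) * (fs_deriv_rep F (?c p))\<^sup>2)"
  have m0: "m \<ge> 0" using m[of 0] t by (smt (verit) norm_zero)
  have contE: "continuous_on ?S E" unfolding E_def bump_def
    by (intro continuous_intros continuous_on_plane[OF continuous_on_fs_deriv_rep_sq[OF F]])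
  have intE: "integrable lborel (\<lambda>p. indicator ?S p *\<^sub>R E p)"
    by (rule borel_integrable_compact[OF _ contE]) simp
  have meas_c: "?c \<in> borel_measurable (lborel :: (real \<times> real) measure)"
    using borel_measurable_continuous_onI[of ?c] by (simp add: continuous_on_Complex continuous_on_fst continuous_on_snd)
  have meas: "(\<lambda>z. indicator (cball 0 t) z *\<^sub>R (fs_deriv_rep F z)\<^sup>2) \<in> borel_measurable borel"
    by (intro borel_measurable_scaleR borel_measurable_indicator borel_measurable_continuous_onI
         continuous_on_fs_deriv_rep_sq[OF F]) auto
  have "(LINT z:cball 0 t|lborel. (fs_deriv_rep F z)\<^sup>2) =
      (LINT p|lborel. indicator (cball 0 t) (?c p) *\<^sub>R (fs_deriv_rep F (?c p))\<^sup>2)"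
    unfolding set_lebesgue_integral_def
    by (subst lborel_complex, rule integral_distr) (use meas_c meas in auto)
  also have "\<dots> \<le> (LINT p|lborel. (indicator ?S p *\<^sub>R E p) / (81 * t ^ 8))"
  proof (rule integral_mono')
    show "integrable lborel (\<lambda>p. (indicator ?S p *\<^sub>R E p) / (81 * t ^ 8))" using intE by simp
    have nonneg: "0 \<le> E p" for p by (simp add: E_def bump_def)
    show "0 \<le> (indicator ?S p *\<^sub>R E p) / (81 * t ^ 8)" for p using nonneg by simp
    show "indicator (cball 0 t) (?c p) *\<^sub>R (fs_deriv_rep F (?c p))\<^sup>2 \<le> (indicator ?S p *\<^sub>R E p) / (81 * t ^ 8)" for p
    proof (cases "?c p \<in> cball 0 t")
      case True
      obtain x y where p: "p = (x, y)" by force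
      have xy: "\<bar>x\<bar> \<le> t" "\<bar>y\<bar> \<le> t" using True abs_Re_le_cmod[of "?c p"] abs_Im_le_cmod[of "?c p"] by (auto simp: p)
      have "p \<in> ?S" using xy t by (auto simp: p a_def cbox_Pair_eq)
      have b: "bump a s \<ge> 9 * t ^ 4" if "\<bar>s\<bar> \<le> t" for s
      proof -
        have "s\<^sup>2 \<le> t\<^sup>2" using that t by (simp add: abs_le_square_iff[symmetric])
        then have "(3 * t\<^sup>2)\<^sup>2 \<le> (a\<^sup>2 - s\<^sup>2)\<^sup>2" unfolding a_def by (intro power_mono) auto
        then show ?thesis by (simp add: bump_def power_mult_distrib)
      qed
      have "(9 * t ^ 4) * (9 * t ^ 4) \<le> bump a x * bump a y"
        using b[OF xy(1)] b[OF xy(2)] t by (intro mult_mono) (auto simp: bump_def)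
      then have "81 * t ^ 8 \<le> bump a x * bump a y" by (simp add: power_numeral_reduce)
      then have "81 * t ^ 8 * (fs_deriv_rep F (?c p))\<^sup>2 \<le> E p"
        unfolding E_def p by (intro mult_right_mono) auto
      then show ?thesis using True \<open>p \<in> ?S\<close> t by (simp add: field_simps)
    qed (use nonneg in simp)
  qed
  also have "\<dots> = (LINT p:?S|lborel. E p) / (81 * t ^ 8)"
    by (simp add: set_lebesgue_integral_def)
  also have "(LINT p:?S|lborel. E p) = integral ?S E"
    by (rule set_borel_integral_eq_integral) (use intE in \<open>simp add: set_integrable_def\<close>)
  also have "integral ?S E \<le> 32 * a ^ 8 * m"
    using caccioppoli[OF F a m] by (simp add: E_def split_def a_def)
  also have "32 * a ^ 8 * m / (81 * t ^ 8) = 8192 / 81 * m"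
    using t by (simp add: a_def power_mult_distrib)
  also have "\<dots> \<le> 102 * m" using m0 by simp
  finally show ?thesis using t by (simp add: divide_right_mono)
qed

section \<open>From the area integral to the characteristic\<close>

lemma homogeneous_rep_iff: "homogeneous_rep f F \<longleftrightarrow> entire_curve F \<and> (\<forall>z. f z = abs_proj (F z))"
  by (auto simp: homogeneous_rep_def entire_curve_def)

lemma fs_deriv_eq_rep: "homogeneous_rep f F \<Longrightarrow> fs_deriv f = fs_deriv_rep F"
  unfolding fs_deriv_def by (rule fs_deriv_rep_unique[OF someI[of "homogeneous_rep f"]])

lemma has_bochner_integral_powr:
  fixes \<sigma> r :: real
  assumes "\<sigma> > -1" "r \<ge> 0"
  shows "has_bochner_integral lborel (\<lambda>t. indicator {0..r} t * t powr \<sigma>) (r powr (\<sigma> + 1) / (\<sigma> + 1))"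
proof (rule has_bochner_integral_nn_integral)
  have "((\<lambda>t. if t \<in> {0..r} then t powr \<sigma> else 0) has_integral (r powr (\<sigma> + 1) / (\<sigma> + 1))) UNIV"
    using has_integral_powr_from_0[OF assms] by (subst has_integral_restrict_UNIV)
  moreover have "(\<lambda>t. if t \<in> {0..r} then t powr \<sigma> else 0) = (\<lambda>t. indicator {0..r} t * t powr \<sigma>)"
    by (auto simp: fun_eq_iff)
  ultimately have "((\<lambda>t. indicator {0..r} t * t powr \<sigma>) has_integral (r powr (\<sigma> + 1) / (\<sigma> + 1))) UNIV"
    by simp
  then show "(\<integral>\<^sup>+t. indicator {0..r} t * t powr \<sigma> \<partial>lborel) = ennreal (r powr (\<sigma> + 1) / (\<sigma> + 1))"
    by (intro nn_integral_has_integral_lborel) auto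
qed (use assms in auto)

text \<open>The estimate from \<open>area_bound\<close> does not tend to 0 with \<open>t\<close>,
  and divided by \<open>t\<close> it would not be integrable at 0. For \<open>t \<le> 1\<close> it
  is therefore replaced by the maximum of the density times the area of the disc, which is quadratic
  in \<open>t\<close>.\<close>

lemma nevanlinna_char_bigo_of_log_norm:
  fixes F :: "complex \<Rightarrow> complex ^ 'n::{finite,linorder}"
  assumes rep: "homogeneous_rep f F" and \<sigma>: "\<sigma> > -1"
    and bound: "\<And>z. \<bar>log_norm F z\<bar> \<le> C * (1 + cmod z) powr (\<sigma> + 1)"
  shows "nevanlinna_char f \<in> O[at_top](\<lambda>r. r powr (\<sigma> + 1))"
proof -
  have F: "entire_curve F" using rep by (simp add: homogeneous_rep_iff)
  have C: "C \<ge> 0" using bound[of 0] by simp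
  define A where "A t = (LINT z:cball 0 t|lborel. (fs_deriv_rep F z)\<^sup>2)" for t
  have A0: "A t \<ge> 0" for t
    unfolding A_def set_lebesgue_integral_def by (rule Bochner_Integration.integral_nonneg) simp
  have A1: "A t \<le> 102 * (C * (1 + 4 * t) powr (\<sigma> + 1))" if "t > 0" for t
    unfolding A_def
  proof (rule area_bound[OF F that])
    fix z assume "cmod z \<le> 4 * t"
    then have "(1 + cmod z) powr (\<sigma> + 1) \<le> (1 + 4 * t) powr (\<sigma> + 1)"
      using \<sigma> by (intro powr_mono2) auto
    from mult_left_mono[OF this C] bound[of z]
    show "\<bar>log_norm F z\<bar> \<le> C * (1 + 4 * t) powr (\<sigma> + 1)" by linarith
  qed
  obtain M where M: "\<And>z. z \<in> cball 0 1 \<Longrightarrow> (fs_deriv_rep F z)\<^sup>2 \<le> M"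
    using continuous_attains_sup[of "cball 0 1 :: complex set" "\<lambda>z. (fs_deriv_rep F z)\<^sup>2"]
      continuous_on_subset[OF continuous_on_fs_deriv_rep_sq[OF F]] by (metis compact_cball cball_eq_empty not_one_less_zero subset_UNIV)
  have M0: "M \<ge> 0" using M[of 0] by (smt (verit) zero_le_power2 centre_in_cball)
  define V where "V = unit_ball_vol 2"
  have V: "V \<ge> 0" by (simp add: V_def)
  have A2: "A t \<le> M * V * t\<^sup>2" if t: "t > 0" "t \<le> 1" for t
  proof -
    have "A t \<le> (LINT z::complex|lborel. indicator (cball 0 t) z *\<^sub>R M)"
      unfolding A_def set_lebesgue_integral_def
    proof (rule Bochner_Integration.integral_mono')
      show "integrable lborel (\<lambda>z :: complex. indicator (cball 0 t) z *\<^sub>R M)"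
        using borel_integrable_compact[of "cball 0 t :: complex set" "\<lambda>_. M"] by simp
    qed (use M t M0 in \<open>auto simp: indicator_def\<close>)
    also have "\<dots> = measure lborel (cball (0 :: complex) t) * M" by simp
    also have "\<dots> = M * V * t\<^sup>2" using t by (simp add: content_cball V_def)
    finally show ?thesis .
  qed
  define c1 c2 where "c1 = M * V / pi" and "c2 = 102 * C * 5 powr (\<sigma> + 1) / pi"
  have c: "c1 \<ge> 0" "c2 \<ge> 0" using M0 V C by (auto simp: c1_def c2_def)
  have bd: "1 / t * (1 / pi * A t) \<le> c1 * indicator {0..1} t + c2 * t powr \<sigma>" if "t \<ge> 0" for t
  proof (cases "t = 0 \<or> t > 1")
    case False
    then have t: "t > 0" "t \<le> 1" using that by auto
    have "1 / t * (1 / pi * A t) \<le> 1 / t * (1 / pi * (M * V * t\<^sup>2))"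
      using A2[OF t] t by (intro mult_left_mono) auto
    also have "\<dots> = c1 * t" using t by (simp add: c1_def power2_eq_square)
    also have "\<dots> \<le> c1 * 1" using c t by (intro mult_left_mono) auto
    finally show ?thesis using t c by (simp add: add_increasing2)
  next
    case True
    show ?thesis
    \<comment> \<open>For \<open>t = 0\<close> the left side is 0 because of
      \<open>1 / 0 = 0\<close>.\<close>
    proof (cases "t = 0")
      case False
      with True have t: "t > 1" by simp
      have "A t \<le> 102 * (C * (5 * t) powr (\<sigma> + 1))"
      proof (rule order_trans[OF A1])
        have "(1 + 4 * t) powr (\<sigma> + 1) \<le> (5 * t) powr (\<sigma> + 1)" using t \<sigma> by (intro powr_mono2) auto
        then show "102 * (C * (1 + 4 * t) powr (\<sigma> + 1)) \<le> 102 * (C * (5 * t) powr (\<sigma> + 1))"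
          using C by (intro mult_left_mono) auto
      qed (use t in auto)
      then have "1 / t * (1 / pi * A t) \<le> 1 / t * (1 / pi * (102 * (C * (5 * t) powr (\<sigma> + 1))))"
        using t by (intro mult_left_mono) auto
      also have "\<dots> = c2 * t powr \<sigma>" using t by (simp add: c2_def powr_mult powr_add)
      finally show ?thesis using t by simp
    qed (use c in simp)
  qed
  define s where "s = \<sigma> + 1"
  have s: "s > 0" using \<sigma> by (simp add: s_def)
  have main: "nevanlinna_char f r \<le> c1 + c2 * (r powr s / s)" if r: "r \<ge> 0" for r
  proof -
    note I1 = has_bochner_integral_powr[OF \<sigma> r]
    have I2: "has_bochner_integral lborel (indicator {0..1::real} :: real \<Rightarrow> real) 1"
      using has_bochner_integral_real_indicator[of "{0..1::real}" lborel] by simp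
    have I: "has_bochner_integral lborel (\<lambda>t. c1 * indicator {0..1} t + c2 * (indicator {0..r} t * t powr \<sigma>))
       (c1 * 1 + c2 * (r powr s / s))"
      unfolding s_def
      by (intro has_bochner_integral_add has_bochner_integral_mult_right I1 I2)
    have "nevanlinna_char f r = (LINT t|lborel. indicator {0..r} t *\<^sub>R (1 / t * (1 / pi * A t)))"
      unfolding nevanlinna_char_def A_def set_lebesgue_integral_def fs_deriv_eq_rep[OF rep] by simp
    also have "\<dots> \<le> (LINT t|lborel. c1 * indicator {0..1} t + c2 * (indicator {0..r} t * t powr \<sigma>))"
    proof (rule Bochner_Integration.integral_mono')
      show "indicator {0..r} t *\<^sub>R (1 / t * (1 / pi * A t)) \<le> c1 * indicator {0..1} t + c2 * (indicator {0..r} t * t powr \<sigma>)" for t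
        using bd[of t] c by (auto simp: indicator_def)
    qed (use I c in \<open>auto simp: has_bochner_integral_iff\<close>)
    also have "\<dots> = c1 + c2 * (r powr s / s)" using has_bochner_integral_integral_eq[OF I] by simp
    finally show ?thesis .
  qed
  have nonneg: "nevanlinna_char f r \<ge> 0" for r
    unfolding nevanlinna_char_def set_lebesgue_integral_def fs_deriv_eq_rep[OF rep]
    by (rule Bochner_Integration.integral_nonneg)
      (auto simp: indicator_def A0[unfolded A_def set_lebesgue_integral_def])
  show ?thesis
  proof (rule bigoI[of _ "c1 + c2 / s"], rule eventually_mono[OF eventually_ge_at_top[of 1]])
    fix r :: real assume r: "r \<ge> 1"
    have "1 \<le> r powr s" using r s by (simp add: ge_one_powr_ge_zero)
    from mult_left_mono[OF this c(1)] main[of r] r nonneg[of r]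
    show "norm (nevanlinna_char f r) \<le> (c1 + c2 / s) * norm (r powr (\<sigma> + 1))"
      unfolding s_def[symmetric] by (simp add: algebra_simps)
  qed
qed

text \<open>With \<open>u = Re G\<close>, multiplying \<open>F\<close> by \<open>exp (- G)\<close>
  represents the same curve and subtracts \<open>u\<close> from \<open>log_norm F\<close>; the
  characteristic depends on the curve only.\<close>

lemma nevanlinna_char_bigo:
  fixes F :: "complex \<Rightarrow> complex ^ 'n::{finite,linorder}"
  assumes rep: "homogeneous_rep f F" and \<sigma>: "\<sigma> > -1" and u: "re_holo UNIV u"
    and bound: "\<And>z. \<bar>log_norm F z - u z\<bar> \<le> C * (1 + cmod z) powr (\<sigma> + 1)"
  shows "nevanlinna_char f \<in> O[at_top](\<lambda>r. r powr (\<sigma> + 1))"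
proof -
  obtain G where G: "G holomorphic_on UNIV" "\<And>z. u z = Re (G z)" using u by (auto simp: re_holo_def)
  define F' where "F' z = exp (- G z) *s F z" for z
  have F: "entire_curve F" "\<And>z. f z = abs_proj (F z)" using rep by (auto simp: homogeneous_rep_iff)
  have F': "entire_curve F'"
    using F(1) G(1) unfolding entire_curve_def F'_def by (auto intro!: holomorphic_intros)
  moreover have "f z = abs_proj (F' z)" for z
  proof -
    have "abs_proj (F z) = abs_proj (F' z)"
      by (subst abs_proj_eq_iff) (use F(1) F' in \<open>auto simp: entire_curve_def F'_def intro!: exI[of _ "exp (- G z)"]\<close>)
    with F(2) show ?thesis by simp
  qed
  ultimately have rep': "homogeneous_rep f F'" by (simp add: homogeneous_rep_iff)
  have "log_norm F' z = log_norm F z - u z" for z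
  proof -
    have "sqnorm F' z = (exp (- u z))\<^sup>2 * sqnorm F z"
      by (simp add: sqnorm_def F'_def norm_mult power_mult_distrib G(2) norm_exp_eq_Re flip: sum_distrib_left)
    then show ?thesis using sqnorm_pos[OF F(1), of z]
      by (simp add: log_norm_def ln_mult ln_realpow)
  qed
  with nevanlinna_char_bigo_of_log_norm[OF rep' \<sigma>, of C] bound show ?thesis by simp
qed

section \<open>Homogeneous representations\<close>

text \<open>A finite \<open>A\<close> leads to a polynomial. An infinite one is listed with
  multiplicities by a sequence tending to infinity, and the Weierstrass product, built from nonzero
  terms, has exactly these zeros.\<close>

lemma entire_with_prescribed_zeros:
  fixes A :: "complex set" and c :: "complex \<Rightarrow> nat"
  assumes A: "closed A" "\<And>r. finite (A \<inter> cball 0 r)" "0 \<notin> A" and c: "\<And>z. z \<in> A \<Longrightarrow> c z > 0"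
  obtains h where "h holomorphic_on UNIV" "\<And>z. h z = 0 \<longleftrightarrow> z \<in> A" "\<And>z. z \<in> A \<Longrightarrow> zorder h z = int (c z)"
proof (cases "finite A")
  case True
  define h where "h z = (\<Prod>w\<in>A. (z - w) ^ c w)" for z
  have "zorder h z = int (c z)" if z: "z \<in> A" for z
  proof (rule zorder_eqI[of UNIV])
    let ?g = "\<lambda>y. \<Prod>w\<in>A - {z}. (y - w) ^ c w"
    show "?g holomorphic_on UNIV" by (intro holomorphic_intros)
    show "?g z \<noteq> 0" using True by auto
    show "h w = ?g w * (w - z) powi int (c z)" for w
      unfolding h_def using True z by (simp add: prod.remove mult.commute)
  qed auto
  moreover have "h holomorphic_on UNIV" unfolding h_def by (intro holomorphic_intros)
  moreover have "h z = 0 \<longleftrightarrow> z \<in> A" for z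
    using True c by (auto simp: h_def)
  ultimately show ?thesis using that by blast
next
  case False
  obtain a :: "nat \<Rightarrow> complex" where a: "range a = A" "filterlim a at_infinity at_top"
    "\<And>z. z \<in> A \<Longrightarrow> finite (a -` {z}) \<and> card (a -` {z}) = c z"
    by (rule sequence_of_sparse_set_exists'[where c = c, OF False A(1) A(2) c]) (assumption, rule that)
  interpret W: weierstrass_product' a
  proof
    show "a n \<noteq> 0" for n using A(3) a(1) by (metis rangeI)
    show "finite (a -` {z})" if "z \<in> range a" for z using a that by auto
  qed fact
  show ?thesis
    by (rule that[of W.f]) (use W.holomorphic W.zero W.zorder a in auto)
qed

section \<open>Affine charts of projective space\<close>

lemma abs_proj_cases:
  obtains v where "v \<noteq> 0" "p = abs_proj v"
proof -
  have "\<exists>v. proj_rel v v \<and> p = abs_proj v"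
    using proj.abs_induct[of "\<lambda>p. \<exists>v. proj_rel v v \<and> p = abs_proj v" p] by blast
  then show ?thesis using that by (auto simp: proj_rel_def)
qed

lemma proj_rel_refl: "v \<noteq> 0 \<Longrightarrow> proj_rel v v"
  by (auto simp: proj_rel_def intro!: exI[of _ 1])

lemma coord_nonzero_abs_proj: "v \<noteq> 0 \<Longrightarrow> coord_nonzero i (abs_proj v) \<longleftrightarrow> v $ i \<noteq> 0"
  by (rule coord_nonzero.abs_eq[OF proj_rel_refl])

lemma affine_coord_abs_proj: "v \<noteq> 0 \<Longrightarrow> affine_coord i j (abs_proj v) = v $ j / v $ i"
  by (rule affine_coord.abs_eq[OF proj_rel_refl])

lemma coord_nonzero_exists: "\<exists>i. coord_nonzero i p"
  by (cases p rule: abs_proj_cases) (auto simp: coord_nonzero_abs_proj vec_eq_iff)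

lemma affine_coord_change:
  "coord_nonzero i p \<Longrightarrow> coord_nonzero l p \<Longrightarrow> affine_coord i j p = affine_coord l j p / affine_coord l i p"
  by (cases p rule: abs_proj_cases) (auto simp: coord_nonzero_abs_proj affine_coord_abs_proj)

lemma coord_nonzero_iff: "coord_nonzero l p \<Longrightarrow> coord_nonzero i p \<longleftrightarrow> affine_coord l i p \<noteq> 0"
  by (cases p rule: abs_proj_cases) (auto simp: coord_nonzero_abs_proj affine_coord_abs_proj)

lemma abs_proj_affine_coord:
  assumes "coord_nonzero i p" "c \<noteq> 0"
  shows "p = abs_proj (\<chi> j. c * affine_coord i j p)" "(\<chi> j. c * affine_coord i j p) \<noteq> 0"
proof -
  obtain v where v: "v \<noteq> 0" "p = abs_proj v" by (rule abs_proj_cases)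
  then have vi: "v $ i \<noteq> 0" using assms by (simp add: coord_nonzero_abs_proj)
  have eq: "(\<chi> j. c * affine_coord i j p) = (c / v $ i) *s v"
    by (simp add: vec_eq_iff v(2) affine_coord_abs_proj[OF v(1)])
  show nz: "(\<chi> j. c * affine_coord i j p) \<noteq> 0" unfolding eq using v vi assms by simp
  show "p = abs_proj (\<chi> j. c * affine_coord i j p)"
    using v nz vi assms unfolding eq by (simp add: abs_proj_eq_iff)
qed

text \<open>
  The affine coordinates with respect to a coordinate \<open>i\<close> that does not vanish at \<open>f 0\<close> are multiplied
  by an entire function whose zeros cancel their poles. At a pole \<open>p\<close> the multiplicity is read off
  in any chart \<open>l p\<close> around \<open>f p\<close>.
\<close>

lemma homogeneous_rep_exists:
  fixes f :: "complex \<Rightarrow> 'n::finite proj"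
  assumes f: "holomorphic_curve f"
  shows "\<exists>F. homogeneous_rep f F"
proof -
  define N where "N i = {z. coord_nonzero i (f z)}" for i
  define \<alpha> where "\<alpha> i j z = affine_coord i j (f z)" for i j z
  have openN: "open (N i)" and hol: "\<alpha> i j holomorphic_on N i" for i j
    using f by (auto simp: holomorphic_curve_def N_def \<alpha>_def[abs_def])
  have exN: "\<exists>i. z \<in> N i" for z using coord_nonzero_exists by (auto simp: N_def)
  obtain i where i: "0 \<in> N i" using exN by blast
  define A where "A = - N i"
  have closedA: "closed A" using openN[of i] by (simp add: A_def closed_def)
  have zero: "w \<in> A \<longleftrightarrow> \<alpha> l i w = 0" if "w \<in> N l" for w l
    using that coord_nonzero_iff by (auto simp: A_def N_def \<alpha>_def)
  have limA: "p \<in> A" if "p islimpt A" for p using that closedA closed_limpt by blast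
  \<comment> \<open>Identity theorem across charts: near a limit point \<open>p\<close> the function
    \<open>\<alpha> l i\<close> of a chart around \<open>p\<close> vanishes on a ball, so the limit
    points form an open set as well as a closed one. The origin is not among them, and the plane is
    connected.\<close>
  have nolim: "\<not> p islimpt A" for p
  proof -
    let ?L = "{p. p islimpt A}"
    have "open ?L"
    proof (rule openI)
      fix p assume "p \<in> ?L"
      then have p: "p islimpt A" by simp
      obtain l where l: "p \<in> N l" using exN by blast
      obtain e where e: "e > 0" "ball p e \<subseteq> N l" using openN l openE by blast
      have "p islimpt (A \<inter> ball p e)"
      proof (rule islimptI)
        fix T assume "p \<in> T" "open T"
        then obtain y where "y \<in> A" "y \<in> T \<inter> ball p e" "y \<noteq> p"
          using islimptE[OF p, of "T \<inter> ball p e"] e by auto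
        then show "\<exists>y\<in>A \<inter> ball p e. y \<in> T \<and> y \<noteq> p" by blast
      qed
      have "\<alpha> l i w = 0" if "w \<in> ball p e" for w
      proof (rule analytic_continuation[of "\<alpha> l i" "ball p e" "A \<inter> ball p e" p])
        show "\<alpha> l i holomorphic_on ball p e" using hol e by (meson holomorphic_on_subset)
        show "\<alpha> l i z = 0" if "z \<in> A \<inter> ball p e" for z using zero[of z l] that e by auto
      qed (use e that \<open>p islimpt (A \<inter> ball p e)\<close> in auto)
      then have "ball p e \<subseteq> A" using zero e by blast
      then have "ball p e \<subseteq> ?L"
        using interior_limit_point[of _ A] interior_maximal[of "ball p e" A] by auto
      then show "\<exists>e>0. ball p e \<subseteq> ?L" using e by blast
    qed
    moreover have "closed ?L" by (rule closed_limpts)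
    ultimately have "?L = {} \<or> ?L = UNIV" using clopen[of ?L] by auto
    moreover have "0 \<notin> ?L" using limA[of 0] i by (auto simp: A_def)
    ultimately show ?thesis by auto
  qed
  have finA: "finite (A \<inter> cball 0 r)" for r
  proof (rule ccontr)
    assume "infinite (A \<inter> cball 0 r)"
    then obtain x where "x islimpt (A \<inter> cball 0 r)"
      using compact_eq_Bolzano_Weierstrass[of "cball (0::complex) r"] by auto
    then show False using nolim islimpt_subset by blast
  qed
  define l where "l p = (SOME l. p \<in> N l)" for p
  have l: "p \<in> N (l p)" for p unfolding l_def by (rule someI_ex) (rule exN)
  have local: "\<exists>e g. e > 0 \<and> ball p e \<subseteq> N (l p) \<and> g holomorphic_on ball p e \<and> zorder (\<alpha> (l p) i) p > 0 \<and>
      (\<forall>w\<in>ball p e. \<alpha> (l p) i w = g w * (w - p) ^ nat (zorder (\<alpha> (l p) i) p) \<and> g w \<noteq> 0)"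
    if p: "p \<in> A" for p
  proof -
    obtain e where e: "e > 0" "ball p e \<subseteq> N (l p)" using openN l openE by blast
    have "\<exists>w\<in>ball p e. \<alpha> (l p) i w \<noteq> 0"
    proof (rule ccontr)
      assume "\<not> ?thesis"
      then have "ball p e \<subseteq> A" using zero e by blast
      then have "p islimpt A"
        using interior_limit_point[of p A] interior_maximal[of "ball p e" A] e(1)
        by (meson centre_in_ball open_ball subsetD)
      then show False using nolim by blast
    qed
    note ex = this
    have hb: "\<alpha> (l p) i holomorphic_on ball p e" by (rule holomorphic_on_subset[OF hol e(2)])
    have pe: "p \<in> ball p e" using e(1) by simp
    have p0: "\<alpha> (l p) i p = 0" using zero[OF l] p by blast
    obtain r where "zorder (\<alpha> (l p) i) p > 0" "r > 0" "cball p r \<subseteq> ball p e"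
      "zor_poly (\<alpha> (l p) i) p holomorphic_on cball p r"
      "\<forall>w\<in>cball p r. \<alpha> (l p) i w = zor_poly (\<alpha> (l p) i) p w * (w - p) ^ nat (zorder (\<alpha> (l p) i) p)
         \<and> zor_poly (\<alpha> (l p) i) p w \<noteq> 0"
      using zorder_exist_zero[OF hb open_ball connected_ball pe ex] unfolding p0 simp_thms(6) if_True by blast
    note r = this
    have "zor_poly (\<alpha> (l p) i) p holomorphic_on ball p r"
      by (rule holomorphic_on_subset[OF r(4) ball_subset_cball])
    moreover have "ball p r \<subseteq> N (l p)" using r(3) e(2) ball_subset_cball[of p r] by blast
    ultimately show ?thesis using r(1,2,5) ball_subset_cball[of p r]
      by (intro exI[of _ r] exI[of _ "zor_poly (\<alpha> (l p) i) p"]) auto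
  qed
  define c where "c p = nat (zorder (\<alpha> (l p) i) p)" for p
  have "c p > 0" if "p \<in> A" for p using local[OF that] by (auto simp: c_def)
  then obtain h where h: "h holomorphic_on UNIV" "\<And>z. h z = 0 \<longleftrightarrow> z \<in> A"
      "\<And>z. z \<in> A \<Longrightarrow> zorder h z = int (c z)"
    using entire_with_prescribed_zeros[OF closedA finA, of c] i by (auto simp: A_def)
  define P where "P p e G \<longleftrightarrow> e > 0 \<and> (\<forall>j. (\<lambda>w. G w $ j) holomorphic_on ball p e) \<and> G p \<noteq> 0 \<and> f p = abs_proj (G p) \<and>
      (\<forall>w\<in>ball p e - {p}. w \<notin> A \<and> (\<forall>j. G w $ j = h w * \<alpha> i j w))" for p e and G :: "complex \<Rightarrow> complex ^ 'n"
  have ext: "\<exists>x. P p (fst x) (snd x)" if p: "p \<in> A" for p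
  proof -
    obtain e1 g1 where g1: "e1 > 0" "ball p e1 \<subseteq> N (l p)" "g1 holomorphic_on ball p e1"
      "\<And>w. w \<in> ball p e1 \<Longrightarrow> \<alpha> (l p) i w = g1 w * (w - p) ^ c p" "\<And>w. w \<in> ball p e1 \<Longrightarrow> g1 w \<noteq> 0"
      using local[OF p] unfolding c_def by blast
    have "\<exists>w\<in>UNIV. h w \<noteq> 0" using h(2)[of 0] i by (auto simp: A_def)
    note ex = this
    have "h p = 0" using h(2) p by blast
    note hz = zorder_exist_zero[OF h(1) open_UNIV connected_UNIV UNIV_I ex, of p, unfolded this simp_thms(6) if_True h(3)[OF p] nat_int]
    obtain e2 where g2: "e2 > 0" "zor_poly h p holomorphic_on cball p e2"
      "\<And>w. w \<in> cball p e2 \<Longrightarrow> h w = zor_poly h p w * (w - p) ^ c p" "\<And>w. w \<in> cball p e2 \<Longrightarrow> zor_poly h p w \<noteq> 0"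
      using hz by blast
    define e where "e = min e1 e2"
    have e: "e > 0" "ball p e \<subseteq> ball p e1" "ball p e \<subseteq> cball p e2" using g1(1) g2(1) by (auto simp: e_def)
    \<comment> \<open>Both \<open>h\<close> and \<open>\<alpha> (l p) i\<close> vanish at
      \<open>p\<close> to the order \<open>c p\<close>, so \<open>q\<close> is their quotient with
      the zeros cancelled. Off \<open>p\<close>, \<open>h * \<alpha> i j\<close> equals
      \<open>q * \<alpha> (l p) j\<close>; the latter is holomorphic at \<open>p\<close>, and its
      coordinate \<open>l p\<close> is nonzero.\<close>
    define q where "q w = zor_poly h p w / g1 w" for w
    have q: "q w \<noteq> 0" if "w \<in> ball p e" for w using that e g1(5) g2(4) by (auto simp: q_def)
    define G where "G w = (\<chi> j. q w * \<alpha> (l p) j w)" for w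
    have "(\<lambda>w. G w $ j) holomorphic_on ball p e" for j
    proof -
      have "zor_poly h p holomorphic_on ball p e" "g1 holomorphic_on ball p e" "\<alpha> (l p) j holomorphic_on ball p e"
        using holomorphic_on_subset[OF g2(2) e(3)] holomorphic_on_subset[OF g1(3) e(2)]
          holomorphic_on_subset[OF hol[of "l p" j], of "ball p e"] e(2) g1(2) by blast+
      then have "(\<lambda>w. zor_poly h p w / g1 w * \<alpha> (l p) j w) holomorphic_on ball p e"
        by (intro holomorphic_on_mult holomorphic_on_divide) (use g1(5) e(2) in blast)+
      then show ?thesis by (simp add: G_def q_def)
    qed
    moreover have "G p \<noteq> 0" "f p = abs_proj (G p)"
      unfolding G_def \<alpha>_def using abs_proj_affine_coord[of "l p" "f p" "q p"] l[of p] q[of p] e(1)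
      by (auto simp: N_def)
    moreover have "w \<notin> A \<and> (\<forall>j. G w $ j = h w * \<alpha> i j w)" if w: "w \<in> ball p e - {p}" for w
    proof -
      have w1: "w \<in> ball p e1" "w \<in> cball p e2" "w \<in> N (l p)" using w e g1(2) by auto
      have wA: "w \<notin> A" using zero[OF w1(3)] g1(4,5)[OF w1(1)] w by auto
      have "\<alpha> i j w = \<alpha> (l p) j w / \<alpha> (l p) i w" for j
        using wA w1(3) affine_coord_change[of i "f w" "l p"] by (auto simp: \<alpha>_def A_def N_def)
      then have "G w $ j = h w * \<alpha> i j w" for j
        using g1(4,5)[OF w1(1)] g2(3)[OF w1(2)] w by (simp add: G_def q_def)
      with wA show ?thesis by blast
    qed
    ultimately have "P p e G" using e(1) unfolding P_def by blast
    then show ?thesis by (intro exI[of _ "(e, G)"]) simp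
  qed
  then have "\<forall>p\<in>A. \<exists>x. P p (fst x) (snd x)" by blast
  from bchoice[OF this] obtain x where x: "\<And>p. p \<in> A \<Longrightarrow> P p (fst (x p)) (snd (x p))" by blast
  define \<epsilon> G where "\<epsilon> p = fst (x p)" and "G p = snd (x p)" for p
  note x = x[folded \<epsilon>_def G_def, unfolded P_def]
  have \<epsilon>: "\<And>p. p \<in> A \<Longrightarrow> \<epsilon> p > 0"
    and G: "\<And>p j. p \<in> A \<Longrightarrow> (\<lambda>w. G p w $ j) holomorphic_on ball p (\<epsilon> p)"
      "\<And>p. p \<in> A \<Longrightarrow> G p p \<noteq> 0" "\<And>p. p \<in> A \<Longrightarrow> f p = abs_proj (G p p)"
      "\<And>p w. p \<in> A \<Longrightarrow> w \<in> ball p (\<epsilon> p) - {p} \<Longrightarrow> w \<notin> A \<and> (\<forall>j. G p w $ j = h w * \<alpha> i j w)"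
    using x by blast+
  define F where "F z = (if z \<in> A then G z z else (\<chi> j. h z * \<alpha> i j z))" for z
  have off: "f z = abs_proj (F z)" "F z \<noteq> 0" if "z \<notin> A" for z
    using abs_proj_affine_coord[of i "f z" "h z"] that h(2)[of z] by (auto simp: F_def \<alpha>_def A_def N_def)
  have "homogeneous_rep f F"
    unfolding homogeneous_rep_def
  proof (intro conjI allI)
    show "F z \<noteq> 0" for z using off G(2) by (cases "z \<in> A") (auto simp: F_def)
    show "f z = abs_proj (F z)" for z using off G(3) by (cases "z \<in> A") (auto simp: F_def)
    show "(\<lambda>z. F z $ j) holomorphic_on UNIV" for j
      unfolding holomorphic_on_def
    proof
      fix p :: complex
      have "\<exists>S. open S \<and> p \<in> S \<and> (\<lambda>z. F z $ j) holomorphic_on S"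
      proof (cases "p \<in> A")
        case True
        have "(\<lambda>z. F z $ j) holomorphic_on ball p (\<epsilon> p)"
        proof (rule holomorphic_transform[OF G(1)[OF True]])
          show "G p w $ j = F w $ j" if "w \<in> ball p (\<epsilon> p)" for w
            using G(4)[OF True, of w] that True by (cases "w = p") (auto simp: F_def)
        qed
        then show ?thesis using \<epsilon>[OF True] by (intro exI[of _ "ball p (\<epsilon> p)"]) auto
      next
        case False
        have "(\<lambda>z. h z * \<alpha> i j z) holomorphic_on N i"
          by (rule holomorphic_on_mult[OF holomorphic_on_subset[OF h(1) subset_UNIV] hol])
        then have "(\<lambda>z. F z $ j) holomorphic_on N i"
          by (rule holomorphic_transform) (auto simp: F_def A_def)
        then show ?thesis using openN[of i] False by (auto simp: A_def)
      qed
      then show "(\<lambda>z. F z $ j) field_differentiable at p within UNIV"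
        by (auto intro: holomorphic_on_imp_differentiable_at)
    qed
  qed
  then show ?thesis by blast
qed

section \<open>The Hilbert basis theorem for algebras of functions\<close>

text \<open>Polynomials are treated through their values, which is all that vanishing at points
  involves; negatives come from the constant \<open>-1\<close>.\<close>

definition function_algebra :: "('b \<Rightarrow> complex) set \<Rightarrow> bool" where
  "function_algebra R \<longleftrightarrow> (\<forall>c. (\<lambda>_. c) \<in> R) \<and> (\<forall>f\<in>R. \<forall>g\<in>R. (\<lambda>x. f x + g x) \<in> R) \<and>
     (\<forall>f\<in>R. \<forall>g\<in>R. (\<lambda>x. f x * g x) \<in> R)"

lemma function_algebra_const: "function_algebra R \<Longrightarrow> (\<lambda>_. c) \<in> R"
  and function_algebra_add: "function_algebra R \<Longrightarrow> f \<in> R \<Longrightarrow> g \<in> R \<Longrightarrow> (\<lambda>x. f x + g x) \<in> R"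
  and function_algebra_mult: "function_algebra R \<Longrightarrow> f \<in> R \<Longrightarrow> g \<in> R \<Longrightarrow> (\<lambda>x. f x * g x) \<in> R"
  by (auto simp: function_algebra_def)

lemma function_algebra_sum:
  assumes "function_algebra R" "\<And>k. k \<in> K \<Longrightarrow> f k \<in> R"
  shows "(\<lambda>x. \<Sum>k\<in>K. f k x) \<in> R"
  using assms(2) by (induction K rule: infinite_finite_induct) (auto intro: function_algebra_const function_algebra_add assms(1))

lemma function_algebra_prod:
  assumes "function_algebra R" "\<And>k. k \<in> K \<Longrightarrow> f k \<in> R"
  shows "(\<lambda>x. \<Prod>k\<in>K. f k x) \<in> R"
  using assms(2) by (induction K rule: infinite_finite_induct) (auto intro: function_algebra_const function_algebra_mult assms(1))

lemma function_algebra_power: "function_algebra R \<Longrightarrow> f \<in> R \<Longrightarrow> (\<lambda>x. f x ^ k) \<in> R"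
  by (induction k) (auto intro: function_algebra_const function_algebra_mult)

inductive_set ideal_gen :: "('b \<Rightarrow> complex) set \<Rightarrow> ('b \<Rightarrow> complex) set \<Rightarrow> ('b \<Rightarrow> complex) set"
  for R T where
  zero: "(\<lambda>_. 0) \<in> ideal_gen R T"
| add: "f \<in> ideal_gen R T \<Longrightarrow> c \<in> R \<Longrightarrow> t \<in> T \<Longrightarrow> (\<lambda>x. f x + c x * t x) \<in> ideal_gen R T"

lemma ideal_gen_base: "function_algebra R \<Longrightarrow> t \<in> T \<Longrightarrow> t \<in> ideal_gen R T"
  using ideal_gen.add[OF ideal_gen.zero function_algebra_const, of R t T 1] by simp

lemma ideal_gen_mono: "f \<in> ideal_gen R S \<Longrightarrow> S \<subseteq> T \<Longrightarrow> f \<in> ideal_gen R T"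
  by (induction rule: ideal_gen.induct) (auto intro: ideal_gen.intros)

lemma ideal_gen_plus: "g \<in> ideal_gen R T \<Longrightarrow> f \<in> ideal_gen R T \<Longrightarrow> (\<lambda>x. f x + g x) \<in> ideal_gen R T"
proof (induction g rule: ideal_gen.induct)
  case (add g c t)
  from ideal_gen.add[OF add.IH[OF add.prems] add.hyps(2,3)] show ?case by (simp add: add.assoc)
qed simp

lemma ideal_gen_mult:
  assumes R: "function_algebra R" and f: "f \<in> ideal_gen R T" and c: "c \<in> R"
  shows "(\<lambda>x. c x * f x) \<in> ideal_gen R T"
  using f
proof (induction f rule: ideal_gen.induct)
  case zero
  then show ?case using ideal_gen.zero[of R T] by simp
next
  case (add f d t)
  from ideal_gen.add[OF add.IH function_algebra_mult[OF R c add.hyps(2)] add.hyps(3)]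
  show ?case by (simp add: algebra_simps)
qed

lemma ideal_gen_sum:
  "(\<And>k. k \<in> K \<Longrightarrow> f k \<in> ideal_gen R T) \<Longrightarrow> (\<lambda>x. \<Sum>k\<in>K. f k x) \<in> ideal_gen R T"
  by (induction K rule: infinite_finite_induct) (auto intro: ideal_gen.zero ideal_gen_plus)

lemma ideal_gen_trans:
  assumes R: "function_algebra R" and f: "f \<in> ideal_gen R S" and S: "S \<subseteq> ideal_gen R T"
  shows "f \<in> ideal_gen R T"
  using f
proof (induction f rule: ideal_gen.induct)
  case (add f c t)
  then show ?case using S by (intro ideal_gen_plus ideal_gen_mult R) auto
qed (rule ideal_gen.zero)

lemma ideal_gen_finite:
  "f \<in> ideal_gen R S \<Longrightarrow> \<exists>T. finite T \<and> T \<subseteq> S \<and> f \<in> ideal_gen R T"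
proof (induction f rule: ideal_gen.induct)
  case zero
  then show ?case by (intro exI[of _ "{}"]) (auto intro: ideal_gen.zero)
next
  case (add f c t)
  then obtain T where T: "finite T" "T \<subseteq> S" "f \<in> ideal_gen R T" by blast
  have "(\<lambda>x. f x + c x * t x) \<in> ideal_gen R (insert t T)"
    by (intro ideal_gen.add ideal_gen_mono[OF T(3)]) (use add in auto)
  then show ?case using T add.hyps(3) by (intro exI[of _ "insert t T"]) auto
qed

lemma ideal_gen_vanish: "f \<in> ideal_gen R T \<Longrightarrow> (\<And>t. t \<in> T \<Longrightarrow> t x = 0) \<Longrightarrow> f x = 0"
  by (induction f rule: ideal_gen.induct) auto

text \<open>The coefficients are attached to positions and not to generators, since values of
  \<open>a\<close> may repeat; leading coefficients of a sequence will be indexed like this.\<close>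

lemma ideal_gen_image_lessThan:
  assumes R: "function_algebra R"
  shows "f \<in> ideal_gen R (a ` {..<N}) \<Longrightarrow> \<exists>d. (\<forall>i. d i \<in> R) \<and> (\<forall>x. f x = (\<Sum>i<(N::nat). d i x * a i x))"
proof (induction f rule: ideal_gen.induct)
  case zero
  then show ?case by (intro exI[of _ "\<lambda>_ _. 0"]) (auto intro: function_algebra_const R)
next
  case (add f c t)
  then obtain d where d: "\<And>i. d i \<in> R" "\<And>x. f x = (\<Sum>i<N. d i x * a i x)" by blast
  obtain j where j: "j < N" "t = a j" using add.hyps(3) by blast
  define d' where "d' i = (if i = j then (\<lambda>x. d i x + c x) else d i)" for i
  have "f x + c x * t x = (\<Sum>i<N. d' i x * a i x)" for x
  proof -
    have "(\<Sum>i<N. d' i x * a i x) = (\<Sum>i<N. d i x * a i x + (if i = j then c x * a i x else 0))"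
      by (intro sum.cong refl) (auto simp: d'_def algebra_simps)
    also have "\<dots> = f x + c x * t x" using j by (simp add: sum.distrib d(2))
    finally show ?thesis by simp
  qed
  moreover have "d' i \<in> R" for i using d(1) add.hyps(2) function_algebra_add[OF R] by (simp add: d'_def)
  ultimately show ?case by blast
qed

definition noetherian :: "('b \<Rightarrow> complex) set \<Rightarrow> bool" where
  "noetherian R \<longleftrightarrow> (\<forall>S\<subseteq>R. \<exists>T. finite T \<and> T \<subseteq> S \<and> S \<subseteq> ideal_gen R T)"

definition polys_below :: "('b \<Rightarrow> complex) set \<Rightarrow> ('b \<Rightarrow> complex) \<Rightarrow> nat \<Rightarrow> ('b \<Rightarrow> complex) set" where
  "polys_below R y l = {f. \<exists>c. (\<forall>k. c k \<in> R) \<and> (\<forall>x. f x = (\<Sum>k<l. c k x * y x ^ k))}"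

definition adjoin :: "('b \<Rightarrow> complex) set \<Rightarrow> ('b \<Rightarrow> complex) \<Rightarrow> ('b \<Rightarrow> complex) set" where
  "adjoin R y = (\<Union>l. polys_below R y l)"

lemma polys_below_monom:
  assumes R: "function_algebra R" and c: "c \<in> R" and k: "k < l"
  shows "(\<lambda>x. c x * y x ^ k) \<in> polys_below R y l"
proof -
  have "c x * y x ^ k = (\<Sum>j<l. (if j = k then c else (\<lambda>_. 0)) x * y x ^ j)" for x
  proof -
    have "(\<Sum>j<l. (if j = k then c else (\<lambda>_. 0)) x * y x ^ j) = (\<Sum>j<l. if j = k then c x * y x ^ j else 0)"
      by (intro sum.cong) auto
    then show ?thesis using k by simp
  qed
  moreover have "(if j = k then c else (\<lambda>_. 0)) \<in> R" for j using c function_algebra_const[OF R] by simp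
  ultimately show ?thesis unfolding polys_below_def
    by (intro CollectI exI[of _ "\<lambda>j. if j = k then c else (\<lambda>_. 0)"]) blast
qed

lemma polys_below_zero: "function_algebra R \<Longrightarrow> (\<lambda>_. 0) \<in> polys_below R y l"
  unfolding polys_below_def by (intro CollectI exI[of _ "\<lambda>_ _. 0"]) (auto intro: function_algebra_const)

lemma polys_below_add:
  assumes R: "function_algebra R" and f: "f \<in> polys_below R y l" and g: "g \<in> polys_below R y l"
  shows "(\<lambda>x. f x + g x) \<in> polys_below R y l"
proof -
  obtain c d where "\<And>k. c k \<in> R" "\<And>x. f x = (\<Sum>k<l. c k x * y x ^ k)"
    "\<And>k. d k \<in> R" "\<And>x. g x = (\<Sum>k<l. d k x * y x ^ k)"
    using f g unfolding polys_below_def by blast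
  then show ?thesis unfolding polys_below_def
    by (intro CollectI exI[of _ "\<lambda>k x. c k x + d k x"])
      (auto intro: function_algebra_add R simp: sum.distrib algebra_simps)
qed

lemma polys_below_sum:
  assumes R: "function_algebra R" and "\<And>k. k \<in> K \<Longrightarrow> f k \<in> polys_below R y l"
  shows "(\<lambda>x. \<Sum>k\<in>K. f k x) \<in> polys_below R y l"
  using assms(2) by (induction K rule: infinite_finite_induct) (auto intro: polys_below_zero polys_below_add R)

lemma polys_below_mono:
  assumes R: "function_algebra R" and f: "f \<in> polys_below R y l" and "l \<le> m"
  shows "f \<in> polys_below R y m"
proof -
  obtain c where c: "\<And>k. c k \<in> R" "\<And>x. f x = (\<Sum>k<l. c k x * y x ^ k)"
    using f unfolding polys_below_def by blast
  have "(\<lambda>x. \<Sum>k<l. c k x * y x ^ k) \<in> polys_below R y m"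
    by (intro polys_below_sum polys_below_monom R c) (use assms in auto)
  moreover have "f = (\<lambda>x. \<Sum>k<l. c k x * y x ^ k)" using c(2) by (rule ext)
  ultimately show ?thesis by simp
qed

lemma function_algebra_adjoin:
  assumes R: "function_algebra R"
  shows "function_algebra (adjoin R y)"
  unfolding function_algebra_def
proof (intro conjI allI ballI)
  show "(\<lambda>_. c) \<in> adjoin R y" for c
    using polys_below_monom[OF R function_algebra_const[OF R, of c], of 0 1 y] by (auto simp: adjoin_def)
  fix f g assume "f \<in> adjoin R y" "g \<in> adjoin R y"
  then obtain l m where f: "f \<in> polys_below R y l" and g: "g \<in> polys_below R y m" by (auto simp: adjoin_def)
  have "(\<lambda>x. f x + g x) \<in> polys_below R y (max l m)"
    by (intro polys_below_add R polys_below_mono[OF R f] polys_below_mono[OF R g]) auto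
  then show "(\<lambda>x. f x + g x) \<in> adjoin R y" by (auto simp: adjoin_def)
  obtain c d where c: "\<And>k. c k \<in> R" "\<And>x. f x = (\<Sum>k<l. c k x * y x ^ k)"
    and d: "\<And>k. d k \<in> R" "\<And>x. g x = (\<Sum>k<m. d k x * y x ^ k)"
    using f g unfolding polys_below_def by blast
  have "(\<lambda>x. \<Sum>k<l. \<Sum>j<m. (c k x * d j x) * y x ^ (k + j)) \<in> polys_below R y (l + m)"
    by (intro polys_below_sum polys_below_monom[where c = "\<lambda>x. c _ x * d _ x"] R function_algebra_mult c d) auto
  moreover have "(\<lambda>x. f x * g x) = (\<lambda>x. \<Sum>k<l. \<Sum>j<m. (c k x * d j x) * y x ^ (k + j))"
    by (rule ext) (simp add: c(2) d(2) sum_product power_add mult_ac)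
  ultimately show "(\<lambda>x. f x * g x) \<in> adjoin R y" by (auto simp: adjoin_def)
qed

lemma adjoin_superset: "function_algebra R \<Longrightarrow> R \<subseteq> adjoin R y"
  using polys_below_monom[of R _ 0 1 y] by (auto simp: adjoin_def)

lemma adjoin_self: "function_algebra R \<Longrightarrow> y \<in> adjoin R y"
  using polys_below_monom[OF _ function_algebra_const, of R 1 2 1 y] by (auto simp: adjoin_def)

text \<open>
  Hilbert's argument, with the least length of a representation \<open>\<Sum>k<l. c k x * y x ^ k\<close> in place of the
  degree, since \<open>y\<close> need not be transcendental over \<open>R\<close>.
\<close>

lemma noetherian_adjoin:
  assumes R: "function_algebra R" and N: "noetherian R"
  shows "noetherian (adjoin R y)"
proof (rule ccontr)
  let ?A = "adjoin R y"
  note A = function_algebra_adjoin[OF R, of y]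
  assume "\<not> noetherian ?A"
  then have "\<exists>S. S \<subseteq> ?A \<and> (\<forall>T. finite T \<longrightarrow> T \<subseteq> S \<longrightarrow> \<not> S \<subseteq> ideal_gen ?A T)"
    unfolding noetherian_def by (simp only: not_all not_imp not_ex not_not de_Morgan_conj de_Morgan_disj imp_conv_disj)
  then obtain S where S: "S \<subseteq> ?A" and bad: "\<forall>T. finite T \<longrightarrow> T \<subseteq> S \<longrightarrow> \<not> S \<subseteq> ideal_gen ?A T"
    by (elim exE conjE)
  define J where "J = ideal_gen ?A S"
  have JA: "J \<subseteq> ?A"
  proof
    fix f assume "f \<in> J"
    then show "f \<in> ?A" unfolding J_def
      by (induction rule: ideal_gen.induct) (use S function_algebra_const[OF A] function_algebra_add[OF A] function_algebra_mult[OF A] in blast)+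
  qed
  have SJ: "S \<subseteq> J" unfolding J_def using ideal_gen_base[OF A] by blast
  \<comment> \<open>Were \<open>J\<close> generated by a finite \<open>F\<close>, each member of
    \<open>F\<close> would involve finitely many elements of \<open>S\<close>, and all these
    together would generate \<open>S\<close>, against its choice.\<close>
  have ex: "\<exists>g. g \<in> J - ideal_gen ?A F" if F: "finite F" "F \<subseteq> J" for F
  proof (rule ccontr)
    assume "\<not> ?thesis"
    then have JF: "J \<subseteq> ideal_gen ?A F" by blast
    have "\<forall>f\<in>F. \<exists>T. finite T \<and> T \<subseteq> S \<and> f \<in> ideal_gen ?A T"
      using F(2) ideal_gen_finite unfolding J_def by blast
    from bchoice[OF this] obtain T where T: "\<forall>f\<in>F. finite (T f) \<and> T f \<subseteq> S \<and> f \<in> ideal_gen ?A (T f)"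
      by (elim exE)
    define U where "U = (\<Union>f\<in>F. T f)"
    have U: "finite U" "U \<subseteq> S" using T F(1) by (auto simp: U_def)
    have "F \<subseteq> ideal_gen ?A U"
      using T ideal_gen_mono[where T = U] unfolding U_def by blast
    then have "S \<subseteq> ideal_gen ?A U"
      using ideal_gen_trans[OF A _ \<open>F \<subseteq> ideal_gen ?A U\<close>] SJ JF by blast
    then show False using bad[rule_format, OF U] by simp
  qed
  define len where "len g = (LEAST l. g \<in> polys_below R y l)" for g
  have len: "g \<in> polys_below R y (len g)" if g: "g \<in> J" for g
  proof -
    obtain k where "g \<in> polys_below R y k" using g JA unfolding adjoin_def by blast
    then show ?thesis unfolding len_def by (rule LeastI[of "\<lambda>l. g \<in> polys_below R y l"])
  qed
  have len_le: "len g \<le> l" if "g \<in> polys_below R y l" for g l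
    unfolding len_def using that by (rule Least_le[of "\<lambda>l. g \<in> polys_below R y l"])
  \<comment> \<open>Each term is of least length among the elements of \<open>J\<close> outside the
    ideal of the earlier terms. The choice depends on the whole past, hence the well-founded
    recursion.\<close>
  have "\<exists>f. \<forall>n :: nat. f n \<in> J - ideal_gen ?A (f ` {..<n}) \<and> (\<forall>g\<in>J - ideal_gen ?A (f ` {..<n}). len (f n) \<le> len g)"
  proof (rule dependent_wf_choice[OF wf_less, where P = "\<lambda>f n r. r \<in> J - ideal_gen ?A (f ` {..<n}) \<and>
      (\<forall>g\<in>J - ideal_gen ?A (f ` {..<n}). len r \<le> len g)"])
    fix f g :: "nat \<Rightarrow> 'a \<Rightarrow> complex" and n r
    assume "\<And>z. (z, n) \<in> {(x, y). x < y} \<Longrightarrow> f z = g z"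
    then have "f ` {..<n} = g ` {..<n}" by (intro image_cong) auto
    then show "(r \<in> J - ideal_gen ?A (f ` {..<n}) \<and> (\<forall>g\<in>J - ideal_gen ?A (f ` {..<n}). len r \<le> len g)) =
      (r \<in> J - ideal_gen ?A (g ` {..<n}) \<and> (\<forall>ga\<in>J - ideal_gen ?A (g ` {..<n}). len r \<le> len ga))" by simp
  next
    fix f :: "nat \<Rightarrow> 'a \<Rightarrow> complex" and n
    assume "\<And>m. (m, n) \<in> {(x, y). x < y} \<Longrightarrow> f m \<in> J - ideal_gen ?A (f ` {..<m}) \<and>
      (\<forall>g\<in>J - ideal_gen ?A (f ` {..<m}). len (f m) \<le> len g)"
    then have "f ` {..<n} \<subseteq> J" by auto
    from ex[OF _ this] obtain g where "g \<in> J - ideal_gen ?A (f ` {..<n})" by auto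
    from ex_has_least_nat[of "\<lambda>g. g \<in> J - ideal_gen ?A (f ` {..<n})", OF this, of len]
    show "\<exists>r. r \<in> J - ideal_gen ?A (f ` {..<n}) \<and> (\<forall>g\<in>J - ideal_gen ?A (f ` {..<n}). len r \<le> len g)" by blast
  qed
  then obtain f :: "nat \<Rightarrow> 'a \<Rightarrow> complex" where f_all: "\<forall>n. f n \<in> J - ideal_gen ?A (f ` {..<n}) \<and>
      (\<forall>g\<in>J - ideal_gen ?A (f ` {..<n}). len (f n) \<le> len g)"
    by (elim exE)
  have f: "f n \<in> J" "f n \<notin> ideal_gen ?A (f ` {..<n})" for n using f_all[rule_format, of n] by simp_all
  have least: "len (f n) \<le> len g" if "g \<in> J" "g \<notin> ideal_gen ?A (f ` {..<n})" for n g
    using f_all[rule_format, of n] that by blast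
  define l where "l n = len (f n)" for n
  have lmono: "l m \<le> l n" if "m \<le> n" for m n
    unfolding l_def
  proof (rule least[OF f(1)])
    have "f ` {..<m} \<subseteq> f ` {..<n}" using that by (intro image_mono) auto
    then show "f n \<notin> ideal_gen ?A (f ` {..<m})" using f(2)[of n] ideal_gen_mono[of "f n"] by blast
  qed
  have lpos: "l n > 0" for n
  proof (rule ccontr)
    assume "\<not> l n > 0"
    then have "f n \<in> polys_below R y 0" using len[OF f(1), of n] by (simp add: l_def)
    then have "f n = (\<lambda>_. 0)" by (auto simp: polys_below_def)
    then show False using f(2)[of n] ideal_gen.zero[of ?A "f ` {..<n}"] by simp
  qed
  have "\<forall>n. \<exists>c. (\<forall>k. c k \<in> R) \<and> (\<forall>x. f n x = (\<Sum>k<l n. c k x * y x ^ k))"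
    using len[OF f(1)] unfolding l_def polys_below_def by blast
  from choice[OF this] obtain C where C_all: "\<forall>n. (\<forall>k. C n k \<in> R) \<and> (\<forall>x. f n x = (\<Sum>k<l n. C n k x * y x ^ k))"
    by (elim exE)
  have C: "C n k \<in> R" "f n x = (\<Sum>k<l n. C n k x * y x ^ k)" for n k x using C_all by simp_all
  \<comment> \<open>A representation with \<open>l n\<close> coefficients has top exponent
    \<open>l n - 1\<close>, so \<open>a n\<close> is the leading coefficient.\<close>
  define a where "a n = C n (l n - 1)" for n
  have fa: "f n x = (\<Sum>k<l n - 1. C n k x * y x ^ k) + a n x * y x ^ (l n - 1)" for n x
    using lpos[of n] sum.lessThan_Suc[of "\<lambda>k. C n k x * y x ^ k" "l n - 1"] by (simp add: C(2) a_def)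
  have "range a \<subseteq> R" using C(1) by (auto simp: a_def)
  with N have "\<exists>T. finite T \<and> T \<subseteq> range a \<and> range a \<subseteq> ideal_gen R T" unfolding noetherian_def by simp
  then obtain T where T: "finite T" "T \<subseteq> range a" "range a \<subseteq> ideal_gen R T" by (elim exE conjE)
  obtain I where I: "finite I" "T = a ` I" using finite_subset_image[OF T(1,2)] by (elim exE conjE)
  obtain n where n: "I \<subseteq> {..<n}" using I(1)[unfolded finite_nat_iff_bounded] by (elim exE)
  have "a n \<in> ideal_gen R (a ` {..<n})"
    by (rule ideal_gen_mono[of _ _ T]) (use T(3) I(2) n in auto)
  from ideal_gen_image_lessThan[OF R this] obtain d where
    d: "\<forall>i. d i \<in> R" "\<forall>x. a n x = (\<Sum>i<n. d i x * a i x)" by (elim exE conjE)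
  note d = d[rule_format]
  \<comment> \<open>The leading coefficient of \<open>f n\<close> is cancelled by earlier terms,
    lifted to the same exponent by \<open>y x ^ (l n - l i)\<close>, where
    \<open>l i \<le> l n\<close>. Like \<open>f n\<close>, the result lies outside the ideal of the
    earlier terms, but it is shorter, contrary to minimality.\<close>
  define g where "g x = f n x + (\<Sum>i<n. (- d i x * y x ^ (l n - l i)) * f i x)" for x
  have coef: "(\<lambda>x. - d i x * y x ^ (l n - l i)) \<in> ?A" for i
  proof -
    have "(\<lambda>x. (-1) * d i x * y x ^ (l n - l i)) \<in> ?A"
      by (intro function_algebra_mult[OF A] function_algebra_const[OF A] function_algebra_power[OF A] adjoin_self[OF R])
        (use adjoin_superset[OF R] d(1) in blast)
    then show ?thesis by simp
  qed
  have sumJ: "(\<lambda>x. \<Sum>i<n. (- d i x * y x ^ (l n - l i)) * f i x) \<in> ideal_gen ?A (f ` {..<n})"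
    by (intro ideal_gen_sum ideal_gen_mult[OF A] ideal_gen_base[OF A] coef) auto
  have sum_sub: "(\<lambda>x. \<Sum>i<n. (- d i x * y x ^ (l n - l i)) * f i x) \<in> J"
    unfolding J_def by (rule ideal_gen_trans[OF A sumJ]) (use f(1) in \<open>auto simp: J_def\<close>)
  have gJ: "g \<in> J" unfolding g_def J_def
    by (rule ideal_gen_plus) (use f(1) sum_sub in \<open>auto simp: J_def\<close>)
  have "g \<notin> ideal_gen ?A (f ` {..<n})"
  proof
    assume "g \<in> ideal_gen ?A (f ` {..<n})"
    from ideal_gen_plus[OF this ideal_gen_mult[OF A sumJ function_algebra_const[OF A, of "-1"]]]
    have "f n \<in> ideal_gen ?A (f ` {..<n})" by (simp add: g_def)
    then show False using f(2) by blast
  qed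
  from least[OF gJ this] have 1: "l n \<le> len g" by (simp add: l_def)
  have "g = (\<lambda>x. (\<Sum>k<l n - 1. C n k x * y x ^ k) +
      (\<Sum>i<n. \<Sum>k<l i - 1. (- d i x * C i k x) * y x ^ (k + (l n - l i))))"
  proof (rule ext)
    fix x
    have "(- d i x * y x ^ (l n - l i)) * f i x =
        (\<Sum>k<l i - 1. (- d i x * C i k x) * y x ^ (k + (l n - l i))) - d i x * a i x * y x ^ (l n - 1)"
      if "i < n" for i
    proof -
      have e: "l n - l i + (l i - 1) = l n - 1" using lmono[of i n] lpos[of i] that by simp
      show ?thesis unfolding fa distrib_left sum_distrib_left e[symmetric] power_add by (simp add: mult_ac)
    qed
    then have "(\<Sum>i<n. (- d i x * y x ^ (l n - l i)) * f i x) =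
       (\<Sum>i<n. (\<Sum>k<l i - 1. (- d i x * C i k x) * y x ^ (k + (l n - l i))) - d i x * a i x * y x ^ (l n - 1))"
      by (intro sum.cong refl) auto
    also have "\<dots> = (\<Sum>i<n. \<Sum>k<l i - 1. (- d i x * C i k x) * y x ^ (k + (l n - l i))) - a n x * y x ^ (l n - 1)"
      by (simp only: sum_subtractf d(2) sum_distrib_right)
    finally show "g x = (\<Sum>k<l n - 1. C n k x * y x ^ k) +
      (\<Sum>i<n. \<Sum>k<l i - 1. (- d i x * C i k x) * y x ^ (k + (l n - l i)))"
      unfolding g_def fa[of n x] by simp
  qed
  also have "\<dots> \<in> polys_below R y (l n - 1)"
  proof (intro polys_below_add[OF R] polys_below_sum[OF R])
    show "(\<lambda>x. C n k x * y x ^ k) \<in> polys_below R y (l n - 1)" if "k \<in> {..<l n - 1}" for k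
      using polys_below_monom[OF R C(1)] that by simp
    show "(\<lambda>x. - d i x * C i k x * y x ^ (k + (l n - l i))) \<in> polys_below R y (l n - 1)"
      if "i \<in> {..<n}" "k \<in> {..<l i - 1}" for i k
    proof (rule polys_below_monom[OF R])
      have "(\<lambda>x. (-1) * d i x * C i k x) \<in> R" by (intro function_algebra_mult[OF R] function_algebra_const[OF R] d(1) C(1))
      then show "(\<lambda>x. - d i x * C i k x) \<in> R" by simp
      show "k + (l n - l i) < l n - 1" using that lmono[of i n] by auto
    qed
  qed
  finally have "len g \<le> l n - 1" by (rule len_le)
  with 1 lpos[of n] show False by simp
qed

lemma noetherian_constants:
  shows "function_algebra (range (\<lambda>c _. c) :: ('b \<Rightarrow> complex) set)" and "noetherian (range (\<lambda>c _. c) :: ('b \<Rightarrow> complex) set)"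
proof -
  show A: "function_algebra (range (\<lambda>c _. c) :: ('b \<Rightarrow> complex) set)" unfolding function_algebra_def by auto
  show "noetherian (range (\<lambda>c _. c) :: ('b \<Rightarrow> complex) set)"
    unfolding noetherian_def
  proof (intro allI impI)
    fix S :: "('b \<Rightarrow> complex) set" assume S: "S \<subseteq> range (\<lambda>c _. c)"
    let ?R = "range (\<lambda>c _. c) :: ('b \<Rightarrow> complex) set"
    show "\<exists>T. finite T \<and> T \<subseteq> S \<and> S \<subseteq> ideal_gen ?R T"
    proof (cases "S \<subseteq> {\<lambda>_. 0}")
      case True
      then show ?thesis using ideal_gen.zero[of ?R "{}"] by (intro exI[of _ "{}"]) auto
    next
      case False
      then obtain c where c: "(\<lambda>_. c) \<in> S" "c \<noteq> 0" using S by fastforce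
      have "(\<lambda>_. d) \<in> ideal_gen ?R {\<lambda>_. c}" for d
        using ideal_gen_mult[OF A ideal_gen_base[OF A, of "\<lambda>_. c" "{\<lambda>_. c}"], of "\<lambda>_. d / c"] c by auto
      then have "S \<subseteq> ideal_gen ?R {\<lambda>_. c}" using S by auto
      then show ?thesis using c by (intro exI[of _ "{\<lambda>_. c}"]) auto
    qed
  qed
qed

theorem hilbert_basis_functions:
  fixes y :: "'i \<Rightarrow> 'b \<Rightarrow> complex"
  assumes "finite I"
  obtains R where "function_algebra R" "noetherian R" "\<And>i. i \<in> I \<Longrightarrow> y i \<in> R"
proof -
  have "\<exists>R. function_algebra R \<and> noetherian R \<and> (\<forall>i\<in>I. y i \<in> R)"
    using assms
  proof (induction I)
    case empty
    then show ?case using noetherian_constants by blast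
  next
    case (insert i I)
    then obtain R where R: "function_algebra R" "noetherian R" "\<forall>i\<in>I. y i \<in> R" by blast
    show ?case
      using function_algebra_adjoin[OF R(1), of "y i"] noetherian_adjoin[OF R(1,2), of "y i"] adjoin_self[OF R(1), of "y i"]
        adjoin_superset[OF R(1), of "y i"] R(3) by blast
  qed
  then show ?thesis using that by blast
qed

section \<open>Zariski closed sets of dimension zero\<close>

lemma cpoly_eval_scale:
  assumes "homogeneous d Q"
  shows "cpoly_eval Q (c *s v) = c ^ d * cpoly_eval Q v"
proof -
  have "(\<Prod>i\<in>UNIV. (c *s v) $ i ^ Poly_Mapping.lookup m i) = c ^ d * (\<Prod>i\<in>UNIV. v $ i ^ Poly_Mapping.lookup m i)"
    if "m \<in> Poly_Mapping.keys Q" for m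
    using that assms by (simp add: homogeneous_def power_mult_distrib prod.distrib flip: power_sum)
  then show ?thesis
    unfolding cpoly_eval_def sum_distrib_left by (intro sum.cong) (auto simp: mult_ac)
qed

definition homogeneous_set :: "'n::finite cpoly set \<Rightarrow> bool" where
  "homogeneous_set S \<longleftrightarrow> (\<forall>Q\<in>S. \<exists>d. homogeneous d Q)"

lemma zariski_closed_iff: "zariski_closed X \<longleftrightarrow> (\<exists>S. homogeneous_set S \<and> X = zero_locus S)"
  by (simp add: zariski_closed_def homogeneous_set_def)

lemma abs_proj_in_zero_locus:
  assumes S: "homogeneous_set S" and v: "v \<noteq> 0"
  shows "abs_proj v \<in> zero_locus S \<longleftrightarrow> (\<forall>Q\<in>S. cpoly_eval Q v = 0)"
proof
  assume "abs_proj v \<in> zero_locus S"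
  then obtain w where w: "abs_proj v = abs_proj w" "w \<noteq> 0" "\<And>Q. Q \<in> S \<Longrightarrow> cpoly_eval Q w = 0"
    unfolding zero_locus_def by blast
  then obtain c where c: "c \<noteq> 0" "v = c *s w" using abs_proj_eq_iff[of w v] v by metis
  show "\<forall>Q\<in>S. cpoly_eval Q v = 0"
  proof
    fix Q assume "Q \<in> S"
    then obtain d where "homogeneous d Q" using S by (auto simp: homogeneous_set_def)
    then have "cpoly_eval Q (c *s w) = c ^ d * cpoly_eval Q w" by (rule cpoly_eval_scale)
    then show "cpoly_eval Q v = 0" using w(3)[OF \<open>Q \<in> S\<close>] c by simp
  qed
qed (use v in \<open>auto simp: zero_locus_def\<close>)

lemma proj_set_eqI: "(\<And>v. v \<noteq> 0 \<Longrightarrow> abs_proj v \<in> X \<longleftrightarrow> abs_proj v \<in> Y) \<Longrightarrow> X = Y"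
  by (metis abs_proj_cases subsetI subset_antisym)

lemma zariski_closed_Int:
  assumes "zariski_closed X" "zariski_closed Y"
  shows "zariski_closed (X \<inter> Y)"
proof -
  obtain S T where S: "homogeneous_set S" "X = zero_locus S" and T: "homogeneous_set T" "Y = zero_locus T"
    using assms by (auto simp: zariski_closed_iff)
  have ST: "homogeneous_set (S \<union> T)" using S T by (auto simp: homogeneous_set_def)
  have "X \<inter> Y = zero_locus (S \<union> T)"
    by (rule proj_set_eqI) (auto simp: S T abs_proj_in_zero_locus[OF S(1)] abs_proj_in_zero_locus[OF T(1)]
      abs_proj_in_zero_locus[OF ST])
  with ST show ?thesis by (auto simp: zariski_closed_iff)
qed

lemma zariski_closed_UNIV: "zariski_closed (UNIV :: 'n::finite proj set)"
proof -
  have "homogeneous_set {}" by (simp add: homogeneous_set_def)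
  moreover have "(UNIV :: 'n proj set) = zero_locus {}"
    by (rule proj_set_eqI) (auto simp: abs_proj_in_zero_locus[OF calculation])
  ultimately show ?thesis by (auto simp: zariski_closed_iff)
qed

lemma zariski_closed_INT:
  assumes "finite I" "\<And>i. i \<in> I \<Longrightarrow> zariski_closed (X i)"
  shows "zariski_closed (\<Inter>i\<in>I. X i)"
  using assms by (induction I) (auto intro: zariski_closed_UNIV zariski_closed_Int)

lemma zariski_closed_Supp: "hypersurface_poly Q \<Longrightarrow> zariski_closed (Supp Q)"
  unfolding Supp_def zariski_closed_def hypersurface_poly_def by (intro exI[of _ "{Q}"]) auto

text \<open>Each strict step yields a polynomial \<open>q n\<close> that vanishes on
  \<open>Z (Suc n)\<close> but not at some point of \<open>Z n\<close>. By noetherianity finitely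
  many of them generate the rest; beyond these, \<open>q n\<close> would vanish at its own point,
  where all earlier ones do.\<close>

lemma no_infinite_zariski_descent:
  fixes Z :: "nat \<Rightarrow> 'n::finite proj set"
  assumes closed: "\<And>n. zariski_closed (Z n)" and desc: "\<And>n. Z (Suc n) \<subset> Z n"
  shows False
proof -
  have "\<exists>Q v. v \<noteq> 0 \<and> abs_proj v \<in> Z n \<and> cpoly_eval Q v \<noteq> 0 \<and>
      (\<forall>w. w \<noteq> 0 \<longrightarrow> abs_proj w \<in> Z (Suc n) \<longrightarrow> cpoly_eval Q w = 0)" for n
  proof -
    obtain S where S: "homogeneous_set S" "Z (Suc n) = zero_locus S" using closed zariski_closed_iff by metis
    obtain p where p: "p \<in> Z n" "p \<notin> Z (Suc n)" using desc[of n] by blast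
    obtain v where v: "v \<noteq> 0" "p = abs_proj v" by (rule abs_proj_cases)
    obtain Q where "Q \<in> S" "cpoly_eval Q v \<noteq> 0"
      using p(2) v abs_proj_in_zero_locus[OF S(1) v(1)] S(2) by auto
    then show ?thesis using v p abs_proj_in_zero_locus[OF S(1)] S(2) by blast
  qed
  then have "\<forall>n. \<exists>x. snd x \<noteq> 0 \<and> abs_proj (snd x) \<in> Z n \<and> cpoly_eval (fst x) (snd x) \<noteq> 0 \<and>
      (\<forall>w. w \<noteq> 0 \<longrightarrow> abs_proj w \<in> Z (Suc n) \<longrightarrow> cpoly_eval (fst x) w = 0)"
    by (metis fst_conv snd_conv)
  from choice[OF this] obtain x where x: "\<forall>n. snd (x n) \<noteq> 0 \<and> abs_proj (snd (x n)) \<in> Z n \<and>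
      cpoly_eval (fst (x n)) (snd (x n)) \<noteq> 0 \<and>
      (\<forall>w. w \<noteq> 0 \<longrightarrow> abs_proj w \<in> Z (Suc n) \<longrightarrow> cpoly_eval (fst (x n)) w = 0)" by (elim exE)
  define q where "q n = cpoly_eval (fst (x n))" for n
  obtain R :: "(complex ^ 'n \<Rightarrow> complex) set" where R: "function_algebra R" "noetherian R" "\<And>i. (\<lambda>v. v $ i) \<in> R"
    using hilbert_basis_functions[of UNIV "\<lambda>i v. v $ i"] by auto
  have "cpoly_eval Q \<in> R" for Q
    unfolding cpoly_eval_def
    by (intro function_algebra_sum[OF R(1)] function_algebra_mult[OF R(1)] function_algebra_const[OF R(1)] function_algebra_prod[OF R(1)]
        function_algebra_power[OF R(1)] R(3))
  then have "range q \<subseteq> R" by (auto simp: q_def)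
  with R(2) have "\<exists>T. finite T \<and> T \<subseteq> range q \<and> range q \<subseteq> ideal_gen R T" unfolding noetherian_def by simp
  then obtain T where T: "finite T" "T \<subseteq> range q" "range q \<subseteq> ideal_gen R T" by (elim exE conjE)
  obtain I where I: "finite I" "T = q ` I" using finite_subset_image[OF T(1,2)] by (elim exE conjE)
  obtain n where n: "I \<subseteq> {..<n}" using I(1)[unfolded finite_nat_iff_bounded] by (elim exE)
  have anti: "Z b \<subseteq> Z a" if "a \<le> b" for a b
    using lift_Suc_antimono_le[of Z a b] desc that by blast
  have "q n (snd (x n)) = 0"
  proof (rule ideal_gen_vanish[of "q n" R T])
    show "q n \<in> ideal_gen R T" using T(3) by blast
    fix t assume "t \<in> T"
    then obtain i where i: "i < n" "t = q i" using I(2) n by auto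
    have "abs_proj (snd (x n)) \<in> Z (Suc i)" using anti[of "Suc i" n] i x by auto
    then show "t (snd (x n)) = 0" using x i(2) by (simp add: q_def)
  qed
  then show False using x by (simp add: q_def)
qed

section \<open>Linear forms, closed points and finiteness in dimension zero\<close>

definition linear_cpoly :: "complex ^ 'n::finite \<Rightarrow> 'n cpoly" where
  "linear_cpoly a = (\<Sum>i\<in>UNIV. Poly_Mapping.single (Poly_Mapping.single i 1) (a $ i))"

lemma lookup_linear_cpoly:
  "Poly_Mapping.lookup (linear_cpoly a) m = (\<Sum>i\<in>UNIV. if m = Poly_Mapping.single i 1 then a $ i else 0)"
  unfolding linear_cpoly_def by (auto simp: lookup_sum lookup_single when_def intro!: sum.cong)

lemma keys_linear_cpoly: "Poly_Mapping.keys (linear_cpoly a) \<subseteq> range (\<lambda>i. Poly_Mapping.single i 1)"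
proof
  fix m assume m: "m \<in> Poly_Mapping.keys (linear_cpoly a)"
  show "m \<in> range (\<lambda>i. Poly_Mapping.single i 1)"
  proof (rule ccontr)
    assume "m \<notin> range (\<lambda>i. Poly_Mapping.single i 1)"
    then have "Poly_Mapping.lookup (linear_cpoly a) m = 0"
      unfolding lookup_linear_cpoly by (intro sum.neutral) auto
    with m show False by (simp add: in_keys_iff)
  qed
qed

lemma inj_single_1: "inj (\<lambda>i. Poly_Mapping.single i (1::nat))"
  by (rule injI) (metis lookup_single_eq lookup_single_not_eq zero_neq_one)

lemma cpoly_eval_linear: "cpoly_eval (linear_cpoly a) v = (\<Sum>i\<in>UNIV. a $ i * v $ i)"
proof -
  let ?s = "\<lambda>i. Poly_Mapping.single i (1::nat)"
  let ?m = "\<lambda>m. \<Prod>j\<in>UNIV. v $ j ^ Poly_Mapping.lookup m j"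
  have "cpoly_eval (linear_cpoly a) v = (\<Sum>m\<in>range ?s. Poly_Mapping.lookup (linear_cpoly a) m * ?m m)"
    unfolding cpoly_eval_def
    by (rule sum.mono_neutral_left) (use keys_linear_cpoly in \<open>auto simp: in_keys_iff\<close>)
  also have "\<dots> = (\<Sum>i\<in>UNIV. Poly_Mapping.lookup (linear_cpoly a) (?s i) * ?m (?s i))"
    using inj_single_1 by (subst sum.reindex) (auto simp: o_def)
  also have "\<dots> = (\<Sum>i\<in>UNIV. a $ i * v $ i)"
  proof (rule sum.cong[OF refl])
    fix i
    have "Poly_Mapping.lookup (linear_cpoly a) (?s i) = (\<Sum>j\<in>UNIV. if i = j then a $ j else 0)"
    proof -
      have "(?s i = ?s j) = (i = j)" for j using inj_single_1 by (metis injD)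
      then show ?thesis unfolding lookup_linear_cpoly by simp
    qed
    moreover have "?m (?s i) = (\<Prod>j\<in>UNIV. if i = j then v $ j else 1)"
      by (intro prod.cong) (auto simp: lookup_single when_def)
    ultimately show "Poly_Mapping.lookup (linear_cpoly a) (?s i) * ?m (?s i) = a $ i * v $ i" by simp
  qed
  finally show ?thesis .
qed

lemma homogeneous_linear: "homogeneous 1 (linear_cpoly a)"
  unfolding homogeneous_def
proof
  fix m assume "m \<in> Poly_Mapping.keys (linear_cpoly a)"
  then obtain i where "m = Poly_Mapping.single i 1" using keys_linear_cpoly by blast
  then show "(\<Sum>j\<in>UNIV. Poly_Mapping.lookup m j) = 1" by (simp add: lookup_single when_def)
qed

text \<open>The point is cut out by the linear forms that vanish on \<open>v\<close>. Among them are
  the minors \<open>v $ k * w $ j - v $ j * w $ k\<close>, which force \<open>w\<close> to be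
  proportional to \<open>v\<close> when \<open>v $ k\<close> is nonzero.\<close>

lemma zariski_closed_singleton: "zariski_closed {p}"
proof -
  obtain v where v: "v \<noteq> 0" "p = abs_proj v" by (rule abs_proj_cases)
  define S where "S = {linear_cpoly a | a. (\<Sum>i\<in>UNIV. a $ i * v $ i) = 0}"
  have S: "homogeneous_set S" using homogeneous_linear by (fastforce simp: S_def homogeneous_set_def)
  have "{p} = zero_locus S"
  proof (rule proj_set_eqI)
    fix w :: "complex ^ 'a" assume w: "w \<noteq> 0"
    show "abs_proj w \<in> {p} \<longleftrightarrow> abs_proj w \<in> zero_locus S"
    proof
      assume "abs_proj w \<in> {p}"
      then show "abs_proj w \<in> zero_locus S"
        using abs_proj_in_zero_locus[OF S v(1)] v(2) by (auto simp: S_def cpoly_eval_linear)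
    next
      assume "abs_proj w \<in> zero_locus S"
      then have *: "(\<Sum>i\<in>UNIV. a $ i * w $ i) = 0" if "(\<Sum>i\<in>UNIV. a $ i * v $ i) = 0" for a
        using abs_proj_in_zero_locus[OF S w] that by (auto simp: S_def cpoly_eval_linear)
      obtain k where k: "v $ k \<noteq> 0" using v(1) by (auto simp: vec_eq_iff)
      have cross: "v $ k * w $ j = v $ j * w $ k" for j
      proof -
        define a where "a = (\<chi> i. (if i = j then v $ k else 0) - (if i = k then v $ j else 0))"
        have "(\<Sum>i\<in>UNIV. a $ i * y $ i) = v $ k * y $ j - v $ j * y $ k" for y
          by (simp add: a_def left_diff_distrib sum_subtractf if_distrib[of "\<lambda>x. x * _"] cong: if_cong)
        with *[of a] show ?thesis by simp
      qed
      have eq: "w = (w $ k / v $ k) *s v"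
        using cross k by (simp add: vec_eq_iff field_simps)
      then have "w $ k / v $ k \<noteq> 0" using w by auto
      then have "abs_proj v = abs_proj w" using eq v(1) w abs_proj_eq_iff[of v w] by blast
      then show "abs_proj w \<in> {p}" using v(2) by simp
    qed
  qed
  with S show ?thesis by (auto simp: zariski_closed_iff)
qed

lemma zariski_irreducible_singleton: "zariski_irreducible {p}"
  by (auto simp: zariski_irreducible_def)

text \<open>A minimal infinite closed subset is irreducible and contains a closed point.\<close>

lemma finite_if_zariski_dim_0:
  fixes X :: "'n::finite proj set"
  assumes closed: "zariski_closed X" and dim: "zariski_dim X = 0"
  shows "finite X"
proof (rule ccontr)
  assume inf: "infinite X"
  define P where "P Z \<longleftrightarrow> zariski_closed Z \<and> infinite Z \<and> Z \<subseteq> X" for Z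
  have "\<exists>Z. P Z \<and> (\<forall>Z'. P Z' \<longrightarrow> \<not> Z' \<subset> Z)"
  proof (rule ccontr)
    assume "\<not> ?thesis"
    then have step: "\<And>Z. P Z \<Longrightarrow> \<exists>Z'. P Z' \<and> Z' \<subset> Z" by blast
    have "\<exists>Z. \<forall>n. P (Z n) \<and> Z (Suc n) \<subset> Z n"
    proof (rule dependent_nat_choice)
      show "\<exists>Z. P Z" using closed inf by (auto simp: P_def)
    qed (use step in blast)
    then obtain Z where Z: "\<forall>n. P (Z n) \<and> Z (Suc n) \<subset> Z n" by (elim exE)
    show False by (rule no_infinite_zariski_descent[of Z]) (use Z in \<open>auto simp: P_def\<close>)
  qed
  then obtain Z where Z: "P Z" and min: "\<And>Z'. P Z' \<Longrightarrow> \<not> Z' \<subset> Z" by blast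
  have Z': "zariski_closed Z" "infinite Z" "Z \<subseteq> X" using Z by (auto simp: P_def)
  have irr: "zariski_irreducible Z"
    unfolding zariski_irreducible_def
  proof (intro conjI allI impI)
    show "Z \<noteq> {}" using Z'(2) by auto
    fix A B :: "'n proj set" assume AB: "zariski_closed A \<and> zariski_closed B \<and> Z \<subseteq> A \<union> B"
    \<comment> \<open>Otherwise \<open>Z \<inter> C\<close> would contradict the minimality of
      \<open>Z\<close>. Of two closed sets covering the infinite \<open>Z\<close>, one meets it in
      infinitely many points.\<close>
    have sub: "Z \<subseteq> C" if "zariski_closed C" "infinite (Z \<inter> C)" for C
    proof -
      have "P (Z \<inter> C)" using that Z' zariski_closed_Int by (auto simp: P_def)
      from min[OF this] show ?thesis by blast
    qed
    have "infinite (Z \<inter> A) \<or> infinite (Z \<inter> B)"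
    proof (rule ccontr)
      assume "\<not> ?thesis"
      then have "finite ((Z \<inter> A) \<union> (Z \<inter> B))" by simp
      moreover have "Z = (Z \<inter> A) \<union> (Z \<inter> B)" using AB by blast
      ultimately show False using Z'(2) by simp
    qed
    then show "Z \<subseteq> A \<or> Z \<subseteq> B" using sub AB by blast
  qed
  obtain p where p: "p \<in> Z" using Z'(2) by fastforce
  \<comment> \<open>A chain of length 1; it is strict because \<open>Z\<close> is infinite, and so
    the dimension is at least 1.\<close>
  define C where "C k = (if k = 0 then {p} else Z)" for k :: nat
  have "\<exists>Z :: nat \<Rightarrow> 'n proj set.
     (\<forall>k\<le>1. zariski_closed (Z k) \<and> zariski_irreducible (Z k) \<and> Z k \<subseteq> X) \<and> (\<forall>k<1. Z k \<subset> Z (Suc k))"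
  proof (intro exI[of _ C] conjI allI impI)
    fix k :: nat
    show "zariski_closed (C k)" "zariski_irreducible (C k)" "C k \<subseteq> X"
      using Z' irr p zariski_closed_singleton zariski_irreducible_singleton by (auto simp: C_def)
    assume "k < 1"
    moreover have "Z \<noteq> {p}" using Z'(2) by auto
    ultimately show "C k \<subset> C (Suc k)" using p by (auto simp: C_def)
  qed
  then have "ereal (real 1) \<le> zariski_dim X" unfolding zariski_dim_def by (intro Sup_upper) blast
  then show False using dim by simp
qed

text \<open>A form that works for \<open>A\<close> is moved by \<open>t\<close> along a coordinate
  \<open>k\<close> with \<open>w $ k\<close> nonzero. Each vector with nonzero coordinate
  \<open>k\<close> excludes one value of \<open>t\<close>, and the others do not notice the
  change.\<close>

lemma linear_form_avoiding:
  assumes "finite A" "\<And>v. v \<in> A \<Longrightarrow> v \<noteq> 0"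
  shows "\<exists>a :: complex ^ 'n::finite. \<forall>v\<in>A. (\<Sum>i\<in>UNIV. a $ i * v $ i) \<noteq> 0"
  using assms
proof (induction A)
  case (insert w A)
  define L :: "complex ^ 'n \<Rightarrow> complex ^ 'n \<Rightarrow> complex" where "L a v = (\<Sum>i\<in>UNIV. a $ i * v $ i)" for a v
  obtain a where a: "\<And>v. v \<in> A \<Longrightarrow> L a v \<noteq> 0" using insert by (auto simp: L_def)
  obtain k where k: "w $ k \<noteq> 0" using insert.prems by (auto simp: vec_eq_iff)
  have L: "L (a + t *s axis k 1) v = L a v + t * v $ k" for t v
    by (simp add: L_def axis_def distrib_right sum.distrib if_distrib[of "\<lambda>x. x * _"] if_distrib[of "\<lambda>x. _ * x"] cong: if_cong)
  have "finite ((\<lambda>v. - L a v / v $ k) ` insert w A)" using insert.hyps by simp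
  then obtain t where t: "t \<notin> insert 0 ((\<lambda>v. - L a v / v $ k) ` insert w A)"
    using ex_new_if_finite[OF infinite_UNIV_char_0] by (metis finite_insert)
  have "L a v + t * v $ k \<noteq> 0" if v: "v \<in> insert w A" for v
  proof (cases "v $ k = 0")
    case True
    then have "v \<in> A" using v k by auto
    then show ?thesis using a True by simp
  next
    case False
    have "t \<noteq> - L a v / v $ k" using t v by blast
    then show ?thesis using False by (auto simp: field_simps add_eq_0_iff2)
  qed
  then show ?case using L unfolding L_def by metis
qed auto

section \<open>Omitted hypersurfaces\<close>

lemma norm_vec_eq_sqnorm: "norm (F z) = sqrt (sqnorm F z)"
  by (simp add: norm_vec_def L2_set_def sqnorm_def)

lemma norm_scalar_mult: "norm (c *s v) = cmod c * norm (v :: complex ^ 'n::finite)"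
  by (simp add: norm_vec_def norm_mult L2_set_right_distrib)

lemma log_norm_eq_ln_norm: "entire_curve F \<Longrightarrow> log_norm F z = ln (norm (F z))"
  using sqnorm_pos[of F z] by (simp add: log_norm_def norm_vec_eq_sqnorm ln_sqrt)

lemma continuous_on_cpoly_eval: "continuous_on S (cpoly_eval Q)"
  unfolding cpoly_eval_def by (intro continuous_intros)

lemma holomorphic_cpoly_eval:
  "entire_curve F \<Longrightarrow> (\<lambda>z. cpoly_eval Q (F z)) holomorphic_on UNIV"
  unfolding cpoly_eval_def entire_curve_def by (auto intro!: holomorphic_intros)

text \<open>Continuity bounds the derivative on a compact disc, the assumption bounds it outside.
  With \<open>1 + cmod z\<close> in place of \<open>cmod z\<close> the majorant is positive and
  finite at the origin too; the exponent \<open>\<bar>\<sigma>\<bar>\<close> handles both signs of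
  \<open>\<sigma>\<close>.\<close>

lemma fs_deriv_global_bound:
  assumes rep: "homogeneous_rep f F" and O: "fs_deriv f \<in> O[at_infinity](\<lambda>z. norm z powr \<sigma>)"
  obtains K where "\<And>z. fs_deriv_rep F z \<le> K * (1 + cmod z) powr \<sigma>"
proof -
  have F: "entire_curve F" using rep by (simp add: homogeneous_rep_iff)
  have nonneg: "0 \<le> fs_deriv_rep F z" for z
    unfolding fs_deriv_rep_def by (intro real_sqrt_ge_zero divide_nonneg_nonneg sum_nonneg) auto
  obtain c where c: "c > 0" "eventually (\<lambda>z. norm (fs_deriv f z) \<le> c * norm (norm z powr \<sigma>)) at_infinity"
    using O by (elim landau_o.bigE)
  then obtain R0 where R0: "\<And>z. cmod z \<ge> R0 \<Longrightarrow> fs_deriv_rep F z \<le> c * cmod z powr \<sigma>"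
    unfolding eventually_at_infinity fs_deriv_eq_rep[OF rep] by force
  define R where "R = max R0 1"
  have cont: "continuous_on (cball 0 R) (\<lambda>z. (fs_deriv_rep F z)\<^sup>2)"
    using continuous_on_subset[OF continuous_on_fs_deriv_rep_sq[OF F]] by blast
  have "cball 0 R \<noteq> ({} :: complex set)" by (simp add: R_def)
  from continuous_attains_sup[OF compact_cball this cont]
  obtain z0 where z0: "\<forall>z\<in>cball 0 R. (fs_deriv_rep F z)\<^sup>2 \<le> (fs_deriv_rep F z0)\<^sup>2" by (rule bexE) (rule that)
  define M where "M = fs_deriv_rep F z0"
  have M: "fs_deriv_rep F z \<le> M" if "cmod z \<le> R" for z
  proof -
    have "z \<in> cball 0 R" using that by simp
    with z0 have "(fs_deriv_rep F z)\<^sup>2 \<le> (fs_deriv_rep F z0)\<^sup>2" by (rule bspec)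
    then show ?thesis unfolding M_def using nonneg[of z0] by (rule power2_le_imp_le)
  qed
  have M0: "M \<ge> 0" by (simp add: M_def nonneg)
  have "fs_deriv_rep F z \<le> (c * 2 powr \<bar>\<sigma>\<bar> + M * (1 + R) powr \<bar>\<sigma>\<bar>) * (1 + cmod z) powr \<sigma>" for z
  proof (cases "cmod z \<le> R")
    case True
    have "1 = (1 + R) powr \<bar>\<sigma>\<bar> * (1 + R) powr (- \<bar>\<sigma>\<bar>)" by (simp add: powr_minus R_def)
    also have "\<dots> \<le> (1 + R) powr \<bar>\<sigma>\<bar> * (1 + cmod z) powr \<sigma>"
    proof (rule mult_left_mono)
      have "(1 + R) powr (- \<bar>\<sigma>\<bar>) \<le> (1 + cmod z) powr (- \<bar>\<sigma>\<bar>)"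
        using True by (intro powr_mono2') (auto simp: add_pos_nonneg)
      also have "\<dots> \<le> (1 + cmod z) powr \<sigma>" by (intro powr_mono) auto
      finally show "(1 + R) powr (- \<bar>\<sigma>\<bar>) \<le> (1 + cmod z) powr \<sigma>" .
    qed simp
    finally have "1 \<le> (1 + R) powr \<bar>\<sigma>\<bar> * (1 + cmod z) powr \<sigma>" .
    from mult_left_mono[OF this M0] M[OF True]
    have "fs_deriv_rep F z \<le> M * (1 + R) powr \<bar>\<sigma>\<bar> * (1 + cmod z) powr \<sigma>" by simp
    then show ?thesis using c(1) by (simp add: distrib_right add_increasing)
  next
    case False
    then have z: "cmod z \<ge> 1" "cmod z \<ge> R0" by (auto simp: R_def)
    have "cmod z powr \<sigma> \<le> 2 powr \<bar>\<sigma>\<bar> * (1 + cmod z) powr \<sigma>"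
    proof (cases "\<sigma> \<ge> 0")
      case True
      have "1 * cmod z powr \<sigma> \<le> 2 powr \<bar>\<sigma>\<bar> * (1 + cmod z) powr \<sigma>"
        using True z by (intro mult_mono powr_mono2 ge_one_powr_ge_zero) auto
      then show ?thesis by simp
    next
      case False
      have "cmod z powr \<sigma> \<le> ((1 + cmod z) / 2) powr \<sigma>" using False z by (intro powr_mono2') auto
      also have "\<dots> = 2 powr \<bar>\<sigma>\<bar> * (1 + cmod z) powr \<sigma>"
        using False by (simp add: powr_divide powr_minus_divide)
      finally show ?thesis .
    qed
    then have "c * cmod z powr \<sigma> \<le> c * (2 powr \<bar>\<sigma>\<bar> * (1 + cmod z) powr \<sigma>)"
      using c(1) by (intro mult_left_mono) auto
    with R0[OF z(2)] have "fs_deriv_rep F z \<le> c * 2 powr \<bar>\<sigma>\<bar> * (1 + cmod z) powr \<sigma>" by simp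
    then show ?thesis using M0 by (simp add: distrib_right add_increasing2)
  qed
  then show ?thesis using that by blast
qed

theorem theorem1:
  fixes V :: "'n::{finite,linorder} proj set"
    and D :: "nat \<Rightarrow> 'n cpoly"
    and q :: nat
    and f :: "complex \<Rightarrow> 'n proj"
    and \<sigma> :: real
  assumes "projective_variety V"
    and "\<And>i. i \<in> {1..q} \<Longrightarrow> hypersurface_poly (D i)"
    and "zariski_dim ((\<Inter>i\<in>{1..q}. Supp (D i)) \<inter> V) = 0"
    and "holomorphic_curve f"
    and "range f \<subseteq> V"
    and "\<sigma> > -1"
    and "fs_deriv f \<in> O[at_infinity](\<lambda>z. norm z powr \<sigma>)"
    and "(\<Union>i\<in>{1..q}. Supp (D i)) \<inter> range f = {}"
  shows "nevanlinna_char f \<in> O[at_top](\<lambda>r. r powr (\<sigma> + 1))"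
proof -
  let ?I = "{1..q}"
  define X where "X = (\<Inter>i\<in>?I. Supp (D i)) \<inter> V"
  have "zariski_closed X"
    unfolding X_def by (intro zariski_closed_Int zariski_closed_INT zariski_closed_Supp assms) auto
  then have finX: "finite X" using finite_if_zariski_dim_0 assms(3) by (simp add: X_def)
  have "\<forall>p :: 'n proj. \<exists>v. v \<noteq> 0 \<and> p = abs_proj v" by (metis abs_proj_cases)
  from choice[OF this] obtain rep :: "'n proj \<Rightarrow> (complex, 'n) vec" where rep: "\<forall>p. rep p \<noteq> 0 \<and> p = abs_proj (rep p)" by (elim exE)
  have "\<exists>a :: (complex, 'n) vec. \<forall>v\<in>rep ` X. (\<Sum>i\<in>UNIV. a $ i * v $ i) \<noteq> 0"
  proof (rule linear_form_avoiding)
    show "finite (rep ` X)" using finX by simp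
    show "v \<noteq> 0" if "v \<in> rep ` X" for v using that rep by auto
  qed
  then obtain a :: "(complex, 'n) vec" where a: "\<forall>v\<in>rep ` X. (\<Sum>i\<in>UNIV. a $ i * v $ i) \<noteq> 0" by (elim exE)
  \<comment> \<open>The hypersurfaces are numbered from 1, and index 0 is given to the auxiliary
    linear form.\<close>
  define P where "P i = (if i = 0 then linear_cpoly a else D i)" for i :: nat
  have "\<forall>i\<in>?I. \<exists>d>0. homogeneous d (D i)"
    using assms(2) by (auto simp: hypersurface_poly_def)
  from bchoice[OF this] obtain d' where d': "\<forall>i\<in>?I. d' i > 0 \<and> homogeneous (d' i) (D i)" by (elim exE)
  define d where "d i = (if i = 0 then 1 else d' i)" for i
  have d: "d i > 0" "homogeneous (d i) (P i)" if "i \<in> {0..q}" for i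
    using d' that homogeneous_linear[of a] by (auto simp: d_def P_def)
  obtain F where F: "homogeneous_rep f F" using homogeneous_rep_exists[OF assms(4)] by blast
  have ecF: "entire_curve F" and fF: "f z = abs_proj (F z)" and F0: "F z \<noteq> 0" for z
    using F by (auto simp: homogeneous_rep_iff entire_curve_def)
  obtain S where S: "homogeneous_set S" "V = zero_locus S" using assms(1) zariski_closed_iff by blast
  have FS: "cpoly_eval Q (F z) = 0" if "Q \<in> S" for Q z
    using assms(5) abs_proj_in_zero_locus[OF S(1) F0] that by (auto simp: fF S(2))
  \<comment> \<open>The unit vectors of the affine cone over \<open>V\<close>: compactness is used
    here, with the topology of the vector space.\<close>
  define K where "K = {v :: (complex, 'n) vec. norm v = 1 \<and> (\<forall>Q\<in>S. cpoly_eval Q v = 0)}"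
  have K_eq: "K = sphere 0 1 \<inter> (\<Inter>Q\<in>S. {v. cpoly_eval Q v = 0})" by (auto simp: K_def)
  have compK: "compact K"
    unfolding K_eq
    by (intro compact_Int_closed closed_INT ballI closed_Collect_eq continuous_on_cpoly_eval continuous_on_const) auto
  define G where "G v = (\<Sum>i\<in>{0..q}. cmod (cpoly_eval (P i) v))" for v
  have contG: "continuous_on K G" unfolding G_def
    by (intro continuous_intros continuous_on_cpoly_eval)
  \<comment> \<open>A common zero of the hypersurface polynomials in \<open>K\<close> represents a
    point of \<open>X\<close>, and there the linear form does not vanish.\<close>
  have Gpos: "G v > 0" if v: "v \<in> K" for v
  proof -
    have v0: "v \<noteq> 0" using v by (auto simp: K_def)
    have "\<exists>i\<in>{0..q}. cpoly_eval (P i) v \<noteq> 0"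
    proof (rule ccontr)
      assume "\<not> ?thesis"
      then have zero: "cpoly_eval (P i) v = 0" if "i \<in> {0..q}" for i using that by blast
      have "abs_proj v \<in> Supp (D i)" if "i \<in> ?I" for i
        using zero[of i] that v0 by (auto simp: Supp_def zero_locus_def P_def)
      moreover have "abs_proj v \<in> V" using v v0 by (auto simp: S(2) zero_locus_def K_def)
      ultimately have "abs_proj v \<in> X" by (auto simp: X_def)
      then have "(\<Sum>i\<in>UNIV. a $ i * rep (abs_proj v) $ i) \<noteq> 0" using a by blast
      moreover obtain c where "c \<noteq> 0" "rep (abs_proj v) = c *s v"
        using abs_proj_eq_iff[OF v0, of "rep (abs_proj v)"] rep by metis
      ultimately have "(\<Sum>i\<in>UNIV. a $ i * v $ i) \<noteq> 0"
        by (auto simp: mult.left_commute simp flip: sum_distrib_left)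
      moreover have "(\<Sum>i\<in>UNIV. a $ i * v $ i) = 0" using zero[of 0] by (simp add: P_def cpoly_eval_linear)
      ultimately show False by simp
    qed
    then obtain i where "i \<in> {0..q}" "cpoly_eval (P i) v \<noteq> 0" by blast
    then show ?thesis unfolding G_def by (intro sum_pos2[of _ i]) auto
  qed
  have FK: "inverse (of_real (norm (F z))) *s F z \<in> K" for z
  proof -
    have "cpoly_eval Q (inverse (of_real (norm (F z))) *s F z) = 0" if Q: "Q \<in> S" for Q
    proof -
      obtain e where "homogeneous e Q" using S(1) Q by (auto simp: homogeneous_set_def)
      from cpoly_eval_scale[OF this] FS[OF Q] show ?thesis by simp
    qed
    moreover have "norm (inverse (of_real (norm (F z))) *s F z) = 1"
      using F0[of z] by (simp add: norm_scalar_mult norm_inverse)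
    ultimately show ?thesis by (simp add: K_def)
  qed
  have Kne: "K \<noteq> {}" using FK by blast
  obtain v0 where v0: "v0 \<in> K" "\<forall>v\<in>K. G v0 \<le> G v" using continuous_attains_inf[OF compK Kne contG] by blast
  obtain v1 where v1: "v1 \<in> K" "\<forall>v\<in>K. G v \<le> G v1" using continuous_attains_sup[OF compK Kne contG] by blast
  \<comment> \<open>If the sum of \<open>Suc q\<close> moduli is at least \<open>G v0\<close>, one
    of them is at least the average. The bounds \<open>c \<le> 1\<close> and, below,
    \<open>B \<ge> 1\<close> fix the signs of their logarithms, so dividing by a degree keeps the
    estimates.\<close>
  define c where "c = min 1 (G v0 / real (Suc q))"
  have c: "0 < c" "c \<le> 1" using Gpos[OF v0(1)] by (auto simp: c_def)
  define B where "B = max 1 (G v1)"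
  have B: "B \<ge> 1" by (simp add: B_def)
  \<comment> \<open>Dividing by the degree gives all these functions weight one: wherever the
    polynomial is nonzero, scaling \<open>F\<close> shifts \<open>w i\<close> by the same amount as
    \<open>log_norm F\<close>.\<close>
  define w where "w i z = 1 / d i * ln (cmod (cpoly_eval (P i) (F z)))" for i z
  define n where "n z = norm (F z)" for z
  define u where "u z = inverse (of_real (n z)) *s F z" for z
  have n0: "n z > 0" for z using F0 by (simp add: n_def)
  have uK: "u z \<in> K" for z using FK by (simp add: u_def n_def)
  have Fu: "F z = of_real (n z) *s u z" for z using n0[of z] by (simp add: u_def vector_smult_assoc)
  have norm_eval: "cmod (cpoly_eval (P i) (F z)) = n z ^ d i * cmod (cpoly_eval (P i) (u z))" if "i \<in> {0..q}" for i z
    by (subst Fu, subst cpoly_eval_scale[OF d(2)[OF that]]) (use n0[of z] in \<open>simp add: norm_mult norm_power\<close>)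
  have w_eq: "w i z = log_norm F z + 1 / d i * ln (cmod (cpoly_eval (P i) (u z)))"
    if "i \<in> {0..q}" "cpoly_eval (P i) (u z) \<noteq> 0" for i z
    unfolding w_def norm_eval[OF that(1)] log_norm_eq_ln_norm[OF ecF] n_def[symmetric]
    using n0[of z] d(1)[OF that(1)] that(2) by (simp add: ln_mult ln_realpow field_simps)
  have nz_iff: "cpoly_eval (P i) (F z) = 0 \<longleftrightarrow> cpoly_eval (P i) (u z) = 0" if "i \<in> {0..q}" for i z
    using norm_eval[OF that, of z] n0[of z] by (metis mult_eq_0_iff norm_eq_zero power_not_zero less_irrefl)
  have upper: "w i z \<le> log_norm F z + ln B" if i: "i \<in> {0..q}" and nz: "cpoly_eval (P i) (F z) \<noteq> 0" for i z
  proof -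
    have nzu: "cpoly_eval (P i) (u z) \<noteq> 0" using nz nz_iff[OF i] by simp
    have "cmod (cpoly_eval (P i) (u z)) \<le> G (u z)" unfolding G_def by (rule member_le_sum[OF i]) auto
    also have "\<dots> \<le> B" using v1(2) uK[of z] by (auto simp: B_def)
    finally have "ln (cmod (cpoly_eval (P i) (u z))) \<le> ln B"
      using nzu B by (subst ln_le_cancel_iff) auto
    then have "1 / d i * ln (cmod (cpoly_eval (P i) (u z))) \<le> 1 / d i * ln B" by (intro mult_left_mono) auto
    also have "\<dots> \<le> 1 * ln B" using d(1)[OF i] B by (intro mult_right_mono) auto
    finally show ?thesis using w_eq[OF i nzu] by simp
  qed
  have lower: "\<exists>i\<in>{0..q}. cpoly_eval (P i) (F z) \<noteq> 0 \<and> w i z \<ge> log_norm F z + ln c" for z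
  proof -
    have "\<exists>i\<in>{0..q}. cmod (cpoly_eval (P i) (u z)) \<ge> c"
    proof (rule ccontr)
      assume "\<not> ?thesis"
      then have "G (u z) < (\<Sum>i\<in>{0..q}. c)" unfolding G_def by (intro sum_strict_mono) (auto simp: not_le)
      also have "\<dots> = real (Suc q) * c" by simp
      also have "\<dots> \<le> real (Suc q) * (G v0 / real (Suc q))" by (intro mult_left_mono) (auto simp: c_def)
      also have "\<dots> = G v0" by simp
      finally show False using v0(2) uK[of z] by force
    qed
    then obtain i where i: "i \<in> {0..q}" "cmod (cpoly_eval (P i) (u z)) \<ge> c" by blast
    have nzu: "cpoly_eval (P i) (u z) \<noteq> 0" using i(2) c(1) by auto
    have "1 * ln c \<le> 1 / d i * ln c"
      using d(1)[OF i(1)] c by (intro mult_right_mono_neg) auto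
    also have "\<dots> \<le> 1 / d i * ln (cmod (cpoly_eval (P i) (u z)))"
      using i(2) c(1) nzu by (intro mult_left_mono) (auto simp: ln_le_cancel_iff)
    finally have "w i z \<ge> log_norm F z + ln c" using w_eq[OF i(1) nzu] by simp
    then show ?thesis using i(1) nz_iff[OF i(1)] nzu by blast
  qed
  have harm: "re_holo UNIV (w i)" if "\<And>z. cpoly_eval (P i) (F z) \<noteq> 0" for i
    unfolding w_def by (intro re_holo_scale re_holo_ln_norm holomorphic_cpoly_eval[OF ecF] that) auto
  have nz: "cpoly_eval (P i) (F z) \<noteq> 0" if "i \<in> ?I" for i z
  proof
    assume "cpoly_eval (P i) (F z) = 0"
    then have "f z \<in> Supp (D i)" using that F0[of z] by (auto simp: P_def Supp_def zero_locus_def fF)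
    then show False using assms(8) that by blast
  qed
  have w0: "w 0 z = ln (cmod (cpoly_eval (P 0) (F z)))" for z by (simp add: w_def d_def)
  have "\<exists>u C. re_holo UNIV u \<and> (\<forall>z. \<bar>log_norm F z - u z\<bar> \<le> C * (1 + cmod z) powr (\<sigma> + 1))"
  \<comment> \<open>Without hypersurfaces only the linear form is left. The lower bound, which then
    must come from index 0, shows that it has no zeros along \<open>F\<close>, so \<open>w 0\<close>
    is itself the harmonic function.\<close>
  proof (cases "q = 0")
    case True
    have nz0: "cpoly_eval (P 0) (F z) \<noteq> 0" and low0: "w 0 z \<ge> log_norm F z + ln c" for z
      using lower[of z] True by auto
    have "\<bar>log_norm F z - w 0 z\<bar> \<le> (ln B - ln c) * (1 + cmod z) powr (\<sigma> + 1)" for z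
    proof -
      have *: "ln B \<ge> 0" "ln c \<le> 0" using B c by auto
      have "\<bar>log_norm F z - w 0 z\<bar> \<le> (ln B - ln c) * 1"
        using low0[of z] upper[OF _ nz0, of z] * by (simp add: abs_le_iff)
      also have "\<dots> \<le> (ln B - ln c) * (1 + cmod z) powr (\<sigma> + 1)"
        using * assms(6) by (intro mult_left_mono ge_one_powr_ge_zero) auto
      finally show ?thesis .
    qed
    then show ?thesis using harm[of 0, OF nz0] by blast
  next
    case False
    obtain K0 where K0: "\<And>z. fs_deriv_rep F z \<le> K0 * (1 + cmod z) powr \<sigma>"
      using fs_deriv_global_bound[OF F assms(7)] by blast
    define W where "W z = Max ((\<lambda>i. w i z) ` ?I)" for z
    have I: "finite ?I" "?I \<noteq> {}" using False by auto
    have comp: "\<bar>ln (max (cmod (cpoly_eval (P 0) (F z))) (exp (W z))) - log_norm F z\<bar> \<le> ln B - ln c" for z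
    proof -
      let ?m = "max (cmod (cpoly_eval (P 0) (F z))) (exp (W z))"
      have *: "ln B \<ge> 0" "ln c \<le> 0" using B c by auto
      have mpos: "?m > 0" by (simp add: less_max_iff_disj)
      have wW: "w i z \<le> W z" if "i \<in> ?I" for i using that by (simp add: W_def)
      have "W z \<le> log_norm F z + ln B"
        unfolding W_def by (rule Max.boundedI) (use I upper nz in auto)
      moreover have "cmod (cpoly_eval (P 0) (F z)) \<le> exp (log_norm F z + ln B)"
      proof (cases "cpoly_eval (P 0) (F z) = 0")
        case False
        then have "ln (cmod (cpoly_eval (P 0) (F z))) \<le> log_norm F z + ln B" using upper[of 0 z] w0 by simp
        then show ?thesis using False by (metis exp_le_cancel_iff exp_ln zero_less_norm_iff)
      qed simp
      ultimately have "?m \<le> exp (log_norm F z + ln B)" by simp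
      then have up: "ln ?m \<le> log_norm F z + ln B" using mpos by (metis exp_le_cancel_iff exp_ln)
      obtain i where i: "i \<in> {0..q}" "cpoly_eval (P i) (F z) \<noteq> 0" "w i z \<ge> log_norm F z + ln c"
        using lower by blast
      have "w i z \<le> ln ?m"
      proof (cases "i = 0")
        case True
        then show ?thesis using i(2) mpos by (simp add: w0)
      next
        case False
        then have "exp (w i z) \<le> ?m" using wW[of i] i(1) by (simp add: le_max_iff_disj)
        then show ?thesis using mpos by (metis exp_le_cancel_iff exp_ln)
      qed
      then show ?thesis using up i(3) * by (simp add: abs_le_iff)
    qed
    obtain k C where k: "k \<in> ?I" and C: "\<forall>z. \<bar>log_norm F z - w k z\<bar> \<le> C * (1 + cmod z) powr (\<sigma> + 1)"
      using log_norm_growth[OF ecF K0 assms(6) holomorphic_cpoly_eval[OF ecF] I harm[OF nz] comp[unfolded W_def]]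
      by blast
    then show ?thesis using harm[OF nz[OF k]] by blast
  qed
  then obtain h C where "re_holo UNIV h" "\<And>z. \<bar>log_norm F z - h z\<bar> \<le> C * (1 + cmod z) powr (\<sigma> + 1)" by blast
  from nevanlinna_char_bigo[OF F assms(6) this] show ?thesis .
qed

end
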